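(* Let $d\ge 2$ and let $(\rho,v)$ be a smooth solution on $\mathbb{R}^d$ of the stationary barotropic compressible Navier–Stokes system $$\nabla\cdot(\rho v)=0,\qquad \nabla\cdot(\rho v\otimes v)=-\nabla P+\mu\Delta v+(\mu+\lambda)\nabla(\nabla\cdot v),\qquad P=A\rho^\gamma .$$ Assume: <ul> <li>if $d\ge 4$: $\|\rho\|_{L^\infty(\mathbb{R}^d)}<\infty$ and $v\in \dot H^1(\mathbb{R}^d)$;</li> <li>if $d=3$: $\|\rho\|_{L^\infty(\mathbb{R}^3)}+\|\nabla v\|_{L^2(\mathbb{R}^3)}+\|v\|_{L^{9/2}(\mathbb{R}^3)}<\infty$;</li> <li>if $d=2$: $\|\rho\|_{L^\infty(\mathbb{R}^2)}+\|\nabla v\|_{L^2(\mathbb{R}^2)}+\|v\|_{L^{6}(\mathbb{R}^2)}<\infty$.</li> </ul> Then $v\equiv 0$ and $\rho$ is constant on $\mathbb{R}^d$.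
   Context: $\rho:\mathbb{R}^d\to[0,\infty)$ is the density, $v:\mathbb{R}^d\to\mathbb{R}^d$ the velocity, $P$ the pressure. The constants satisfy $\mu>0$, $\lambda+2\mu>0$, $A>0$, $\gamma>1$. $(\nabla\cdot(\rho v\otimes v))_j=\sum_i\partial_i(\rho v_iv_j)$. The space $\dot H^1(\mathbb{R}^d)$ is the completion of $C_c^\infty(\mathbb{R}^d)$ under the norm $\|\nabla f\|_{L^2(\mathbb{R}^d)}$ (so in particular, for $d\ge 3$, $v\in L^{2d/(d-2)}(\mathbb{R}^d)$ and $\nabla v\in L^2$). *)

theory Defs
  imports "HOL-Analysis.Analysis"
begin

definition partial :: "'n::finite \<Rightarrow> (real^'n \<Rightarrow> 'b::real_normed_vector) \<Rightarrow> real^'n \<Rightarrow> 'b" where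
  "partial i f x = vector_derivative (\<lambda>t. f (x + t *\<^sub>R axis i 1)) (at 0)"

fun iter_partial :: "'n::finite list \<Rightarrow> (real^'n \<Rightarrow> real) \<Rightarrow> real^'n \<Rightarrow> real" where
  "iter_partial [] f = f"
| "iter_partial (i # is) f = partial i (iter_partial is f)"

definition smooth :: "(real^'n::finite \<Rightarrow> real) \<Rightarrow> bool" where
  "smooth f \<longleftrightarrow> (\<forall>is x. iter_partial is f differentiable (at x))"

definition smooth_vf :: "(real^'n::finite \<Rightarrow> real^'n) \<Rightarrow> bool" where
  "smooth_vf v \<longleftrightarrow> (\<forall>j. smooth (\<lambda>x. v x $ j))"

definition divergence :: "(real^'n::finite \<Rightarrow> real^'n) \<Rightarrow> real^'n \<Rightarrow> real" where
  "divergence v x = (\<Sum>i\<in>UNIV. partial i (\<lambda>y. v y $ i) x)"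

definition grad_sq :: "(real^'n::finite \<Rightarrow> real^'n) \<Rightarrow> real^'n \<Rightarrow> real" where
  "grad_sq v x = (\<Sum>i\<in>UNIV. \<Sum>j\<in>UNIV. (partial i (\<lambda>y. v y $ j) x)\<^sup>2)"

definition grad_L2 :: "(real^'n::finite \<Rightarrow> real^'n) \<Rightarrow> bool" where
  "grad_L2 v \<longleftrightarrow> integrable lborel (grad_sq v)"

definition in_Lp :: "real \<Rightarrow> (real^'n::finite \<Rightarrow> real^'n) \<Rightarrow> bool" where
  "in_Lp p v \<longleftrightarrow> integrable lborel (\<lambda>x. norm (v x) powr p)"

definition compact_supp :: "(real^'n::finite \<Rightarrow> real^'n) \<Rightarrow> bool" where
  "compact_supp f \<longleftrightarrow> (\<exists>K. compact K \<and> (\<forall>x. x \<notin> K \<longrightarrow> f x = 0))"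

text \<open>Homogeneous Sobolev space dot H^1 (for d >= 3): the completion of C_c^infinity under
  the norm of the gradient in L^2, realised (via the Sobolev embedding) as the functions v
  with gradient in L^2 and v in L^(2d/(d-2)) that are limits of C_c^infinity fields phi_k with
  nabla phi_k -> nabla v in L^2 and phi_k -> v in L^(2d/(d-2)).\<close>
definition Hdot1 :: "(real^'n::finite \<Rightarrow> real^'n) \<Rightarrow> bool" where
  "Hdot1 v \<longleftrightarrow>
     (let d = real CARD('n); q = 2 * d / (d - 2) in
      grad_L2 v \<and> in_Lp q v \<and>
      (\<exists>\<phi> :: nat \<Rightarrow> real^'n \<Rightarrow> real^'n.
         (\<forall>k. smooth_vf (\<phi> k) \<and> compact_supp (\<phi> k)) \<and>
         (\<forall>k. grad_L2 (\<lambda>x. \<phi> k x - v x) \<and> in_Lp q (\<lambda>x. \<phi> k x - v x)) \<and>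
         (\<lambda>k. integral\<^sup>L lborel (grad_sq (\<lambda>x. \<phi> k x - v x))) \<longlonglongrightarrow> 0 \<and>
         (\<lambda>k. integral\<^sup>L lborel (\<lambda>x. norm (\<phi> k x - v x) powr q)) \<longlonglongrightarrow> 0))"

end

theory Submission
  imports Defs
begin

text \<open>The momentum equation is tested with the velocity times a radial cut-off. Because
  v . grad P = gamma / (gamma - 1) div ((P - kappa rho) v) for every constant kappa, the pressure
  enters only through P - c with a constant c that may depend on the radius R, and the flux through
  the annulus R < |x| < 2R vanishes in the limit once P - c is controlled in L2 on balls.

  That control needs no singular integrals. Test the momentum equation with w = K * g, where
  g = (P - c) chi has mean zero and K(x) = x (|x|^2 + e^2)^(-d/2) is a regularised Newtonian field,
  and let e tend to 0. The field w is curl-free, so the L2 norm of its gradient is that of its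
  divergence, and mean zero makes w decay like |x|^(-d). For d = 2, 3 the tensor rho v v is in L2
  on balls with a growth in R that exactly matches the hypothesis on v. For d >= 4 the velocity need
  not be locally in L4 uniformly, so v is split as a + b with a = v / (1 + |v|^2)^2: the
  tensor rho v a is in L2 and is paired with grad w, whereas rho v . grad b is in L1 and is paired
  with w, which is bounded. For the same reason the energy test field is truncated when d >= 4.\<close>

section \<open>Calculus with one-dimensional partial derivatives\<close>

text \<open>The exponents 6 and 9/2 come from one count. The cubic energy flux through the annulus
  is about 1/R times the integral of |v|^3, and Hoelder with v in L^q turns it into R^(d - 1 - 3d/q)
  times a power of the tail of a convergent integral; the power of R is 0 exactly when q (d - 1) = 3
  d. The local L2 bound of the pressure fits the same count. For d >= 4 the Sobolev exponent makes
  1/R times the L2 norm of v on the annulus tend to 0, so every other factor must stay bounded in R;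
  the truncation that achieves this leaves an error which vanishes only after the radius has gone to
  infinity. The pressure estimate closes by absorption: its left side is quadratic in the L2 size N
  of P - c, its right side at most affine in N. The constant kappa is then tied to c: if c is the
  pressure at density c0, kappa = A c0^(gamma - 1) gives |P - kappa rho| <= |P - c| at every point,
  vacuum included. Since mu + lambda may be negative, coercivity of the energy also uses that the
  integral of (div v)^2 is at most that of |grad v|^2, which rests on the same null form as the
  curl-free identity for w.\<close>

text \<open>No Frechet derivative is required, so that convolutions qualify by differentiation
  under the integral sign.\<close>

definition C1 :: "(real^'n::finite \<Rightarrow> real) \<Rightarrow> bool" where
  "C1 u \<longleftrightarrow> continuous_on UNIV u \<and> (\<forall>i. continuous_on UNIV (partial i u)) \<and>
     (\<forall>i x. ((\<lambda>t. u (x + t *\<^sub>R axis i 1)) has_real_derivative partial i u x) (at 0))"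

lemma C1_continuous: "C1 u \<Longrightarrow> continuous_on A u"
  and C1_partial_continuous: "C1 u \<Longrightarrow> continuous_on A (partial i u)"
  and C1_deriv: "C1 u \<Longrightarrow> ((\<lambda>t. u (x + t *\<^sub>R axis i 1)) has_real_derivative partial i u x) (at 0)"
  unfolding C1_def by (auto intro: continuous_on_subset)

lemma C1_deriv_at:
  assumes "C1 u"
  shows "((\<lambda>t. u (x + t *\<^sub>R axis i 1)) has_real_derivative partial i u (x + t0 *\<^sub>R axis i 1)) (at t0)"
proof -
  have "((\<lambda>t. u (x + (t + t0) *\<^sub>R axis i 1)) has_real_derivative partial i u (x + t0 *\<^sub>R axis i 1)) (at 0)"
    using C1_deriv[OF assms, of "x + t0 *\<^sub>R axis i 1" i] by (simp add: algebra_simps)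
  then show ?thesis
    using DERIV_shift[of "\<lambda>t. u (x + t *\<^sub>R axis i 1)" "partial i u (x + t0 *\<^sub>R axis i 1)" 0 t0] by simp
qed

lemma partial_eqI:
  assumes "((\<lambda>t. u (x + t *\<^sub>R axis i 1)) has_real_derivative d) (at 0)"
  shows "partial i u x = d"
  using assms unfolding partial_def
  by (simp add: has_real_derivative_iff_has_vector_derivative vector_derivative_at)

text \<open>The candidate \<open>d\<close> serves twice: once the derivative along each axis is
  exhibited, regularity and the formula for \<open>partial\<close> follow together. This is why the
  calculus rules below come in pairs.\<close>

lemma C1I:
  assumes "continuous_on UNIV u" "\<And>i. continuous_on UNIV (d i)"
    and "\<And>i x. ((\<lambda>t. u (x + t *\<^sub>R axis i 1)) has_real_derivative d i x) (at 0)"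
  shows "C1 u" and "partial i u x = d i x"
proof -
  have *: "partial i u = d i" for i
    using partial_eqI[OF assms(3)] by (intro ext)
  show "C1 u" unfolding C1_def * using assms by auto
  show "partial i u x = d i x" by (simp add: *)
qed

lemma C1_const [intro, simp]: "C1 (\<lambda>x. c)" and partial_const [simp]: "partial i (\<lambda>x. c :: real) x = 0"
  by (rule C1I[where d = "\<lambda>i x. 0"]; auto)+

lemma
  assumes "C1 u" "C1 w"
  shows C1_add [intro]: "C1 (\<lambda>x. u x + w x)"
    and partial_add: "partial i (\<lambda>x. u x + w x) x = partial i u x + partial i w x"
proof -
  note D = DERIV_add[OF C1_deriv[OF assms(1)] C1_deriv[OF assms(2)]]
  note c = continuous_on_add[OF C1_continuous[OF assms(1)] C1_continuous[OF assms(2)]]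
    continuous_on_add[OF C1_partial_continuous[OF assms(1)] C1_partial_continuous[OF assms(2)]]
  show "C1 (\<lambda>x. u x + w x)"
    and "partial i (\<lambda>x. u x + w x) x = partial i u x + partial i w x"
    by (rule C1I[where d = "\<lambda>i x. partial i u x + partial i w x", OF c D])+
qed

lemma
  assumes "C1 u" "C1 w"
  shows C1_diff [intro]: "C1 (\<lambda>x. u x - w x)"
    and partial_diff: "partial i (\<lambda>x. u x - w x) x = partial i u x - partial i w x"
proof -
  note D = DERIV_diff[OF C1_deriv[OF assms(1)] C1_deriv[OF assms(2)]]
  note c = continuous_on_diff[OF C1_continuous[OF assms(1)] C1_continuous[OF assms(2)]]
    continuous_on_diff[OF C1_partial_continuous[OF assms(1)] C1_partial_continuous[OF assms(2)]]
  show "C1 (\<lambda>x. u x - w x)"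
    and "partial i (\<lambda>x. u x - w x) x = partial i u x - partial i w x"
    by (rule C1I[where d = "\<lambda>i x. partial i u x - partial i w x", OF c D])+
qed

lemma
  assumes "C1 u" "C1 w"
  shows C1_mult [intro]: "C1 (\<lambda>x. u x * w x)"
    and partial_mult: "partial i (\<lambda>x. u x * w x) x = partial i u x * w x + u x * partial i w x"
proof -
  have D: "((\<lambda>t. u (x + t *\<^sub>R axis i 1) * w (x + t *\<^sub>R axis i 1)) has_real_derivative
         partial i u x * w x + u x * partial i w x) (at 0)" for i x
    using DERIV_mult[OF C1_deriv[OF assms(1), of x i] C1_deriv[OF assms(2), of x i]]
    by (simp add: algebra_simps)
  note c1 = C1_continuous[OF assms(1)] C1_continuous[OF assms(2)]
  note c2 = C1_partial_continuous[OF assms(1)] C1_partial_continuous[OF assms(2)]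
  note c = continuous_on_mult[OF c1]
    continuous_on_add[OF continuous_on_mult[OF c2(1) c1(2)] continuous_on_mult[OF c1(1) c2(2)]]
  show "C1 (\<lambda>x. u x * w x)" and "partial i (\<lambda>x. u x * w x) x = partial i u x * w x + u x * partial i w x"
    by (rule C1I[where d = "\<lambda>i x. partial i u x * w x + u x * partial i w x", OF c D])+
qed

lemma
  assumes "C1 u"
  shows C1_cmult [intro]: "C1 (\<lambda>x. c * u x)"
    and partial_cmult: "partial i (\<lambda>x. c * u x) x = c * partial i u x"
  using C1_mult[of "\<lambda>x. c" u] partial_mult[of "\<lambda>x. c" u] assms by auto

lemma
  assumes "\<And>k. k \<in> S \<Longrightarrow> C1 (u k)"
  shows C1_sum [intro]: "C1 (\<lambda>x. \<Sum>k\<in>S. u k x)"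
    and partial_sum: "partial i (\<lambda>x. \<Sum>k\<in>S. u k x) x = (\<Sum>k\<in>S. partial i (u k) x)"
proof -
  note D = DERIV_sum[OF C1_deriv[OF assms]]
  note c = continuous_on_sum[OF C1_continuous[OF assms]] continuous_on_sum[OF C1_partial_continuous[OF assms]]
  show "C1 (\<lambda>x. \<Sum>k\<in>S. u k x)" and "partial i (\<lambda>x. \<Sum>k\<in>S. u k x) x = (\<Sum>k\<in>S. partial i (u k) x)"
    by (rule C1I[where d = "\<lambda>i x. \<Sum>k\<in>S. partial i (u k) x", OF c D]; assumption)+
qed

text \<open>The powers and rational truncations composed later are regular only on the values that
  the inner function takes, so continuity of \<open>F'\<close> is asked on
  \<open>range u\<close>.\<close>

lemma
  assumes "C1 u" and F: "\<And>x. (F has_real_derivative F' (u x)) (at (u x))" and F': "continuous_on (range u) F'"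
  shows C1_compose: "C1 (\<lambda>x. F (u x))"
    and partial_compose: "partial i (\<lambda>x. F (u x)) x = F' (u x) * partial i u x"
proof -
  have D: "((\<lambda>t. F (u (x + t *\<^sub>R axis i 1))) has_real_derivative F' (u x) * partial i u x) (at 0)" for i x
    using F[of x] C1_deriv[OF assms(1), of x i] by (intro DERIV_chain2[where f = F]) auto
  have c: "continuous_on UNIV (\<lambda>x. F (u x))"
    using F by (intro continuous_on_compose2[OF _ C1_continuous[OF assms(1)], of "range u" F])
      (auto intro!: continuous_at_imp_continuous_on DERIV_isCont)
  have c': "continuous_on UNIV (\<lambda>x. F' (u x))"
    by (intro continuous_on_compose2[OF F' C1_continuous[OF assms(1)]]) auto
  show "C1 (\<lambda>x. F (u x))" and "partial i (\<lambda>x. F (u x)) x = F' (u x) * partial i u x"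
    by (rule C1I[where d = "\<lambda>i x. F' (u x) * partial i u x",
        OF c continuous_on_mult[OF c' C1_partial_continuous[OF assms(1)]] D])+
qed

text \<open>Bridge to the Frechet derivative, for the places where several coordinates move at once:
  the mean value bound along a segment and the constancy of a function with vanishing
  partials.\<close>

lemma differentiable_directional:
  fixes f :: "real^'n::finite \<Rightarrow> real"
  assumes "f differentiable (at x)"
  shows "(f has_derivative (\<lambda>h. \<Sum>i\<in>UNIV. h $ i * partial i f x)) (at x)"
    and "((\<lambda>t. f (x + t *\<^sub>R axis i 1)) has_real_derivative partial i f x) (at 0)"
proof -
  obtain D where D: "(f has_derivative D) (at x)" using assms unfolding differentiable_def by blast
  interpret D: bounded_linear D using D by (rule has_derivative_bounded_linear)
  have 1: "((\<lambda>t. f (x + t *\<^sub>R axis i 1)) has_real_derivative D (axis i 1)) (at 0)" for i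
  proof -
    have "((\<lambda>t. f (x + t *\<^sub>R axis i 1)) has_derivative (\<lambda>t. D (t *\<^sub>R axis i 1))) (at 0)"
      by (rule has_derivative_compose[where g = f]) (use D in \<open>auto intro!: derivative_eq_intros\<close>)
    then show ?thesis
      by (simp add: has_field_derivative_def D.scaleR mult_commute_abs)
  qed
  have 2: "D (axis i 1) = partial i f x" for i
    using partial_eqI[OF 1] by simp
  have "D h = (\<Sum>i\<in>UNIV. h $ i * partial i f x)" for h
  proof -
    have "D h = D (\<Sum>i\<in>UNIV. (h $ i) *\<^sub>R axis i 1)"
      by (metis basis_expansion scalar_mult_eq_scaleR)
    then show ?thesis by (simp add: D.sum D.scaleR 2)
  qed
  then have "D = (\<lambda>h. \<Sum>i\<in>UNIV. h $ i * partial i f x)" by auto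
  with D show "(f has_derivative (\<lambda>h. \<Sum>i\<in>UNIV. h $ i * partial i f x)) (at x)" by simp
  show "((\<lambda>t. f (x + t *\<^sub>R axis i 1)) has_real_derivative partial i f x) (at 0)" using 1 2 by simp
qed

lemma differentiable_C1:
  assumes "\<And>x. f differentiable (at x)" "\<And>i. continuous_on UNIV (partial i f)"
  shows "C1 f"
  unfolding C1_def using assms(2) differentiable_directional(2)[OF assms(1)]
  by (auto intro!: continuous_at_imp_continuous_on differentiable_imp_continuous_within assms(1))

lemma smooth_differentiable: "smooth f \<Longrightarrow> f differentiable (at x)"
  unfolding smooth_def by (metis iter_partial.simps(1))

lemma iter_partial_append: "iter_partial (xs @ ys) f = iter_partial xs (iter_partial ys f)"
  by (induction xs) auto

lemma smooth_partial: "smooth f \<Longrightarrow> smooth (partial i f)"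
  unfolding smooth_def by (metis iter_partial_append iter_partial.simps)

lemma smooth_C1: "smooth f \<Longrightarrow> C1 f"
  by (intro differentiable_C1 continuous_at_imp_continuous_on ballI differentiable_imp_continuous_within
     smooth_differentiable smooth_partial)

section \<open>Compact support, differentiation under the integral, integration by parts\<close>

definition csupp :: "(real^'n::finite \<Rightarrow> real) \<Rightarrow> bool" where
  "csupp u \<longleftrightarrow> (\<exists>r. \<forall>x. norm x > r \<longrightarrow> u x = 0)"

lemma csupp_mult [intro]: "csupp u \<Longrightarrow> csupp (\<lambda>x. u x * w x)" "csupp u \<Longrightarrow> csupp (\<lambda>x. w x * u x)"
  unfolding csupp_def by fastforce+

text \<open>The strict inequality in \<open>csupp\<close> makes the exterior region open, so near an
  exterior point \<open>u\<close> vanishes identically along the line and the derivative is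
  0.\<close>

lemma csupp_partial [intro]:
  assumes "csupp u" shows "csupp (partial i u)"
proof -
  obtain r where r: "\<forall>x. norm x > r \<longrightarrow> u x = 0" using assms by (auto simp: csupp_def)
  have "partial i u x = 0" if "norm x > r" for x
  proof (rule partial_eqI)
    have "((\<lambda>t. norm (x + t *\<^sub>R axis i 1)) \<longlongrightarrow> norm (x + 0 *\<^sub>R axis i 1)) (at 0)" by (intro tendsto_intros)
    then have "\<forall>\<^sub>F t in at 0. norm (x + t *\<^sub>R axis i 1) > r"
      using that by (intro order_tendstoD(1)) auto
    then have "\<forall>\<^sub>F t in at 0. u (x + t *\<^sub>R axis i 1) = 0"
      by eventually_elim (use r in auto)
    then have "\<forall>\<^sub>F t in nhds 0. u (x + t *\<^sub>R axis i 1) = 0"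
      using r that by (simp add: eventually_at_filter) (auto elim!: eventually_mono)
    then show "((\<lambda>t. u (x + t *\<^sub>R axis i 1)) has_real_derivative 0) (at 0)"
      by (subst DERIV_cong_ev[OF refl _ refl, of _ "\<lambda>_. 0"]) auto
  qed
  then show ?thesis by (auto simp: csupp_def)
qed

lemma integrable_csupp:
  assumes "continuous_on UNIV u" "csupp u"
  shows "integrable lborel u"
proof -
  obtain r where r: "\<forall>x. norm x > r \<longrightarrow> u x = 0" using assms by (auto simp: csupp_def)
  have "integrable lborel (\<lambda>x. indicator (cball 0 r) x *\<^sub>R u x)"
    using assms by (intro borel_integrable_compact) (auto intro: continuous_on_subset)
  also have "(\<lambda>x. indicator (cball 0 r) x *\<^sub>R u x) = u"
    using r by (auto simp: indicator_def fun_eq_iff)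
  finally show ?thesis .
qed

lemma integrable_csupp_mult:
  assumes "continuous_on UNIV u" "continuous_on UNIV w" "csupp w"
  shows "integrable lborel (\<lambda>x. u x * w x)"
  using assms by (intro integrable_csupp continuous_on_mult csupp_mult)

lemma csupp_bounded:
  assumes "continuous_on UNIV u" "csupp u"
  obtains B where "B \<ge> 0" "\<And>x. \<bar>u x\<bar> \<le> B"
proof -
  obtain r where r: "\<forall>x. norm x > r \<longrightarrow> u x = 0" using assms by (auto simp: csupp_def)
  have "compact (u ` cball 0 r)"
    using assms by (intro compact_continuous_image) (auto intro: continuous_on_subset)
  then obtain B where B: "B > 0" "\<forall>y\<in>u ` cball 0 r. norm y \<le> B"
    using compact_imp_bounded bounded_pos by metis
  have "\<bar>u x\<bar> \<le> B" for x
    using B r by (cases "norm x > r") (auto simp: image_iff)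
  with B that show thesis by (meson less_imp_le)
qed

text \<open>Dominated convergence for the difference quotients. The mean value inequality on
  \<open>{-1..1}\<close> turns the bound on \<open>h'\<close> into a bound on the quotients, so the
  majorant concerns parameters in that interval only; translates of a compactly supported function
  have such a majorant.\<close>

lemma deriv_under_integral:
  fixes h h' :: "real \<Rightarrow> 'a \<Rightarrow> real"
  assumes int: "\<And>t. integrable M (h t)" and m: "h' 0 \<in> borel_measurable M"
    and D: "\<And>t y. ((\<lambda>s. h s y) has_real_derivative h' t y) (at t)"
    and b: "\<And>t y. \<bar>t\<bar> \<le> 1 \<Longrightarrow> \<bar>h' t y\<bar> \<le> G y" and G: "integrable M G"
  shows "((\<lambda>t. \<integral>y. h t y \<partial>M) has_real_derivative (\<integral>y. h' 0 y \<partial>M)) (at 0)"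
proof -
  have "((\<lambda>t. ((\<integral>y. h (0 + t) y \<partial>M) - (\<integral>y. h 0 y \<partial>M)) / t) \<longlongrightarrow> (\<integral>y. h' 0 y \<partial>M)) (at 0)"
    unfolding tendsto_at_iff_sequentially
  proof (intro allI impI)
    fix X :: "nat \<Rightarrow> real" assume X0: "\<forall>i. X i \<in> UNIV - {0}" and X: "X \<longlonglongrightarrow> 0"
    have "\<forall>\<^sub>F i in sequentially. \<bar>X i\<bar> < 1"
      using order_tendstoD(2)[OF tendsto_rabs[OF X], of 1] by simp
    \<comment> \<open>A sequence tending to 0 enters the interval of domination only from some
      \<open>N\<close> on; the earlier terms are dropped here and restored by
      \<open>LIMSEQ_offset\<close>.\<close>
    then obtain N where N: "\<And>i. i \<ge> N \<Longrightarrow> \<bar>X i\<bar> \<le> 1"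
      unfolding eventually_sequentially by (meson less_imp_le)
    have e: "((\<integral>y. h (0 + X i) y \<partial>M) - (\<integral>y. h 0 y \<partial>M)) / X i = (\<integral>y. (h (X i) y - h 0 y) / X i \<partial>M)" for i
      using int by (simp add: Bochner_Integration.integral_diff)
    have "(\<lambda>i. \<integral>y. (h (X (i + N)) y - h 0 y) / X (i + N) \<partial>M) \<longlonglongrightarrow> (\<integral>y. h' 0 y \<partial>M)"
    proof (rule integral_dominated_convergence[where w = G])
      show "h' 0 \<in> borel_measurable M" by fact
      show "integrable M G" by fact
      show "(\<lambda>y. (h (X (i + N)) y - h 0 y) / X (i + N)) \<in> borel_measurable M" for i
        using int[THEN borel_measurable_integrable] by measurable
      show "AE y in M. (\<lambda>i. (h (X (i + N)) y - h 0 y) / X (i + N)) \<longlonglongrightarrow> h' 0 y"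
      proof (rule AE_I2)
        fix y
        have "((\<lambda>t. (h (0 + t) y - h 0 y) / t) \<longlongrightarrow> h' 0 y) (at 0)"
          using D[of y 0] by (simp add: DERIV_def)
        then have "(\<lambda>i. (h (0 + X i) y - h 0 y) / X i) \<longlonglongrightarrow> h' 0 y"
          using X0 X unfolding tendsto_at_iff_sequentially comp_def by blast
        then show "(\<lambda>i. (h (X (i + N)) y - h 0 y) / X (i + N)) \<longlonglongrightarrow> h' 0 y"
          using LIMSEQ_ignore_initial_segment[of _ _ N] by simp
      qed
      show "AE y in M. norm ((h (X (i + N)) y - h 0 y) / X (i + N)) \<le> G y" for i
      proof (rule AE_I2)
        fix y
        let ?t = "X (i + N)"
        have t: "\<bar>?t\<bar> \<le> 1" "?t \<noteq> 0" using N X0 by auto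
        have "norm (h ?t y - h 0 y) \<le> G y * norm (?t - 0)"
        proof (rule field_differentiable_bound[of "{-1..1}" "\<lambda>s. h s y" "\<lambda>s. h' s y"])
          show "((\<lambda>s. h s y) has_field_derivative h' z y) (at z within {- 1..1})" if "z \<in> {-1..1}" for z
            using D by (rule has_field_derivative_at_within)
        qed (use t b in \<open>auto simp: abs_le_iff\<close>)
        then show "norm ((h ?t y - h 0 y) / ?t) \<le> G y"
          using t by (simp add: divide_le_eq)
      qed
    qed
    then have "(\<lambda>i. \<integral>y. (h (X i) y - h 0 y) / X i \<partial>M) \<longlonglongrightarrow> (\<integral>y. h' 0 y \<partial>M)"
      by (rule LIMSEQ_offset)
    then show "((\<lambda>t. ((\<integral>y. h (0 + t) y \<partial>M) - (\<integral>y. h 0 y \<partial>M)) / t) \<circ> X) \<longlonglongrightarrow> (\<integral>y. h' 0 y \<partial>M)"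
      by (simp only: comp_def e)
  qed
  then show ?thesis by (simp add: DERIV_def)
qed

lemma lborel_integral_affine:
  fixes f :: "'a::euclidean_space \<Rightarrow> real"
  assumes [measurable]: "f \<in> borel_measurable borel" and c: "c \<noteq> 0"
  shows "(LBINT x. f x) = \<bar>c\<bar> ^ DIM('a) * (LBINT x. f (a + c *\<^sub>R x))"
proof -
  have "(LBINT x. f x) = (\<integral>x. f x \<partial>density (distr lborel borel (\<lambda>x. a + c *\<^sub>R x)) (\<lambda>_. \<bar>c\<bar> ^ DIM('a)))"
    using lborel_affine[OF c, of a] by simp
  also have "\<dots> = (\<integral>x. \<bar>c\<bar> ^ DIM('a) *\<^sub>R f x \<partial>distr lborel borel (\<lambda>x. a + c *\<^sub>R x))"
    by (subst integral_density) auto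
  also have "\<dots> = \<bar>c\<bar> ^ DIM('a) * (LBINT x. f (a + c *\<^sub>R x))"
    by (subst integral_distr) auto
  finally show ?thesis .
qed

lemma lborel_integral_translate:
  fixes f :: "'a::euclidean_space \<Rightarrow> real"
  assumes "f \<in> borel_measurable borel"
  shows "(LBINT x. f (x + a)) = (LBINT x. f x)"
  using lborel_integral_affine[OF assms, of 1 a] by (simp add: add.commute)

text \<open>Translation invariance replaces Fubini: the integral of \<open>u\<close> shifted by
  \<open>t\<close> along axis \<open>i\<close> is constant in \<open>t\<close>, and its derivative
  at 0 is the integral of \<open>partial i u\<close>. For the majorant, a shift by at most 1 keeps
  the support in the ball of radius \<open>r + 1\<close>.\<close>

lemma integral_partial_eq_0:
  fixes u :: "real^'n::finite \<Rightarrow> real"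
  assumes u: "C1 u" "csupp u"
  shows "(LBINT x. partial i u x) = 0"
proof -
  obtain r where r: "\<forall>x. norm x > r \<longrightarrow> partial i u x = 0"
    using csupp_partial[OF u(2)] by (auto simp: csupp_def)
  obtain B where B: "B \<ge> 0" "\<And>x. \<bar>partial i u x\<bar> \<le> B"
    using csupp_bounded[OF C1_partial_continuous[OF u(1)] csupp_partial[OF u(2)]] by blast
  have m: "u \<in> borel_measurable borel" "partial i u \<in> borel_measurable borel"
    using u C1_continuous C1_partial_continuous borel_measurable_continuous_onI by blast+
  have tr: "(LBINT x. u (x + t *\<^sub>R axis i 1)) = (LBINT x. u x)" for t
    by (rule lborel_integral_translate) fact
  have "((\<lambda>t. \<integral>x. u (x + t *\<^sub>R axis i 1) \<partial>lborel) has_real_derivative (LBINT x. partial i u (x + 0 *\<^sub>R axis i 1))) (at 0)"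
  proof (rule deriv_under_integral[where h = "\<lambda>t x. u (x + t *\<^sub>R axis i 1)" and h' = "\<lambda>t x. partial i u (x + t *\<^sub>R axis i 1)"
       and G = "\<lambda>x. indicator (cball 0 (r + 1)) x *\<^sub>R B"])
    show "integrable lborel (\<lambda>x. u (x + t *\<^sub>R axis i 1))" for t
    proof -
      obtain s where s: "\<forall>x. norm x > s \<longrightarrow> u x = 0" using u(2) by (auto simp: csupp_def)
      have "csupp (\<lambda>x. u (x + t *\<^sub>R axis i 1))"
        unfolding csupp_def
      proof (intro exI[of _ "s + \<bar>t\<bar>"] allI impI)
        fix x :: "real^'n" assume "s + \<bar>t\<bar> < norm x"
        moreover have "norm x \<le> norm (x + t *\<^sub>R axis i 1) + norm (t *\<^sub>R axis i (1::real) :: real^'n)"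
          by (metis add_diff_cancel norm_triangle_ineq4)
        ultimately show "u (x + t *\<^sub>R axis i 1) = 0" using s by auto
      qed
      then show ?thesis
        by (intro integrable_csupp continuous_on_compose2[OF C1_continuous[OF u(1), of UNIV]] continuous_intros) auto
    qed
    show "((\<lambda>s. u (y + s *\<^sub>R axis i 1)) has_real_derivative partial i u (y + t *\<^sub>R axis i 1)) (at t)" for t y
      by (rule C1_deriv_at) fact
    show "\<bar>partial i u (y + t *\<^sub>R axis i 1)\<bar> \<le> indicator (cball 0 (r + 1)) y *\<^sub>R B" if "\<bar>t\<bar> \<le> 1" for t y
    proof (cases "norm y \<le> r + 1")
      case True then show ?thesis using B by auto
    next
      case False
      have "norm y \<le> norm (y + t *\<^sub>R axis i 1) + norm (t *\<^sub>R axis i (1::real) :: real^'n)"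
        by (metis add_diff_cancel norm_triangle_ineq4)
      then have "norm (y + t *\<^sub>R axis i 1) > r" using False that by auto
      then show ?thesis using r B by auto
    qed
    show "integrable lborel (\<lambda>x. indicator (cball 0 (r + 1)) x *\<^sub>R B :: real)"
      by (intro borel_integrable_compact) auto
  qed (use m in simp)
  moreover have "((\<lambda>t. \<integral>x. u (x + t *\<^sub>R axis i 1) \<partial>lborel) has_real_derivative 0) (at 0)"
    unfolding tr by simp
  ultimately show ?thesis using DERIV_unique by fastforce
qed

lemma integration_by_parts:
  assumes "C1 u" "C1 w" "csupp w"
  shows "(LBINT x. partial i u x * w x) = - (LBINT x. u x * partial i w x)"
proof -
  have "(LBINT x. partial i u x * w x + u x * partial i w x) = 0"
    using integral_partial_eq_0[of "\<lambda>x. u x * w x" i] assms by (auto simp: partial_mult)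
  moreover have "integrable lborel (\<lambda>x. partial i u x * w x)" "integrable lborel (\<lambda>x. u x * partial i w x)"
    using assms by (auto intro!: integrable_csupp_mult C1_continuous C1_partial_continuous)
  ultimately show ?thesis by simp
qed

lemma
  assumes "C1 u"
  shows C1_shift: "C1 (\<lambda>x. u (x + a))" and partial_shift: "partial i (\<lambda>x. u (x + a)) x = partial i u (x + a)"
proof -
  have *: "((\<lambda>t. u (x + t *\<^sub>R axis i 1 + a)) has_real_derivative partial i u (x + a)) (at 0)" for i x
    using C1_deriv[OF assms, of "x + a" i] by (simp add: algebra_simps)
  show "C1 (\<lambda>x. u (x + a))" and "partial i (\<lambda>x. u (x + a)) x = partial i u (x + a)"
    by (rule C1I[where d = "\<lambda>i x. partial i u (x + a)"];
      intro continuous_intros * continuous_on_compose2[OF C1_partial_continuous[OF assms, of UNIV]]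
        continuous_on_compose2[OF C1_continuous[OF assms, of UNIV]]; simp)+
qed

lemma deriv_integral_shift:
  fixes f :: "real^'n::finite \<Rightarrow> real"
  assumes f: "C1 f" and \<Theta>: "continuous_on UNIV \<Theta>" "csupp \<Theta>"
  shows "((\<lambda>s. \<integral>x. f (x + s *\<^sub>R axis j 1) * \<Theta> x \<partial>lborel) has_real_derivative
           (LBINT x. partial j f x * \<Theta> x)) (at 0)"
proof -
  obtain r where r: "\<forall>x. norm x > r \<longrightarrow> \<Theta> x = 0"
    using \<Theta>(2) by (auto simp: csupp_def)
  have "compact (partial j f ` cball 0 (r + 1))"
    by (intro compact_continuous_image C1_partial_continuous f) auto
  then obtain B where B: "B > 0" "\<forall>y\<in>partial j f ` cball 0 (r + 1). norm y \<le> B"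
    using compact_imp_bounded bounded_pos by metis
  have [measurable]: "f \<in> borel_measurable borel" "partial j f \<in> borel_measurable borel" "\<Theta> \<in> borel_measurable borel"
    using f \<Theta> C1_continuous C1_partial_continuous borel_measurable_continuous_onI by blast+
  have "((\<lambda>s. \<integral>x. f (x + s *\<^sub>R axis j 1) * \<Theta> x \<partial>lborel) has_real_derivative
           (LBINT x. partial j f (x + 0 *\<^sub>R axis j 1) * \<Theta> x)) (at 0)"
  proof (rule deriv_under_integral[where h = "\<lambda>t x. f (x + t *\<^sub>R axis j 1) * \<Theta> x"
        and h' = "\<lambda>t x. partial j f (x + t *\<^sub>R axis j 1) * \<Theta> x" and G = "\<lambda>x. B * \<bar>\<Theta> x\<bar>"])
    show "integrable lborel (\<lambda>x. f (x + t *\<^sub>R axis j 1) * \<Theta> x)" for t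
      by (intro integrable_csupp continuous_intros \<Theta> csupp_mult
         continuous_on_compose2[OF C1_continuous[OF f, of UNIV]]) auto
    show "((\<lambda>s. f (y + s *\<^sub>R axis j 1) * \<Theta> y) has_real_derivative partial j f (y + t *\<^sub>R axis j 1) * \<Theta> y) (at t)" for t y
      by (intro DERIV_cmult_right C1_deriv_at f)
    show "\<bar>partial j f (y + t *\<^sub>R axis j 1) * \<Theta> y\<bar> \<le> B * \<bar>\<Theta> y\<bar>" if "\<bar>t\<bar> \<le> 1" for t y
    proof (cases "norm y > r")
      case True then show ?thesis using r by simp
    next
      case False
      have "norm (y + t *\<^sub>R axis j 1) \<le> norm y + norm (t *\<^sub>R axis j (1::real) :: real^'n)"
        by (rule norm_triangle_ineq)
      then have "\<bar>partial j f (y + t *\<^sub>R axis j 1)\<bar> \<le> B" using B False that by auto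
      then show ?thesis by (simp add: abs_mult mult_right_mono)
    qed
    show "integrable lborel (\<lambda>x. B * \<bar>\<Theta> x\<bar>)"
      by (intro integrable_mult_right integrable_abs integrable_csupp \<Theta>)
  qed measurable
  then show ?thesis by simp
qed

text \<open>Symmetry of second derivatives is needed in integrated form only; there it follows by
  differentiating a translation under the integral sign.\<close>

lemma weak_schwarz:
  fixes u :: "real^'n::finite \<Rightarrow> real"
  assumes u: "C1 u" "C1 (partial i u)" "C1 (partial j u)" and \<Theta>: "C1 \<Theta>" "csupp \<Theta>"
  shows "(LBINT x. partial i (partial j u) x * \<Theta> x) = (LBINT x. partial j (partial i u) x * \<Theta> x)"
proof -
  have "(LBINT x. u (x + s *\<^sub>R axis j 1) * partial i \<Theta> x)
      = - (LBINT x. partial i u (x + s *\<^sub>R axis j 1) * \<Theta> x)" for s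
    using integration_by_parts[OF C1_shift[OF u(1), of "s *\<^sub>R axis j 1"] \<Theta>, of i]
    by (simp add: partial_shift u)
  then have "((\<lambda>s. \<integral>x. u (x + s *\<^sub>R axis j 1) * partial i \<Theta> x \<partial>lborel) has_real_derivative
       - (LBINT x. partial j (partial i u) x * \<Theta> x)) (at 0)"
    using DERIV_minus[OF deriv_integral_shift[OF u(2) C1_continuous[OF \<Theta>(1)] \<Theta>(2), of j]] by simp
  moreover have "((\<lambda>s. \<integral>x. u (x + s *\<^sub>R axis j 1) * partial i \<Theta> x \<partial>lborel) has_real_derivative
       (LBINT x. partial j u x * partial i \<Theta> x)) (at 0)"
    by (intro deriv_integral_shift u C1_partial_continuous \<Theta> csupp_partial)
  ultimately have "(LBINT x. partial j u x * partial i \<Theta> x) = - (LBINT x. partial j (partial i u) x * \<Theta> x)"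
    using DERIV_unique by blast
  with integration_by_parts[OF u(3) \<Theta>, of i] show ?thesis by simp
qed

text \<open>Integrating by parts, both products leave a mixed second derivative of \<open>h\<close>
  against \<open>f x * \<phi> x\<close>. These cancel by \<open>weak_schwarz\<close>, and only terms
  with a derivative of \<open>\<phi>\<close> survive. With \<open>\<phi>\<close> a cut-off, this is
  how a squared divergence is compared with a gradient.\<close>

lemma null_form_identity:
  fixes f h \<phi> :: "real^'n::finite \<Rightarrow> real"
  assumes f: "C1 f" and h: "C1 h" "C1 (partial i h)" "C1 (partial j h)" and \<phi>: "C1 \<phi>" "csupp \<phi>"
  shows "(LBINT x. partial i f x * partial j h x * \<phi> x - partial j f x * partial i h x * \<phi> x)
       = (LBINT x. f x * partial i h x * partial j \<phi> x - f x * partial j h x * partial i \<phi> x)"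
proof -
  note C = f h \<phi> C1_continuous C1_partial_continuous C1_mult csupp_partial
  have I: "integrable lborel (\<lambda>x. partial a f x * partial b h x * \<phi> x)"
     "integrable lborel (\<lambda>x. f x * partial a h x * partial b \<phi> x)" for a b
    by (intro integrable_csupp continuous_intros csupp_mult; (intro C)?)+
  have 1: "integrable lborel (\<lambda>x. partial a (partial b h) x * (f x * \<phi> x))" if "C1 (partial b h)" for a b
    by (intro integrable_csupp continuous_intros csupp_mult that; (intro C that)?)
  have P: "(LBINT x. partial a f x * partial b h x * \<phi> x) =
     - (LBINT x. partial a (partial b h) x * (f x * \<phi> x)) - (LBINT x. f x * partial b h x * partial a \<phi> x)"
    if b: "C1 (partial b h)" for a b
  proof -
    have "(LBINT x. partial a f x * (partial b h x * \<phi> x)) = - (LBINT x. f x * partial a (\<lambda>x. partial b h x * \<phi> x) x)"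
      by (intro integration_by_parts f C1_mult b \<phi> csupp_mult)
    also have "\<dots> = - (LBINT x. partial a (partial b h) x * (f x * \<phi> x) + f x * partial b h x * partial a \<phi> x)"
      by (simp add: partial_mult b \<phi> algebra_simps)
    also have "\<dots> = - (LBINT x. partial a (partial b h) x * (f x * \<phi> x)) - (LBINT x. f x * partial b h x * partial a \<phi> x)"
      by (subst Bochner_Integration.integral_add) (use 1[OF b] I in auto)
    finally show ?thesis by (simp add: mult.assoc)
  qed
  show ?thesis
    using P[OF h(3), of i] P[OF h(2), of j] weak_schwarz[OF h C1_mult[OF f \<phi>(1)] csupp_mult(2)[OF \<phi>(2)]] I
    by (simp add: Bochner_Integration.integral_diff)
qed

section \<open>Cut-off functions and square integrability\<close>

text \<open>A C1 function that vanishes on a half-line; two copies of it build the cut-off, which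
  has to be C1 and no more.\<close>

definition pos_sq :: "real \<Rightarrow> real" where "pos_sq z = (max 0 z)\<^sup>2"

lemma DERIV_pos_sq: "(pos_sq has_real_derivative 2 * max 0 z) (at z)"
proof -
  consider "z < 0" | "z > 0" | "z = 0" by linarith
  then show ?thesis
  proof cases
    case 1
    have "\<forall>\<^sub>F t in nhds z. pos_sq t = 0"
      using eventually_nhds_in_open[of "{..<0}" z] 1 by (auto elim!: eventually_mono simp: pos_sq_def)
    then show ?thesis using 1 by (subst DERIV_cong_ev[OF refl _ refl, of _ "\<lambda>_. 0"]) auto
  next
    case 2
    have "\<forall>\<^sub>F t in nhds z. pos_sq t = t\<^sup>2"
      using eventually_nhds_in_open[of "{0<..}" z] 2 by (auto elim!: eventually_mono simp: pos_sq_def)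
    then show ?thesis using 2 by (subst DERIV_cong_ev[OF refl _ refl, of _ "\<lambda>t. t\<^sup>2"]) (auto intro!: derivative_eq_intros)
  next
    case 3
    have "((\<lambda>h. (pos_sq (0 + h) - pos_sq 0) / h) \<longlongrightarrow> 0) (at 0)"
    proof (rule Lim_null_comparison)
      show "\<forall>\<^sub>F h in at (0::real). norm ((pos_sq (0 + h) - pos_sq 0) / h) \<le> \<bar>h\<bar>"
        by (rule always_eventually) (auto simp: pos_sq_def max_def power2_eq_square)
      show "((\<lambda>h. \<bar>h\<bar>) \<longlongrightarrow> 0) (at (0::real))" by (auto intro!: tendsto_eq_intros)
    qed
    then show ?thesis using 3 by (simp add: DERIV_def)
  qed
qed

lemma
  assumes "C1 u"
  shows C1_pos_sq: "C1 (\<lambda>x. pos_sq (u x))"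
    and partial_pos_sq: "partial i (\<lambda>x. pos_sq (u x)) x = 2 * max 0 (u x) * partial i u x"
proof -
  have c: "continuous_on (range u) (\<lambda>z. 2 * max 0 z)" by (intro continuous_intros)
  show "C1 (\<lambda>x. pos_sq (u x))" "partial i (\<lambda>x. pos_sq (u x)) x = 2 * max 0 (u x) * partial i u x"
    using C1_compose[OF assms DERIV_pos_sq c] partial_compose[OF assms DERIV_pos_sq c] by auto
qed

lemma C1_norm_sq [intro]: "C1 (\<lambda>x::real^'n::finite. (norm x)\<^sup>2)"
  and partial_norm_sq: "partial i (\<lambda>x::real^'n::finite. (norm x)\<^sup>2) x = 2 * x $ i"
proof -
  have D: "((\<lambda>t. (norm (x + t *\<^sub>R axis i 1))\<^sup>2) has_real_derivative 2 * x $ i) (at 0)" for i and x :: "real^'n"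
  proof -
    have "(norm (x + t *\<^sub>R axis i 1))\<^sup>2 = (norm x)\<^sup>2 + 2 * t * x $ i + t\<^sup>2" for t
      unfolding power2_norm_eq_inner
      by (simp add: inner_add_left inner_add_right inner_axis inner_axis' inner_axis_axis power2_eq_square algebra_simps)
    then show ?thesis by (simp add: DERIV_cong[OF DERIV_add[OF DERIV_add]]) (auto intro!: derivative_eq_intros)
  qed
  show "C1 (\<lambda>x::real^'n::finite. (norm x)\<^sup>2)"
     "partial i (\<lambda>x::real^'n::finite. (norm x)\<^sup>2) x = 2 * x $ i"
    by (rule C1I[where d = "\<lambda>i x. 2 * x $ i"]; intro continuous_intros D)+
qed

lemma C1_comp [intro]: "C1 (\<lambda>x::real^'n::finite. x $ j)"
  and partial_comp: "partial i (\<lambda>x::real^'n::finite. x $ j) x = (if i = j then 1 else 0)"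
  by (rule C1I[where d = "\<lambda>i x. if i = j then 1 else 0"];
    (intro continuous_intros)?; auto simp: axis_def intro!: derivative_eq_intros)+

text \<open>The inner argument is at least 1 for \<open>norm x \<le> R\<close> and at most 0 for
  \<open>norm x \<ge> 2 * R\<close>, so the inner \<open>pos_sq\<close> falls from at least 1 to 0.
  The outer map \<open>1 - pos_sq (1 - z)\<close> clips this at 1 without a corner. The squared norm
  avoids the singularity of the norm at the origin.\<close>

definition cutoff :: "real \<Rightarrow> real^'n::finite \<Rightarrow> real" where
  "cutoff R x = 1 - pos_sq (1 - pos_sq ((4 - (norm x)\<^sup>2 / R\<^sup>2) / 3))"

definition annulus :: "real \<Rightarrow> (real^'n::finite) set" where
  "annulus R = {x. R \<le> norm x \<and> norm x \<le> 2 * R}"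

lemma cutoff_range: "0 \<le> cutoff R x" "cutoff R x \<le> 1"
proof -
  have "pos_sq z \<ge> 0" for z by (simp add: pos_sq_def)
  moreover have "max 0 (1 - pos_sq z) \<le> 1" for z using calculation[of z] by simp
  ultimately show "0 \<le> cutoff R x" "cutoff R x \<le> 1"
    unfolding cutoff_def by (auto simp: pos_sq_def[of "1 - _"] power_le_one)
qed

lemma cutoff_eq_1:
  assumes "R > 0" "norm x \<le> R" shows "cutoff R x = 1"
proof -
  have "(norm x)\<^sup>2 / R\<^sup>2 \<le> 1" using assms by (simp add: power_mono)
  then have "(4 - (norm x)\<^sup>2 / R\<^sup>2) / 3 \<ge> 1" by simp
  then have "pos_sq ((4 - (norm x)\<^sup>2 / R\<^sup>2) / 3) \<ge> 1" by (simp add: pos_sq_def)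
  then show ?thesis by (simp add: cutoff_def pos_sq_def[of "1 - _"])
qed

lemma cutoff_eq_0:
  assumes "R > 0" "norm x \<ge> 2 * R" shows "cutoff R x = 0"
proof -
  have "(norm x)\<^sup>2 / R\<^sup>2 \<ge> (2 * R)\<^sup>2 / R\<^sup>2" using assms by (intro divide_right_mono power_mono) auto
  then have "(4 - (norm x)\<^sup>2 / R\<^sup>2) / 3 \<le> 0" using assms by (simp add: power_mult_distrib)
  then show ?thesis by (simp add: cutoff_def pos_sq_def max_def)
qed

lemma csupp_cutoff: "R > 0 \<Longrightarrow> csupp (cutoff R)"
  unfolding csupp_def by (intro exI[of _ "2 * R"]) (auto intro: cutoff_eq_0)

lemma C1_cutoff: "C1 (cutoff R :: real^'n::finite \<Rightarrow> real)"
  and partial_cutoff: "R > 0 \<Longrightarrow> \<bar>partial i (cutoff R) x\<bar> \<le> 6 / R * indicator (annulus R) (x :: real^'n)"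
proof -
  let ?a = "\<lambda>x::real^'n. (4 - (norm x)\<^sup>2 / R\<^sup>2) / 3"
  have a': "?a = (\<lambda>x. 4/3 - 1 / (3 * R\<^sup>2) * (norm x)\<^sup>2)" by (auto simp: field_simps)
  have Ca: "C1 ?a" and pa: "partial i ?a x = - (2 * x $ i / (3 * R\<^sup>2))" for i x
    unfolding a'
    using C1_diff[OF C1_const C1_cmult[OF C1_norm_sq], of "4/3" "1 / (3 * R\<^sup>2)"]
      partial_diff[OF C1_const C1_cmult[OF C1_norm_sq], of i "4/3" "1 / (3 * R\<^sup>2)" x]
      partial_cmult[OF C1_norm_sq, of i "1 / (3 * R\<^sup>2)" x]
    by (simp_all add: partial_norm_sq)
  let ?b = "\<lambda>x. 1 - pos_sq (?a x)"
  have Cb: "C1 ?b" and pb: "partial i ?b x = - (2 * max 0 (?a x) * partial i ?a x)" for i x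
    using Ca by (auto intro!: C1_diff C1_pos_sq simp: partial_diff partial_pos_sq C1_pos_sq)
  have eq: "cutoff R = (\<lambda>x. 1 - pos_sq (?b x))" by (auto simp: cutoff_def)
  show "C1 (cutoff R :: real^'n \<Rightarrow> real)" unfolding eq using Cb by (auto intro!: C1_diff C1_pos_sq)
  have p: "partial i (cutoff R) x = - (2 * max 0 (?b x) * (2 * max 0 (?a x) * (2 * x $ i / (3 * R\<^sup>2))))"
    unfolding eq using Cb by (simp add: partial_diff partial_pos_sq C1_pos_sq pb pa)
  assume R: "R > 0"
  show "\<bar>partial i (cutoff R) x\<bar> \<le> 6 / R * indicator (annulus R) x"
  \<comment> \<open>Off the transition layer one of the two positive parts is 0 and the derivative
    vanishes; on the layer, \<open>0 < ?a x \<le> 1\<close> places \<open>x\<close> in the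
    annulus.\<close>
  proof (cases "?a x \<le> 0 \<or> ?a x > 1")
    case True
    then have "partial i (cutoff R) x = 0"
    proof
      assume "?a x > 1"
      then have "pos_sq (?a x) > 1" by (simp add: pos_sq_def)
      then show ?thesis unfolding p by simp
    qed (simp add: p)
    then show ?thesis using R by (simp add: indicator_def)
  next
    case False
    then have 1: "(norm x)\<^sup>2 / R\<^sup>2 \<le> 4" "1 \<le> (norm x)\<^sup>2 / R\<^sup>2" by auto
    have "(norm x)\<^sup>2 \<le> (2 * R)\<^sup>2" using 1(1) R unfolding power_mult_distrib by (simp add: divide_le_eq)
    moreover have "R\<^sup>2 \<le> (norm x)\<^sup>2"
      using 1(2) R by (simp only: le_divide_eq_1_pos[OF zero_less_power[OF R]])
    ultimately have n: "norm x \<le> 2 * R" "R \<le> norm x"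
      using R by (auto intro: power2_le_imp_le)
    have xi: "\<bar>x $ i\<bar> \<le> 2 * R" using component_le_norm_cart[of x i] n by simp
    have b: "0 \<le> max 0 (?b x)" "max 0 (?b x) \<le> 1" by (auto simp: pos_sq_def)
    have a: "0 \<le> max 0 (?a x)" "max 0 (?a x) \<le> 1" using False by auto
    have "\<bar>partial i (cutoff R) x\<bar> = max 0 (?b x) * max 0 (?a x) * (8 * \<bar>x $ i\<bar> / (3 * R\<^sup>2))"
      unfolding p abs_minus_cancel abs_mult abs_divide using a b by (simp add: abs_of_nonneg)
    also have "\<dots> \<le> 1 * 1 * (8 * (2 * R) / (3 * R\<^sup>2))"
      using a b xi by (intro mult_mono divide_right_mono) auto
    \<comment> \<open>With both positive parts at most 1 and each component at most
      \<open>2 * R\<close>, the constant is 16/3; it is rounded up to 6.\<close>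
    also have "\<dots> \<le> 6 / R" using R by (simp add: field_simps power2_eq_square)
    finally show ?thesis using n by (simp add: annulus_def)
  qed
qed

section \<open>Cauchy-Schwarz and Fatou for Bochner integrals\<close>

lemma
  fixes f g :: "'a \<Rightarrow> real"
  assumes [measurable]: "f \<in> borel_measurable M" "g \<in> borel_measurable M"
    and f: "integrable M (\<lambda>x. (f x)\<^sup>2)" and g: "integrable M (\<lambda>x. (g x)\<^sup>2)"
  shows integrable_mult_L2: "integrable M (\<lambda>x. f x * g x)"
    and Cauchy_Schwarz_L2: "(\<integral>x. \<bar>f x * g x\<bar> \<partial>M) \<le> sqrt (\<integral>x. (f x)\<^sup>2 \<partial>M) * sqrt (\<integral>x. (g x)\<^sup>2 \<partial>M)"
proof -
  have ab: "\<bar>f x * g x\<bar> \<le> (f x)\<^sup>2 + (g x)\<^sup>2" for x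
    using sum_squares_bound[of "\<bar>f x\<bar>" "\<bar>g x\<bar>"] mult_nonneg_nonneg[of "\<bar>f x\<bar>" "\<bar>g x\<bar>"]
    unfolding abs_mult power2_abs by (simp add: algebra_simps del: mult_nonneg_nonneg)
  show I: "integrable M (\<lambda>x. f x * g x)"
    by (rule Bochner_Integration.integrable_bound[of M "\<lambda>x. (f x)\<^sup>2 + (g x)\<^sup>2"]) (use f g ab in auto)
  define a b c where "a = (\<integral>x. (f x)\<^sup>2 \<partial>M)" and "b = (\<integral>x. (g x)\<^sup>2 \<partial>M)" and "c = (\<integral>x. \<bar>f x * g x\<bar> \<partial>M)"
  have nn: "a \<ge> 0" "b \<ge> 0" "c \<ge> 0" by (auto simp: a_def b_def c_def)
  have "c\<^sup>2 \<le> a * b"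
  proof (cases "a = 0")
    case True
    then have "AE x in M. (f x)\<^sup>2 = 0" using f by (simp add: a_def integral_nonneg_eq_0_iff_AE)
    then have "c = (\<integral>x. 0 \<partial>M)" unfolding c_def by (intro integral_cong_AE) auto
    with True show ?thesis by simp
  next
    case False
    \<comment> \<open>The minimiser in \<open>t\<close> of the nonnegative quadratic
      \<open>b - 2 * t * c + t\<^sup>2 * a\<close>; its value there is
      \<open>b - c\<^sup>2 / a\<close>.\<close>
    define t where "t = c / a"
    have "0 \<le> (\<integral>x. (\<bar>g x\<bar> - t * \<bar>f x\<bar>)\<^sup>2 \<partial>M)" by simp
    also have "\<dots> = (\<integral>x. (g x)\<^sup>2 - 2 * t * \<bar>f x * g x\<bar> + t\<^sup>2 * (f x)\<^sup>2 \<partial>M)"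
      by (intro Bochner_Integration.integral_cong) (auto simp: power2_diff abs_mult power_mult_distrib)
    also have "\<dots> = b - 2 * t * c + t\<^sup>2 * a"
      using f g I by (simp add: a_def b_def c_def)
    also have "\<dots> = b - c\<^sup>2 / a" using False by (simp add: t_def field_simps power2_eq_square)
    finally show ?thesis using False nn by (simp add: field_simps)
  qed
  then have "c \<le> sqrt (a * b)" using nn by (simp add: real_le_rsqrt)
  then show "(\<integral>x. \<bar>f x * g x\<bar> \<partial>M) \<le> sqrt (\<integral>x. (f x)\<^sup>2 \<partial>M) * sqrt (\<integral>x. (g x)\<^sup>2 \<partial>M)"
    by (simp add: a_def b_def c_def real_sqrt_mult)
qed

text \<open>Delivers integrability of the limit together with the bound, from bounds
  \<open>B n\<close> that merely converge. It is used where a cut-off has to be removed and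
  integrability without it is the point at issue.\<close>

lemma Fatou_integral:
  fixes f :: "nat \<Rightarrow> 'a \<Rightarrow> real"
  assumes int: "\<And>n. integrable M (f n)" and nn: "\<And>n x. 0 \<le> f n x" and lim: "\<And>x. (\<lambda>n. f n x) \<longlonglongrightarrow> g x"
    and le: "\<And>n. (\<integral>x. f n x \<partial>M) \<le> B n" and B: "B \<longlonglongrightarrow> b"
  shows "integrable M g" and "(\<integral>x. g x \<partial>M) \<le> b"
proof -
  have g[measurable]: "g \<in> borel_measurable M"
    by (rule borel_measurable_LIMSEQ_real[where u = f]) (use int lim in auto)
  have gnn: "0 \<le> g x" for x using lim nn by (meson LIMSEQ_le_const)
  have Bnn: "0 \<le> B n" for n using le[of n] Bochner_Integration.integral_nonneg[of M "f n"] nn by (meson order_trans)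
  have bnn: "0 \<le> b" using B Bnn by (meson LIMSEQ_le_const)
  have "(\<integral>\<^sup>+x. ennreal (g x) \<partial>M) = (\<integral>\<^sup>+x. liminf (\<lambda>n. ennreal (f n x)) \<partial>M)"
    by (intro nn_integral_cong lim_imp_Liminf[symmetric] tendsto_ennrealI lim) simp
  also have "\<dots> \<le> liminf (\<lambda>n. \<integral>\<^sup>+x. ennreal (f n x) \<partial>M)"
    by (rule nn_integral_liminf) (use int in auto)
  also have "\<dots> \<le> liminf (\<lambda>n. ennreal (B n))"
    by (intro Liminf_mono always_eventually allI) (use int nn le in \<open>simp add: nn_integral_eq_integral ennreal_leI\<close>)
  also have "\<dots> = ennreal b" using B by (simp add: lim_imp_Liminf)
  finally have *: "(\<integral>\<^sup>+x. ennreal (g x) \<partial>M) \<le> ennreal b" .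
  then show I: "integrable M g"
    using gnn by (intro integrableI_bounded) (auto simp: less_top[symmetric] top_unique)
  show "(\<integral>x. g x \<partial>M) \<le> b"
    using * I gnn bnn by (simp add: nn_integral_eq_integral)
qed

lemma cutoff_tendsto: "(\<lambda>n. cutoff (real (Suc n)) x) \<longlonglongrightarrow> 1"
proof (rule tendsto_eventually)
  obtain N :: nat where "norm x \<le> real N" using real_arch_simple by blast
  then show "\<forall>\<^sub>F n in sequentially. cutoff (real (Suc n)) x = 1"
    unfolding eventually_sequentially by (intro exI[of _ N]) (auto intro!: cutoff_eq_1)
qed

lemma cball_borel [measurable]: "cball (x :: 'a :: euclidean_space) r \<in> sets borel"
  by (intro borel_closed closed_cball)

section \<open>Radial integrals and convolutions\<close>

text \<open>Each point with \<open>f x \<noteq> 0\<close> is charged to one ball with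
  \<open>f x \<le> a n\<close>, so \<open>f\<close> lies below the sum of \<open>a n\<close> times
  the ball indicators. Whole balls in place of shells cost only a constant factor.\<close>

lemma dyadic_integral_bound:
  fixes f :: "real^'n::finite \<Rightarrow> real"
  assumes f[measurable]: "f \<in> borel_measurable borel" and nn: "\<And>x. f x \<ge> 0"
    and a: "\<And>n. a n \<ge> 0" and r: "\<And>n. r n \<ge> 0"
    and cov: "\<And>x. f x \<noteq> 0 \<Longrightarrow> \<exists>n::nat. norm x \<le> r n \<and> f x \<le> a n"
    and s: "(\<lambda>n. a n * r n ^ CARD('n)) sums s"
  shows "integrable lborel f" and "(LBINT x. f x) \<le> unit_ball_vol (real CARD('n)) * s"
proof -
  let ?V = "unit_ball_vol (real CARD('n))"
  have V: "?V \<ge> 0" by (simp add: unit_ball_vol_def)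
  have ennle: "ennreal (f x) \<le> (\<Sum>n. ennreal (a n) * indicator (cball 0 (r n)) x)" for x
  proof (cases "f x = 0")
    case False
    then obtain n where n: "norm x \<le> r n" "f x \<le> a n" using cov by blast
    define F where "F n = ennreal (a n) * indicator (cball 0 (r n)) x" for n
    have "ennreal (f x) \<le> F n" using n by (simp add: ennreal_leI F_def)
    also have "\<dots> \<le> (\<Sum>n. F n)"
      using sum_le_suminf[of F "{n}"] by simp
    finally show ?thesis by (simp add: F_def)
  qed simp
  have "(\<integral>\<^sup>+x. ennreal (f x) \<partial>lborel) \<le> (\<integral>\<^sup>+x. (\<Sum>n. ennreal (a n) * indicator (cball (0::real^'n) (r n)) x) \<partial>lborel)"
    by (intro nn_integral_mono ennle)
  also have "\<dots> = (\<Sum>n. \<integral>\<^sup>+x. ennreal (a n) * indicator (cball (0::real^'n) (r n)) x \<partial>lborel)"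
    by (intro nn_integral_suminf borel_measurable_times borel_measurable_const borel_measurable_indicator) simp
  also have "\<dots> = (\<Sum>n. ennreal (?V * (a n * r n ^ CARD('n))))"
    by (intro arg_cong[where f = suminf] ext)
       (simp add: nn_integral_cmult_indicator emeasure_cball r a V ennreal_mult[symmetric] mult_ac)
  also have "\<dots> = ennreal (?V * s)"
    by (intro suminf_ennreal_eq sums_mult s mult_nonneg_nonneg V a zero_le_power r)
  finally have *: "(\<integral>\<^sup>+x. ennreal (f x) \<partial>lborel) \<le> ennreal (?V * s)" .
  then show I: "integrable lborel f"
    using nn by (intro integrableI_bounded) (auto simp: less_top[symmetric] top_unique)
  have "s \<ge> 0" using s a r by (auto intro!: sums_le[OF _ sums_zero s])
  then show "(LBINT x. f x) \<le> ?V * s"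
    using * I nn V by (simp add: nn_integral_eq_integral)
qed

lemma dyadic_ex:
  assumes "1 \<le> (t::real)" shows "\<exists>n::nat. 2 ^ n \<le> t \<and> t \<le> 2 ^ Suc n"
proof -
  obtain N :: nat where N: "t < 2 ^ N" using real_arch_pow[of 2 t] by auto
  define m where "m = (LEAST m. t < 2 ^ m)"
  have m: "t < 2 ^ m" unfolding m_def by (rule LeastI) (rule N)
  have "m \<noteq> 0" using m assms by (cases m) auto
  then obtain k where k: "m = Suc k" by (cases m) auto
  have "\<not> t < 2 ^ k" using not_less_Least[of k "\<lambda>m. t < 2 ^ m"] k by (simp add: m_def)
  then show ?thesis using m k by (intro exI[of _ k]) auto
qed

text \<open>On the shell between \<open>2 ^ n * R\<close> and \<open>2 ^ Suc n * R\<close> the power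
  is at most its value at the inner radius, and height times volume is geometric in \<open>n\<close>
  with ratio \<open>2 powr (- m)\<close>. The constant \<open>C\<close> is common to all radii,
  because later estimates vary \<open>R\<close>.\<close>

lemma radial_tail:
  fixes m :: real
  assumes m: "m > 0"
  obtains C where "C \<ge> 0" "\<And>R. R > 0 \<Longrightarrow>
      integrable lborel (\<lambda>x::real^'n::finite. indicator {x. R \<le> norm x} x * norm x powr (- (real CARD('n) + m)))"
    "\<And>R. R > 0 \<Longrightarrow> (LBINT x. indicator {x. R \<le> norm x} x * norm (x::real^'n) powr (- (real CARD('n) + m))) \<le> C * R powr (- m)"
proof -
  let ?d = "real CARD('n)"
  define q where "q = (2::real) powr (- m)"
  have q: "0 < q" "q < 1" using m powr_less_mono[of "-m" 0 2] by (auto simp: q_def)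
  define C where "C = unit_ball_vol ?d * (2 ^ CARD('n) * (1 / (1 - q)))"
  have C: "C \<ge> 0" using q by (simp add: C_def unit_ball_vol_def)
  have *: "integrable lborel (\<lambda>x::real^'n. indicator {x. R \<le> norm x} x * norm x powr (- (?d + m)))
     \<and> (LBINT x. indicator {x. R \<le> norm x} x * norm (x::real^'n) powr (- (?d + m))) \<le> C * R powr (- m)"
    if R: "R > 0" for R
  proof -
    let ?f = "\<lambda>x::real^'n. indicator {x. R \<le> norm x} x * norm x powr (- (?d + m))"
    let ?a = "\<lambda>n::nat. (2 ^ n * R) powr (- (?d + m))" and ?r = "\<lambda>n::nat. 2 ^ Suc n * R"
    have t: "?a n * ?r n ^ CARD('n) = 2 ^ CARD('n) * R powr (- m) * q ^ n" for n
    proof -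
      have "?r n ^ CARD('n) = 2 ^ CARD('n) * (2 ^ n * R) powr ?d"
        using R by (simp add: powr_realpow power_mult_distrib)
      then have "?a n * ?r n ^ CARD('n) = 2 ^ CARD('n) * ((2 ^ n * R) powr (- (?d + m)) * (2 ^ n * R) powr ?d)"
        by simp
      also have "\<dots> = 2 ^ CARD('n) * (2 ^ n * R) powr (- m)" by (simp add: powr_add[symmetric])
      also have "\<dots> = 2 ^ CARD('n) * (q ^ n * R powr (- m))"
        using R by (simp add: powr_mult q_def powr_realpow[symmetric] powr_powr mult.commute)
      finally show ?thesis by simp
    qed
    have s: "(\<lambda>n. ?a n * ?r n ^ CARD('n)) sums (2 ^ CARD('n) * R powr (- m) * (1 / (1 - q)))"
      unfolding t by (intro sums_mult geometric_sums) (use q in auto)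
    have cov: "\<exists>n. norm x \<le> ?r n \<and> ?f x \<le> ?a n" if "?f x \<noteq> 0" for x
    proof -
      have x: "R \<le> norm x" using that by (auto simp: indicator_def split: if_splits)
      obtain n :: nat where n: "2 ^ n \<le> norm x / R" "norm x / R \<le> 2 ^ Suc n"
        using dyadic_ex[of "norm x / R"] x R by auto
      have "norm x powr (- (?d + m)) \<le> ?a n"
        using n R m by (intro powr_mono2') (auto simp: field_simps)
      then show ?thesis using n R x by (intro exI[of _ n]) (auto simp: field_simps)
    qed
    show ?thesis
      using dyadic_integral_bound[of ?f ?a ?r, OF _ _ _ _ cov s] R by (simp add: C_def mult_ac)
  qed
  show thesis using that[OF C] * by blast
qed

text \<open>The singularity is one power weaker than the volume can bear, so the shells of inner
  radius \<open>1 / 2 ^ Suc n\<close> contribute a geometric series of ratio 1/2.\<close>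

lemma radial_head:
  "integrable lborel (\<lambda>x::real^'n::finite. indicator (cball 0 1) x * norm x powr (1 - real CARD('n)))"
proof -
  let ?d = "real CARD('n)"
  let ?f = "\<lambda>x::real^'n. indicator (cball 0 1) x * norm x powr (1 - ?d)"
  let ?a = "\<lambda>n::nat. (1 / 2 ^ Suc n) powr (1 - ?d)" and ?r = "\<lambda>n::nat. 1 / 2 ^ n :: real"
  have d: "?d \<ge> 1" using zero_less_card_finite[where 'a='n] by linarith
  have t: "?a n * ?r n ^ CARD('n) = 2 powr (?d - 1) * (1 / 2) ^ n" for n
  proof -
    have "?r n ^ CARD('n) = (1 / 2 ^ n) powr ?d" by (simp add: powr_realpow)
    moreover have "?a n = 2 powr (?d - 1) * (1 / 2 ^ n) powr (1 - ?d)"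
      by (simp add: powr_divide powr_mult powr_diff field_simps)
    ultimately have "?a n * ?r n ^ CARD('n) = 2 powr (?d - 1) * ((1 / 2 ^ n) powr (1 - ?d) * (1 / 2 ^ n) powr ?d)"
      by simp
    also have "\<dots> = 2 powr (?d - 1) * (1 / 2 ^ n)" by (simp add: powr_add[symmetric])
    finally show ?thesis by (simp add: power_one_over)
  qed
  have s: "(\<lambda>n. ?a n * ?r n ^ CARD('n)) sums (2 powr (?d - 1) * (1 / (1 - 1 / 2)))"
    unfolding t by (intro sums_mult geometric_sums) auto
  have cov: "\<exists>n. norm x \<le> ?r n \<and> ?f x \<le> ?a n" if "?f x \<noteq> 0" for x
  proof -
    have x: "norm x \<le> 1" "norm x > 0" using that by (auto simp: indicator_def split: if_splits)
    obtain n :: nat where n: "2 ^ n \<le> 1 / norm x" "1 / norm x \<le> 2 ^ Suc n"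
      using dyadic_ex[of "1 / norm x"] x by auto
    have "norm x powr (1 - ?d) \<le> ?a n"
      using n x d by (intro powr_mono2') (auto simp: field_simps)
    then show ?thesis using n x by (intro exI[of _ n]) (auto simp: field_simps)
  qed
  show ?thesis
    by (rule dyadic_integral_bound(1)[of ?f ?a ?r, OF _ _ _ _ cov s])
       (auto intro!: borel_measurable_times powr_real_measurable)
qed

section \<open>Convolution with a compactly supported function\<close>

definition conv :: "(real^'n::finite \<Rightarrow> real) \<Rightarrow> (real^'n \<Rightarrow> real) \<Rightarrow> real^'n \<Rightarrow> real" where
  "conv k g x = (LBINT y. k (x - y) * g y)"

lemma conv_integrable:
  assumes "continuous_on UNIV k" "continuous_on UNIV g" "csupp g"
  shows "integrable lborel (\<lambda>y. k (x - y) * g y)"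
  using assms
  by (intro integrable_csupp_mult continuous_on_compose2[OF assms(1)] continuous_intros) auto

lemma conv_continuous:
  fixes k g :: "real^'n::finite \<Rightarrow> real"
  assumes k: "continuous_on UNIV k" "\<And>x. \<bar>k x\<bar> \<le> B" and g: "continuous_on UNIV g" "csupp g"
  shows "continuous_on UNIV (conv k g)"
  unfolding continuous_on_sequentially
proof (intro allI ballI impI)
  fix X :: "nat \<Rightarrow> real^'n" and a assume X: "(\<forall>n. X n \<in> UNIV) \<and> X \<longlonglongrightarrow> a"
  have m: "(\<lambda>y. k (x - y) * g y) \<in> borel_measurable lborel" for x
    using conv_integrable[OF k(1) g] by (rule borel_measurable_integrable)
  have "(\<lambda>n. LBINT y. k (X n - y) * g y) \<longlonglongrightarrow> (LBINT y. k (a - y) * g y)"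
  proof (rule integral_dominated_convergence[where w = "\<lambda>y. B * \<bar>g y\<bar>"])
    show "integrable lborel (\<lambda>y. B * \<bar>g y\<bar>)"
      by (intro integrable_mult_right integrable_abs integrable_csupp g)
    show "AE y in lborel. (\<lambda>n. k (X n - y) * g y) \<longlonglongrightarrow> k (a - y) * g y"
    proof (intro AE_I2 tendsto_mult tendsto_const)
      fix y
      have "isCont k (a - y)" using k(1) by (simp add: continuous_on_eq_continuous_at)
      then show "(\<lambda>n. k (X n - y)) \<longlonglongrightarrow> k (a - y)"
        using X by (intro isCont_tendsto_compose[of _ k] tendsto_intros) auto
    qed
    show "AE y in lborel. norm (k (X n - y) * g y) \<le> B * \<bar>g y\<bar>" for n
      using k(2) by (intro AE_I2) (simp add: abs_mult mult_right_mono)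
  qed (use m in auto)
  then show "(conv k g \<circ> X) \<longlonglongrightarrow> conv k g a" by (simp add: comp_def conv_def)
qed

text \<open>All derivatives fall on the kernel, so continuity of \<open>g\<close> is enough
  regularity on that side; the bound on the derivative of the kernel supplies the majorant
  \<open>B' * \<bar>g y\<bar>\<close>.\<close>

lemma
  fixes k g :: "real^'n::finite \<Rightarrow> real"
  assumes k: "C1 k" "\<And>x. \<bar>k x\<bar> \<le> B" "\<And>i x. \<bar>partial i k x\<bar> \<le> B'" and g: "continuous_on UNIV g" "csupp g"
  shows C1_conv: "C1 (conv k g)"
    and partial_conv: "partial i (conv k g) x = conv (partial i k) g x"
proof -
  note k0 = C1_continuous[OF k(1), of UNIV] and k1 = C1_partial_continuous[OF k(1), of UNIV]
  have D: "((\<lambda>t. conv k g (x + t *\<^sub>R axis i 1)) has_real_derivative conv (partial i k) g x) (at 0)" for i x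
  proof -
    have "((\<lambda>t. \<integral>y. k (x - y + t *\<^sub>R axis i 1) * g y \<partial>lborel) has_real_derivative
        (LBINT y. partial i k (x - y + 0 *\<^sub>R axis i 1) * g y)) (at 0)"
    proof (rule deriv_under_integral[where h = "\<lambda>t y. k (x - y + t *\<^sub>R axis i 1) * g y"
         and h' = "\<lambda>t y. partial i k (x - y + t *\<^sub>R axis i 1) * g y" and G = "\<lambda>y. B' * \<bar>g y\<bar>"])
      show "integrable lborel (\<lambda>y. k (x - y + t *\<^sub>R axis i 1) * g y)" for t
        using conv_integrable[OF k0 g, of "x + t *\<^sub>R axis i 1"] by (simp add: algebra_simps)
      show "(\<lambda>y. partial i k (x - y + 0 *\<^sub>R axis i 1) * g y) \<in> borel_measurable lborel"
        using borel_measurable_integrable[OF conv_integrable[OF k1 g, of i x]] by simp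
      show "((\<lambda>s. k (x - y + s *\<^sub>R axis i 1) * g y) has_real_derivative partial i k (x - y + t *\<^sub>R axis i 1) * g y) (at t)" for t y
        by (intro DERIV_cmult_right C1_deriv_at k)
      show "integrable lborel (\<lambda>y. B' * \<bar>g y\<bar>)"
        by (intro integrable_mult_right integrable_abs integrable_csupp g)
      show "\<bar>partial i k (x - y + t *\<^sub>R axis i 1) * g y\<bar> \<le> B' * \<bar>g y\<bar>" for t y
        using k(3) by (simp add: abs_mult mult_right_mono)
    qed
    then show ?thesis by (simp add: conv_def algebra_simps)
  qed
  show "C1 (conv k g)" "partial i (conv k g) x = conv (partial i k) g x"
    by (rule C1I[where d = "\<lambda>i x. conv (partial i k) g x",
        OF conv_continuous[OF k0 k(2) g] conv_continuous[OF k1 k(3) g] D])+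
qed

lemma integrable_lborel_affine:
  fixes f :: "'a::euclidean_space \<Rightarrow> real"
  assumes "integrable lborel f" and c: "c \<noteq> 0"
  shows "integrable lborel (\<lambda>x. f (a + c *\<^sub>R x))"
proof -
  have [measurable]: "f \<in> borel_measurable borel" using assms(1) by auto
  have "integrable (density (distr lborel borel (\<lambda>x. a + c *\<^sub>R x)) (\<lambda>_. \<bar>c\<bar> ^ DIM('a))) f"
    using lborel_affine[OF c, of a] assms by simp
  then have "integrable (distr lborel borel (\<lambda>x. a + c *\<^sub>R x)) (\<lambda>x. \<bar>c\<bar> ^ DIM('a) *\<^sub>R f x)"
    by (subst (asm) integrable_density) auto
  then have "integrable lborel (\<lambda>x. \<bar>c\<bar> ^ DIM('a) *\<^sub>R f (a + c *\<^sub>R x))"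
    by (subst (asm) integrable_distr_eq) auto
  then show ?thesis using c by simp
qed

text \<open>Fubini. The double integral converges absolutely because the kernel is integrable,
  \<open>P\<close> is bounded and \<open>g\<close> has compact support; so \<open>P\<close> may be a
  pressure without decay.\<close>

lemma
  fixes k g P :: "real^'n::finite \<Rightarrow> real"
  assumes k: "continuous_on UNIV k" "integrable lborel k" and P: "continuous_on UNIV P" "\<And>x. \<bar>P x\<bar> \<le> B"
    and g: "continuous_on UNIV g" "csupp g"
  shows conv_mult_integrable: "integrable lborel (\<lambda>x. P x * conv k g x)"
    and conv_swap_measurable: "(\<lambda>y. LBINT x. k (x - y) * P x) \<in> borel_measurable borel"
    and conv_swap: "(LBINT x. P x * conv k g x) = (LBINT y. g y * (LBINT x. k (x - y) * P x))"
proof -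
  have [measurable]: "k \<in> borel_measurable borel" "P \<in> borel_measurable borel" "g \<in> borel_measurable borel"
    using k P g borel_measurable_continuous_onI by blast+
  let ?F = "\<lambda>(x, y). P x * (k (x - y) * g y)"
  have m: "?F \<in> borel_measurable (lborel \<Otimes>\<^sub>M lborel)" by measurable
  have kI: "integrable lborel (\<lambda>x. k (x - y))" for y
    using integrable_lborel_affine[OF k(2), of 1 "- y"] by simp
  have kn: "(\<integral>\<^sup>+x. ennreal \<bar>k (x - y)\<bar> \<partial>lborel) = ennreal (LBINT x. \<bar>k x\<bar>)" for y
  proof -
    have "(\<integral>\<^sup>+x. ennreal \<bar>k (x - y)\<bar> \<partial>lborel) = ennreal (LBINT x. \<bar>k (x - y)\<bar>)"
      using kI[of y] by (intro nn_integral_eq_integral integrable_abs) auto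
    also have "(LBINT x. \<bar>k (x - y)\<bar>) = (LBINT x. \<bar>k x\<bar>)"
      using lborel_integral_translate[of "\<lambda>x. \<bar>k x\<bar>" "- y"] by simp
    finally show ?thesis .
  qed
  have B: "B \<ge> 0" using P(2)[of 0] by linarith
  have gI: "integrable lborel (\<lambda>y. \<bar>g y\<bar>)" by (intro integrable_abs integrable_csupp g)
  have "(\<integral>\<^sup>+z. ennreal (norm (?F z)) \<partial>(lborel \<Otimes>\<^sub>M lborel))
      = (\<integral>\<^sup>+y. (\<integral>\<^sup>+x. ennreal (norm (P x * (k (x - y) * g y))) \<partial>lborel) \<partial>lborel)"
    by (subst lborel_pair.nn_integral_snd[symmetric]) (auto simp: split_beta')
  also have "\<dots> \<le> (\<integral>\<^sup>+y. (\<integral>\<^sup>+x. ennreal (B * \<bar>g y\<bar>) * ennreal \<bar>k (x - y)\<bar> \<partial>lborel) \<partial>lborel)"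
  proof (intro nn_integral_mono)
    fix x y :: "real^'n"
    have "norm (P x * (k (x - y) * g y)) \<le> B * (\<bar>k (x - y)\<bar> * \<bar>g y\<bar>)"
      unfolding real_norm_def abs_mult by (intro mult_right_mono P) auto
    then show "ennreal (norm (P x * (k (x - y) * g y))) \<le> ennreal (B * \<bar>g y\<bar>) * ennreal \<bar>k (x - y)\<bar>"
      using B by (simp add: ennreal_mult[symmetric] ennreal_leI mult_ac)
  qed
  also have "\<dots> = (\<integral>\<^sup>+y. ennreal (B * \<bar>g y\<bar>) * ennreal (LBINT x. \<bar>k x\<bar>) \<partial>lborel)"
    by (simp add: nn_integral_cmult kn)
  also have "\<dots> = (\<integral>\<^sup>+y. ennreal (B * \<bar>g y\<bar>) \<partial>lborel) * ennreal (LBINT x. \<bar>k x\<bar>)"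
    by (rule nn_integral_multc) auto
  also have "\<dots> = ennreal (LBINT y. B * \<bar>g y\<bar>) * ennreal (LBINT x. \<bar>k x\<bar>)"
    using gI B by (subst nn_integral_eq_integral) auto
  also have "\<dots> < \<infinity>" by (simp add: ennreal_mult_less_top)
  finally have I: "integrable (lborel \<Otimes>\<^sub>M lborel) ?F"
    using m by (intro integrableI_bounded) auto
  have "integrable lborel (\<lambda>x. \<integral>y. P x * (k (x - y) * g y) \<partial>lborel)"
    using lborel_pair.integrable_fst'[OF I] by simp
  then show "integrable lborel (\<lambda>x. P x * conv k g x)" by (simp add: conv_def)
  have "(\<lambda>y. LBINT x. (\<lambda>(y, x). k (x - y) * P x) (y, x)) \<in> borel_measurable lborel"
    by (rule lborel.borel_measurable_lebesgue_integral) measurable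
  then show "(\<lambda>y. LBINT x. k (x - y) * P x) \<in> borel_measurable borel" by simp
  have "(LBINT x. P x * conv k g x) = (LBINT x. (LBINT y. P x * (k (x - y) * g y)))"
    by (simp add: conv_def)
  also have "\<dots> = (LBINT y. (LBINT x. P x * (k (x - y) * g y)))"
    using lborel_pair.Fubini_integral[OF I] by simp
  also have "\<dots> = (LBINT y. g y * (LBINT x. k (x - y) * P x))"
    by (intro Bochner_Integration.integral_cong refl)
       (simp add: integral_mult_right_zero[symmetric] mult_ac del: integral_mult_right_zero)
  finally show "(LBINT x. P x * conv k g x) = (LBINT y. g y * (LBINT x. k (x - y) * P x))" .
qed

text \<open>Young's inequality for an L1 kernel and an L2 function. Writing \<open>k\<close> as a
  product of two square roots, Cauchy-Schwarz bounds the square of the convolution by the mass times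
  the convolution of the square; integrating in \<open>x\<close> gives the second factor of the
  mass. Evenness identifies the integral of \<open>k (x - y)\<close> over \<open>y\<close> with the
  mass.\<close>

lemma conv_L2:
  fixes k g :: "real^'n::finite \<Rightarrow> real"
  assumes k: "continuous_on UNIV k" "integrable lborel k" "\<And>x. 0 \<le> k x" "\<And>x. k (- x) = k x"
    and g: "continuous_on UNIV g" "csupp g" and m[measurable]: "conv k g \<in> borel_measurable borel"
  shows "integrable lborel (\<lambda>x. (conv k g x)\<^sup>2)"
    and "(LBINT x. (conv k g x)\<^sup>2) \<le> (LBINT x. k x)\<^sup>2 * (LBINT x. (g x)\<^sup>2)"
proof -
  define \<omega> where "\<omega> = (LBINT x. k x)"
  have \<omega>: "\<omega> \<ge> 0" using k by (simp add: \<omega>_def)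
  have [measurable]: "k \<in> borel_measurable borel" "g \<in> borel_measurable borel"
    using k g borel_measurable_continuous_onI by blast+
  have g2: "continuous_on UNIV (\<lambda>x. (g x)\<^sup>2)" "csupp (\<lambda>x. (g x)\<^sup>2)"
    using g by (auto intro!: continuous_intros simp: power2_eq_square)
  have kI: "integrable lborel (\<lambda>y. k (x - y))" "(LBINT y. k (x - y)) = \<omega>" for x
  proof -
    have "k (x - y) = k (- x + 1 *\<^sub>R y)" for y using k(4)[of "y - x"] by simp
    then show "integrable lborel (\<lambda>y. k (x - y))" "(LBINT y. k (x - y)) = \<omega>"
      using integrable_lborel_affine[OF k(2), of 1 "-x"] lborel_integral_affine[of k 1 "-x"] by (auto simp: \<omega>_def)
  qed
  have pw: "(conv k g x)\<^sup>2 \<le> \<omega> * conv k (\<lambda>x. (g x)\<^sup>2) x" for x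
  proof -
    have I: "integrable lborel (\<lambda>y. k (x - y) * (g y)\<^sup>2)" by (rule conv_integrable[OF k(1) g2])
    have "\<bar>conv k g x\<bar> \<le> (LBINT y. \<bar>k (x - y) * g y\<bar>)"
      unfolding conv_def by (rule integral_abs_bound)
    also have "\<dots> = (LBINT y. \<bar>sqrt (k (x - y)) * (sqrt (k (x - y)) * g y)\<bar>)"
      using k(3) by (intro Bochner_Integration.integral_cong) (auto simp: mult.assoc[symmetric])
    also have "\<dots> \<le> sqrt (LBINT y. (sqrt (k (x - y)))\<^sup>2) * sqrt (LBINT y. (sqrt (k (x - y)) * g y)\<^sup>2)"
      using kI k(3) I by (intro Cauchy_Schwarz_L2) (auto simp: power_mult_distrib)
    also have "\<dots> = sqrt \<omega> * sqrt (conv k (\<lambda>x. (g x)\<^sup>2) x)"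
      using k(3) kI by (simp add: power_mult_distrib conv_def)
    finally have "\<bar>conv k g x\<bar>\<^sup>2 \<le> (sqrt \<omega> * sqrt (conv k (\<lambda>x. (g x)\<^sup>2) x))\<^sup>2"
      by (intro power_mono) auto
    moreover have "conv k (\<lambda>x. (g x)\<^sup>2) x \<ge> 0" unfolding conv_def using k(3) by simp
    ultimately show ?thesis using \<omega> by (simp add: power_mult_distrib)
  qed
  have I: "integrable lborel (conv k (\<lambda>x. (g x)\<^sup>2))"
    using conv_mult_integrable[OF k(1,2), of "\<lambda>_. 1" 1, OF _ _ g2] by simp
  have "(LBINT x. conv k (\<lambda>x. (g x)\<^sup>2) x) = (LBINT y. (g y)\<^sup>2 * (LBINT x. k (x - y)))"
    using conv_swap[OF k(1,2), of "\<lambda>_. 1" 1, OF _ _ g2] by simp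
  also have "\<dots> = (LBINT y. (g y)\<^sup>2 * \<omega>)"
    using lborel_integral_translate[of k "- _"] by (simp add: \<omega>_def)
  finally have E: "(LBINT x. conv k (\<lambda>x. (g x)\<^sup>2) x) = \<omega> * (LBINT y. (g y)\<^sup>2)" by simp
  show J: "integrable lborel (\<lambda>x. (conv k g x)\<^sup>2)"
    by (rule Bochner_Integration.integrable_bound[of lborel "\<lambda>x. \<omega> * conv k (\<lambda>x. (g x)\<^sup>2) x"])
       (use pw I in \<open>auto intro: order_trans[OF pw abs_ge_self]\<close>)
  have "(LBINT x. (conv k g x)\<^sup>2) \<le> (LBINT x. \<omega> * conv k (\<lambda>x. (g x)\<^sup>2) x)"
    using I J pw by (intro integral_mono) auto
  also have "\<dots> = \<omega>\<^sup>2 * (LBINT x. (g x)\<^sup>2)" using E by (simp add: power2_eq_square)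
  finally show "(LBINT x. (conv k g x)\<^sup>2) \<le> (LBINT x. k x)\<^sup>2 * (LBINT x. (g x)\<^sup>2)"
    by (simp add: \<omega>_def)
qed

lemma mean_value_partial:
  fixes f :: "real^'n::finite \<Rightarrow> real"
  assumes f: "\<And>x. f differentiable (at x)"
    and M: "\<And>t i. 0 \<le> t \<Longrightarrow> t \<le> 1 \<Longrightarrow> \<bar>partial i f (x - t *\<^sub>R y)\<bar> \<le> M"
  shows "\<bar>f (x - y) - f x\<bar> \<le> real CARD('n) * M * norm y"
proof -
  let ?D = "\<lambda>t. \<Sum>i\<in>UNIV. - (y $ i * partial i f (x - t *\<^sub>R y))"
  have "norm (f (x - 1 *\<^sub>R y) - f (x - 0 *\<^sub>R y)) \<le> (real CARD('n) * M * norm y) * norm (1 - 0 :: real)"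
  proof (rule field_differentiable_bound[of "{0..1}" "\<lambda>t. f (x - t *\<^sub>R y)" ?D])
    fix t :: real assume t: "t \<in> {0..1}"
    have "((\<lambda>t. f (x - t *\<^sub>R y)) has_derivative (\<lambda>s. \<Sum>i\<in>UNIV. (- (s *\<^sub>R y)) $ i * partial i f (x - t *\<^sub>R y))) (at t)"
      by (rule has_derivative_compose[OF _ differentiable_directional(1)[OF f]]) (auto intro!: derivative_eq_intros)
    moreover have "(\<lambda>s. \<Sum>i\<in>UNIV. (- (s *\<^sub>R y)) $ i * partial i f (x - t *\<^sub>R y)) = (*) (?D t)"
      by (auto simp: fun_eq_iff sum_distrib_right sum_distrib_left sum_negf mult_ac)
    ultimately show "((\<lambda>t. f (x - t *\<^sub>R y)) has_field_derivative ?D t) (at t within {0..1})"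
      by (simp add: has_field_derivative_def has_derivative_at_withinI)
    have "norm (?D t) \<le> (\<Sum>i\<in>(UNIV :: 'n set). norm y * M)"
    proof (rule sum_norm_le)
      show "norm (- (y $ i * partial i f (x - t *\<^sub>R y))) \<le> norm y * M" for i
        using t M[of t i] component_le_norm_cart[of y i]
        by (simp only: real_norm_def abs_minus_cancel abs_mult) (intro mult_mono, auto)
    qed
    then show "norm (?D t) \<le> real CARD('n) * M * norm y" by (simp add: mult_ac)
  qed auto
  then show ?thesis by simp
qed

text \<open>Mean zero permits subtracting \<open>k x\<close> from the kernel, so the decay is that
  of the derivative of \<open>k\<close>, one power better for the kernels used here. On the segment
  from \<open>x\<close> to \<open>x - y\<close> the norm stays above \<open>norm x / 2\<close>,
  because \<open>norm y \<le> r \<le> norm x / 2\<close> where \<open>g\<close> lives.\<close>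

lemma conv_decay:
  fixes k g :: "real^'n::finite \<Rightarrow> real"
  assumes k: "\<And>x. k differentiable (at x)" "\<And>i z. z \<noteq> 0 \<Longrightarrow> \<bar>partial i k z\<bar> \<le> A * norm z powr (- m)" and m: "m \<ge> 0" and A: "A \<ge> 0"
    and g: "continuous_on UNIV g" "\<And>y. norm y > r \<Longrightarrow> g y = 0" "(LBINT y. g y) = 0"
    and r: "r > 0" and x: "norm x \<ge> 2 * r"
  shows "\<bar>conv k g x\<bar> \<le> real CARD('n) * A * r * (norm x / 2) powr (- m) * (LBINT y. \<bar>g y\<bar>)"
proof -
  have kc: "continuous_on UNIV k" using k(1) by (auto intro!: continuous_at_imp_continuous_on differentiable_imp_continuous_within)
  have gs: "csupp g" using g(2) by (auto simp: csupp_def)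
  have gI: "integrable lborel g" by (rule integrable_csupp[OF g(1) gs])
  let ?D = "real CARD('n) * A * r * (norm x / 2) powr (- m)"
  have "conv k g x = (LBINT y. k (x - y) * g y) - k x * (LBINT y. g y)" using g(3) by (simp add: conv_def)
  also have "\<dots> = (LBINT y. (k (x - y) - k x) * g y)"
    using conv_integrable[OF kc g(1) gs, of x] gI by (simp add: left_diff_distrib)
  also have "\<bar>\<dots>\<bar> \<le> (LBINT y. \<bar>(k (x - y) - k x) * g y\<bar>)" by (rule integral_abs_bound)
  also have "\<dots> \<le> (LBINT y. ?D * \<bar>g y\<bar>)"
  proof (rule integral_mono)
    show "integrable lborel (\<lambda>y. \<bar>(k (x - y) - k x) * g y\<bar>)"
      using conv_integrable[OF kc g(1) gs, of x] gI by (intro integrable_abs) (simp add: left_diff_distrib)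
    show "integrable lborel (\<lambda>y. ?D * \<bar>g y\<bar>)" using gI by (intro integrable_mult_right integrable_abs)
    fix y
    show "\<bar>(k (x - y) - k x) * g y\<bar> \<le> ?D * \<bar>g y\<bar>"
    proof (cases "norm y > r")
      case True then show ?thesis using g(2) by simp
    next
      case False
      have "\<bar>k (x - y) - k x\<bar> \<le> real CARD('n) * (A * (norm x / 2) powr (- m)) * norm y"
      proof (rule mean_value_partial[OF k(1)])
        fix t i assume t: "0 \<le> t" "t \<le> (1::real)"
        have "norm (t *\<^sub>R y) \<le> 1 * norm y" unfolding norm_scaleR using t by (intro mult_right_mono) auto
        moreover have "norm x \<le> norm (x - t *\<^sub>R y) + norm (t *\<^sub>R y)" by (metis diff_add_cancel norm_triangle_ineq)
        ultimately have z: "norm x / 2 \<le> norm (x - t *\<^sub>R y)" using False x by linarith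
        then have "x - t *\<^sub>R y \<noteq> 0" using x r by auto
        then have "\<bar>partial i k (x - t *\<^sub>R y)\<bar> \<le> A * norm (x - t *\<^sub>R y) powr (- m)" by (rule k(2))
        also have "\<dots> \<le> A * (norm x / 2) powr (- m)"
          using z x r m A by (intro mult_left_mono powr_mono2') auto
        finally show "\<bar>partial i k (x - t *\<^sub>R y)\<bar> \<le> A * (norm x / 2) powr (- m)" .
      qed
      also have "\<dots> \<le> real CARD('n) * (A * (norm x / 2) powr (- m)) * r"
        using False A by (intro mult_left_mono) auto
      finally have "\<bar>k (x - y) - k x\<bar> \<le> ?D" by (simp add: mult_ac)
      then show ?thesis unfolding abs_mult by (rule mult_right_mono) simp
    qed
  qed
  also have "\<dots> = ?D * (LBINT y. \<bar>g y\<bar>)" by simp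
  finally show ?thesis .
qed

section \<open>The regularised Newtonian field\<close>

text \<open>The field newton e is, up to a constant, a smooth regularisation of the gradient of the
  Newtonian potential; its divergence newton_div e is an approximate identity as e tends to 0.\<close>

definition regsq :: "real \<Rightarrow> real^'n::finite \<Rightarrow> real" where
  "regsq e x = (norm x)\<^sup>2 + e\<^sup>2"

definition newton :: "real \<Rightarrow> 'n \<Rightarrow> real^'n::finite \<Rightarrow> real" where
  "newton e j x = x $ j * regsq e x powr (- real CARD('n) / 2)"

definition newton_grad :: "real \<Rightarrow> 'n \<Rightarrow> 'n \<Rightarrow> real^'n::finite \<Rightarrow> real" where
  "newton_grad e i j x = (if i = j then 1 else 0) * regsq e x powr (- real CARD('n) / 2)
     - real CARD('n) * (x $ i * x $ j * regsq e x powr (- real CARD('n) / 2 - 1))"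

definition newton_div :: "real \<Rightarrow> real^'n::finite \<Rightarrow> real" where
  "newton_div e x = real CARD('n) * e\<^sup>2 * regsq e x powr (- real CARD('n) / 2 - 1)"

context
  fixes e :: real
  assumes e: "e > 0"
begin

lemma regsq_pos: "regsq e x > 0"
  using e by (simp add: regsq_def add_nonneg_pos)

lemma
  fixes x :: "real^'n::finite"
  shows C1_regsq_powr: "C1 (\<lambda>x::real^'n. regsq e x powr b)"
    and partial_regsq_powr: "partial i (\<lambda>x. regsq e x powr b) x = 2 * b * x $ i * regsq e x powr (b - 1)"
proof -
  have C: "C1 (regsq e :: real^'n \<Rightarrow> real)" and p: "partial i (regsq e) x = 2 * x $ i" for i and x :: "real^'n"
    using C1_add[OF C1_norm_sq C1_const, of "e\<^sup>2"] partial_add[OF C1_norm_sq C1_const, of i "e\<^sup>2" x]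
    unfolding regsq_def[abs_def] by (auto simp: partial_norm_sq)
  have D: "((\<lambda>z. z powr b) has_real_derivative (\<lambda>z. b * z powr (b - 1)) (regsq e x)) (at (regsq e x))" for x :: "real^'n"
    using regsq_pos[of x] by (auto intro!: derivative_eq_intros)
  have c: "continuous_on (range (regsq e :: real^'n \<Rightarrow> real)) (\<lambda>z. b * z powr (b - 1))"
    by (intro continuous_intros) (metis imageE regsq_pos less_irrefl)
  show "C1 (\<lambda>x::real^'n. regsq e x powr b)"
     "partial i (\<lambda>x. regsq e x powr b) x = 2 * b * x $ i * regsq e x powr (b - 1)"
    using C1_compose[OF C D c] partial_compose[OF C D c, of i x] by (auto simp: p)
qed

lemma
  fixes x :: "real^'n::finite"
  shows C1_newton: "C1 (newton e j :: real^'n \<Rightarrow> real)"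
    and partial_newton: "partial i (newton e j) x = newton_grad e i j x"
proof -
  show "C1 (newton e j :: real^'n \<Rightarrow> real)"
    unfolding newton_def[abs_def] by (intro C1_mult C1_comp C1_regsq_powr)
  show "partial i (newton e j) x = newton_grad e i j x"
    unfolding newton_def[abs_def] newton_grad_def
    unfolding partial_mult[OF C1_comp C1_regsq_powr] partial_comp partial_regsq_powr by simp
qed

lemma newton_grad_sym: "newton_grad e i j x = newton_grad e j i x"
  by (auto simp: newton_grad_def mult_ac)

text \<open>Over the common power of \<open>regsq\<close> the trace is \<open>d\<close> times
  \<open>regsq e x\<close> minus \<open>d\<close> times the squared norm, and only \<open>d\<close>
  times \<open>e\<^sup>2\<close> is left: away from the origin the unregularised field is divergence
  free.\<close>

lemma newton_div_eq: "newton_div e x = (\<Sum>i\<in>UNIV. newton_grad e i i x)" for x :: "real^'n::finite"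
proof -
  let ?d = "real CARD('n)"
  have p: "regsq e x powr (- ?d / 2) = regsq e x * regsq e x powr (- ?d / 2 - 1)"
    using powr_mult_base[of "regsq e x" "- ?d / 2 - 1"] regsq_pos[of x] by simp
  have "(\<Sum>i\<in>UNIV. newton_grad e i i x) = ?d * regsq e x powr (- ?d / 2)
       - ?d * ((\<Sum>i\<in>UNIV. x $ i * x $ i) * regsq e x powr (- ?d / 2 - 1))"
    by (simp add: newton_grad_def sum_subtractf sum_distrib_left sum_distrib_right)
  also have "(\<Sum>i\<in>UNIV. x $ i * x $ i) = (norm x)\<^sup>2"
    by (simp add: power2_norm_eq_inner inner_vec_def)
  finally show ?thesis unfolding p newton_div_def by (simp add: regsq_def algebra_simps)
qed

lemma comp_le_regsq: "\<bar>x $ i\<bar> \<le> regsq e x powr (1/2)" for x :: "real^'n::finite"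
proof -
  have "(norm x)\<^sup>2 \<le> regsq e x" by (simp add: regsq_def)
  then have "norm x \<le> sqrt (regsq e x)" by (rule real_le_rsqrt)
  then show ?thesis using component_le_norm_cart[of x i] regsq_pos[of x] by (simp add: powr_half_sqrt)
qed

text \<open>Two uses: the power of \<open>e\<close> gives the bounds, finite for each
  \<open>e\<close>, that make the convolutions differentiable; the power of the norm gives decay
  that is uniform in \<open>e\<close>.\<close>

lemma regsq_powr_le:
  assumes "m \<ge> 0"
  shows "regsq e x powr (- m / 2) \<le> e powr (- m)" and "x \<noteq> 0 \<Longrightarrow> regsq e x powr (- m / 2) \<le> norm x powr (- m)"
proof -
  have sq: "(t\<^sup>2) powr (- m / 2) = t powr (- m)" if "t > 0" for t :: real
  proof -
    have "t\<^sup>2 = t powr 2" using that by simp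
    then show ?thesis by (simp only: powr_powr) simp
  qed
  have "regsq e x powr (- m / 2) \<le> (e\<^sup>2) powr (- m / 2)"
    using assms e by (intro powr_mono2') (auto simp: regsq_def)
  then show "regsq e x powr (- m / 2) \<le> e powr (- m)" using sq[OF e] by simp
  assume x: "x \<noteq> 0"
  then have "regsq e x powr (- m / 2) \<le> ((norm x)\<^sup>2) powr (- m / 2)"
    using assms by (intro powr_mono2') (auto simp: regsq_def)
  then show "regsq e x powr (- m / 2) \<le> norm x powr (- m)" using sq[of "norm x"] x by simp
qed

lemma newton_bound: "\<bar>newton e j x\<bar> \<le> regsq e x powr (- (real CARD('n) - 1) / 2)" for x :: "real^'n::finite"
proof -
  have "\<bar>newton e j x\<bar> \<le> regsq e x powr (1/2) * regsq e x powr (- real CARD('n) / 2)"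
    unfolding newton_def abs_mult by (intro mult_mono comp_le_regsq) auto
  then show ?thesis by (simp add: powr_add[symmetric] diff_divide_distrib add_ac)
qed

lemma newton_grad_bound: "\<bar>newton_grad e i j x\<bar> \<le> (1 + real CARD('n)) * regsq e x powr (- real CARD('n) / 2)" for x :: "real^'n::finite"
proof -
  let ?d = "real CARD('n)"
  have "\<bar>newton_grad e i j x\<bar> \<le> \<bar>(if i = j then 1 else 0) * regsq e x powr (- ?d / 2)\<bar>
      + \<bar>?d * (x $ i * x $ j * regsq e x powr (- ?d / 2 - 1))\<bar>"
    unfolding newton_grad_def by (rule abs_triangle_ineq4)
  also have "\<dots> \<le> regsq e x powr (- ?d / 2) + ?d * (regsq e x powr (1/2) * regsq e x powr (1/2) * regsq e x powr (- ?d / 2 - 1))"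
    unfolding abs_mult by (intro add_mono mult_mono comp_le_regsq) auto
  also have "regsq e x powr (1/2) * regsq e x powr (1/2) * regsq e x powr (- ?d / 2 - 1) = regsq e x powr (- ?d / 2)"
    unfolding powr_add[symmetric] by (rule arg_cong[where f = "(powr) (regsq e x)"]) simp
  also have "regsq e x powr (- ?d / 2) + ?d * \<dots> = (1 + ?d) * regsq e x powr (- ?d / 2)"
    by (simp add: algebra_simps)
  finally show ?thesis .
qed

text \<open>The constant collects three terms linear in the components, each with coefficient
  \<open>d\<close>, and one cubic term with coefficient \<open>d\<^sup>2 + 2 * d\<close>. Counting
  half a power of \<open>regsq\<close> for every component, all four have the same order.\<close>

lemma
  fixes x :: "real^'n::finite"
  shows C1_newton_grad: "C1 (newton_grad e i j :: real^'n \<Rightarrow> real)"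
    and newton_grad2_bound: "\<bar>partial l (newton_grad e i j) x\<bar>
       \<le> (5 * real CARD('n) + (real CARD('n))\<^sup>2) * regsq e x powr (- (real CARD('n) + 1) / 2)"
proof -
  let ?d = "real CARD('n)"
  let ?a = "- real CARD('n) / 2"
  note C = C1_comp C1_regsq_powr
  show "C1 (newton_grad e i j :: real^'n \<Rightarrow> real)"
    unfolding newton_grad_def[abs_def] by (intro C1_diff C1_cmult C1_mult C)
  have p: "partial l (newton_grad e i j) x = (if i = j then 1 else 0) * (2 * ?a * x $ l * regsq e x powr (?a - 1))
     - ?d * ((((if l = i then 1 else 0) * x $ j + x $ i * (if l = j then 1 else 0)) * regsq e x powr (?a - 1))
          + x $ i * x $ j * (2 * (?a - 1) * x $ l * regsq e x powr (?a - 1 - 1)))"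
    unfolding newton_grad_def[abs_def]
    unfolding partial_diff[OF C1_cmult[OF C1_regsq_powr] C1_cmult[OF C1_mult[OF C1_mult[OF C1_comp C1_comp] C1_regsq_powr]]]
      partial_cmult[OF C1_regsq_powr] partial_cmult[OF C1_mult[OF C1_mult[OF C1_comp C1_comp] C1_regsq_powr]]
      partial_mult[OF C1_mult[OF C1_comp C1_comp] C1_regsq_powr] partial_mult[OF C1_comp C1_comp]
      partial_comp partial_regsq_powr ..
  let ?h = "regsq e x powr (1/2)"
  let ?q = "regsq e x powr (?a - 1/2)"
  have h: "\<bar>x $ k\<bar> \<le> ?h" for k by (rule comp_le_regsq)
  have e1: "?h * regsq e x powr (?a - 1) = ?q"
    unfolding powr_add[symmetric] by (rule arg_cong[where f = "(powr) (regsq e x)"]) simp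
  have "?h * ?h * ?h * regsq e x powr (?a - 1 - 1) = regsq e x powr (1/2 + 1/2 + 1/2 + (?a - 1 - 1))"
    unfolding powr_add by simp
  also have "1/2 + 1/2 + 1/2 + (?a - 1 - 1) = ?a - 1/2" by simp
  finally have e2: "?h * ?h * ?h * regsq e x powr (?a - 1 - 1) = ?q" .
  have X1: "\<bar>x $ k * regsq e x powr (?a - 1)\<bar> \<le> ?q" for k
    unfolding abs_mult e1[symmetric] by (intro mult_mono h) auto
  have X2: "\<bar>x $ i * x $ j * x $ l * regsq e x powr (?a - 1 - 1)\<bar> \<le> ?q"
    unfolding abs_mult e2[symmetric] by (intro mult_mono h) auto
  have d: "?d \<ge> 0" by simp
  have q: "?q \<ge> 0" by simp
  let ?I = "\<lambda>b. if b then 1 else (0::real)"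
  have eq: "partial l (newton_grad e i j) x = - (?I (i = j) * ?d * (x $ l * regsq e x powr (?a - 1)))
      - ?d * ?I (l = i) * (x $ j * regsq e x powr (?a - 1)) - ?d * ?I (l = j) * (x $ i * regsq e x powr (?a - 1))
      + (?d\<^sup>2 + 2 * ?d) * (x $ i * x $ j * x $ l * regsq e x powr (?a - 1 - 1))"
    unfolding p by (simp add: algebra_simps power2_eq_square)
  have T: "\<bar>c * ?I b * t\<bar> \<le> c * ?q" "\<bar>?I b * c * t\<bar> \<le> c * ?q" if "\<bar>t\<bar> \<le> ?q" "c \<ge> 0" for c t b
    using that q by (auto simp: abs_mult intro!: mult_left_mono)
  have "\<bar>(?d\<^sup>2 + 2 * ?d) * (x $ i * x $ j * x $ l * regsq e x powr (?a - 1 - 1))\<bar> \<le> (?d\<^sup>2 + 2 * ?d) * ?q"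
    unfolding abs_mult[of "?d\<^sup>2 + 2 * ?d"] using X2 by (intro mult_mono) auto
  then have "\<bar>partial l (newton_grad e i j) x\<bar> \<le> ?d * ?q + ?d * ?q + ?d * ?q + (?d\<^sup>2 + 2 * ?d) * ?q"
    using T(2)[OF X1[of l] d, of "i = j"] T(1)[OF X1[of j] d, of "l = i"] T(1)[OF X1[of i] d, of "l = j"]
    unfolding eq by linarith
  also have "\<dots> = (5 * ?d + ?d\<^sup>2) * ?q" by (simp add: algebra_simps)
  also have "?q = regsq e x powr (- (?d + 1) / 2)" by (simp add: diff_divide_distrib add_divide_distrib)
  finally show "\<bar>partial l (newton_grad e i j) x\<bar> \<le> (5 * ?d + ?d\<^sup>2) * regsq e x powr (- (?d + 1) / 2)" .
qed

lemma regsq_powr_differentiable: "(\<lambda>x. regsq e x powr b) differentiable (at x)" for x :: "real^'n::finite"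
proof -
  have "((\<lambda>x::real^'n. (x \<bullet> x + e\<^sup>2) powr b) has_derivative
     (\<lambda>h. (x \<bullet> x + e\<^sup>2) powr b * (0 * ln (x \<bullet> x + e\<^sup>2) + (h \<bullet> x + x \<bullet> h) * b / (x \<bullet> x + e\<^sup>2)))) (at x)"
    by (rule derivative_eq_intros | use e in \<open>simp add: add_nonneg_pos inner_commute\<close>)+
  then show ?thesis unfolding regsq_def power2_norm_eq_inner by (rule differentiableI)
qed

lemma comp_differentiable: "(\<lambda>x. x $ j) differentiable (at x)" for x :: "real^'n::finite"
  by (rule bounded_linear_imp_differentiable) (rule bounded_linear_vec_nth)

lemma newton_differentiable: "newton e j differentiable (at x)"
  and newton_grad_differentiable: "newton_grad e i j differentiable (at x)" for x :: "real^'n::finite"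
  unfolding newton_def[abs_def] newton_grad_def[abs_def]
  by (intro differentiable_mult differentiable_diff differentiable_const comp_differentiable regsq_powr_differentiable)+

lemma newton_div_continuous: "continuous_on A (newton_div e :: real^'n::finite \<Rightarrow> real)"
  unfolding newton_div_def[abs_def] by (intro continuous_intros C1_continuous[OF C1_regsq_powr])

lemma newton_div_nonneg: "newton_div e x \<ge> 0"
  by (simp add: newton_div_def)

text \<open>Self-similarity: the kernels are mass-preserving dilates of \<open>newton_div 1\<close>.
  Hence one integrability proof and one mass serve every \<open>e\<close>.\<close>

lemma newton_div_scale: "e ^ CARD('n) * newton_div e (e *\<^sub>R u) = newton_div 1 u" for u :: "real^'n::finite"
proof -
  let ?d = "real CARD('n)"
  have "regsq e (e *\<^sub>R u) = e\<^sup>2 * regsq 1 u" by (simp add: regsq_def power_mult_distrib algebra_simps)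
  moreover have "regsq 1 u > 0" by (simp add: regsq_def add_nonneg_pos)
  ultimately have "regsq e (e *\<^sub>R u) powr (- ?d / 2 - 1) = (e\<^sup>2) powr (- ?d / 2 - 1) * regsq 1 u powr (- ?d / 2 - 1)"
    by (simp add: powr_mult)
  also have "(e\<^sup>2) powr (- ?d / 2 - 1) = e powr (- ?d - 2)"
  proof -
    have "e\<^sup>2 = e powr 2" using e by simp
    then show ?thesis by (simp only: powr_powr) (simp add: algebra_simps)
  qed
  finally have "e ^ CARD('n) * newton_div e (e *\<^sub>R u) = (e powr ?d * e powr 2 * e powr (- ?d - 2)) * newton_div 1 u"
    using e by (simp add: newton_div_def powr_realpow)
  also have "e powr ?d * e powr 2 * e powr (- ?d - 2) = 1" unfolding powr_add[symmetric] using e by simp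
  finally show ?thesis by simp
qed

end

text \<open>By the divergence theorem this is the flux of the field through large spheres, that is,
  the area of the unit sphere. The argument uses its independence of \<open>e\<close> and its
  positivity, by which the pressure estimate is divided.\<close>

definition newton_mass :: "'n::finite itself \<Rightarrow> real" where
  "newton_mass _ = (LBINT x. newton_div 1 (x :: real^'n))"

lemma newton_div_1_integrable: "integrable lborel (newton_div 1 :: real^'n::finite \<Rightarrow> real)"
proof -
  let ?d = "real CARD('n)"
  obtain C where I: "integrable lborel (\<lambda>x::real^'n. indicator {x. 1 \<le> norm x} x * norm x powr (- (?d + 2)))"
    using radial_tail[of 2, where 'n = 'n] by (metis zero_less_numeral zero_less_one)
  have J: "integrable lborel (\<lambda>x::real^'n. indicator (cball 0 1) x *\<^sub>R (1::real))"
    by (intro borel_integrable_compact) auto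
  have [measurable]: "(newton_div 1 :: real^'n \<Rightarrow> real) \<in> borel_measurable borel"
    by (intro borel_measurable_continuous_onI newton_div_continuous) simp
  show ?thesis
  proof (rule Bochner_Integration.integrable_bound)
    show "integrable lborel (\<lambda>x::real^'n. ?d * (indicator (cball 0 1) x *\<^sub>R 1) + ?d * (indicator {x. 1 \<le> norm x} x * norm x powr (- (?d + 2))))"
      using I J by auto
    show "AE x::real^'n in lborel. norm (newton_div 1 x) \<le> norm (?d * (indicator (cball 0 1) x *\<^sub>R 1) + ?d * (indicator {x. 1 \<le> norm x} x * norm x powr (- (?d + 2))))"
    proof (intro AE_I2)
      fix x :: "real^'n"
      have h: "- ?d / 2 - 1 = - (?d + 2) / 2" by (simp add: add_divide_distrib)
      note r = regsq_powr_le[of 1 "?d + 2" x]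
      have "norm (newton_div 1 x) = ?d * regsq 1 x powr (- (?d + 2) / 2)" unfolding newton_div_def h by simp
      also have "\<dots> \<le> ?d * (indicator (cball 0 1) x *\<^sub>R 1) + ?d * (indicator {x. 1 \<le> norm x} x * norm x powr (- (?d + 2)))"
      proof (cases "norm x \<le> 1")
        case True
        have "?d * regsq 1 x powr (- (?d + 2) / 2) \<le> ?d * 1" using r(1) by (intro mult_left_mono) auto
        moreover have "0 \<le> ?d * (indicator {x. 1 \<le> norm x} x * norm x powr (- (?d + 2)))" by simp
        moreover have "?d * (indicator (cball 0 1) x *\<^sub>R 1) = ?d" using True by simp
        ultimately show ?thesis by linarith
      next
        case False
        then have "x \<noteq> 0" by auto
        then have "?d * regsq 1 x powr (- (?d + 2) / 2) \<le> ?d * norm x powr (- (?d + 2))"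
          using r(2) by (intro mult_left_mono) auto
        then show ?thesis using False by simp
      qed
      finally show "norm (newton_div 1 x) \<le> norm (?d * (indicator (cball 0 1) x *\<^sub>R 1) + ?d * (indicator {x. 1 \<le> norm x} x * norm x powr (- (?d + 2))))"
        by (rule order_trans) simp
    qed
  qed measurable
qed

lemma newton_mass_pos: "newton_mass TYPE('n::finite) > 0"
proof -
  let ?d = "real CARD('n)"
  let ?c = "?d * 2 powr (- ?d / 2 - 1)"
  have J: "integrable lborel (\<lambda>x::real^'n. ?c * indicator (cball 0 1) x)"
    using borel_integrable_compact[of "cball (0::real^'n) 1" "\<lambda>_. 1::real"] by auto
  have "(LBINT x. ?c * indicator (cball (0::real^'n) 1) x) \<le> newton_mass TYPE('n)"
    unfolding newton_mass_def
  proof (rule integral_mono[OF J newton_div_1_integrable])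
    fix x :: "real^'n"
    show "?c * indicator (cball 0 1) x \<le> newton_div 1 x"
    proof (cases "norm x \<le> 1")
      case True
      then have "regsq 1 x \<le> 2" by (simp add: regsq_def power_le_one)
      then have "2 powr (- ?d / 2 - 1) \<le> regsq 1 x powr (- ?d / 2 - 1)"
        by (intro powr_mono2') (auto simp: regsq_def add_nonneg_pos)
      then have "?c \<le> newton_div 1 x" unfolding newton_div_def by (simp add: mult_left_mono)
      then show ?thesis using True by simp
    qed (simp add: newton_div_def)
  qed
  moreover have "measure lborel (cball (0::real^'n) 1) > 0"
    using content_cball_pos[of 1 "0::real^'n"] by simp
  then have "(LBINT x. ?c * indicator (cball (0::real^'n) 1) x) > 0"
    by (simp)
  ultimately show ?thesis by linarith
qed

lemma
  assumes e: "e > 0"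
  shows newton_div_integrable: "integrable lborel (newton_div e :: real^'n::finite \<Rightarrow> real)"
    and integral_newton_div: "(LBINT x. newton_div e (x :: real^'n)) = newton_mass TYPE('n)"
proof -
  have [measurable]: "(newton_div e :: real^'n \<Rightarrow> real) \<in> borel_measurable borel"
    by (intro borel_measurable_continuous_onI newton_div_continuous e)
  have s: "newton_div e x = newton_div 1 ((1/e) *\<^sub>R x) / e ^ CARD('n)" for x :: "real^'n"
    using newton_div_scale[OF e, of "(1/e) *\<^sub>R x"] e by (simp add: field_simps)
  have "integrable lborel (\<lambda>x::real^'n. newton_div 1 (0 + (1/e) *\<^sub>R x) / e ^ CARD('n))"
    using e by (intro integrable_divide integrable_lborel_affine newton_div_1_integrable) auto
  then show "integrable lborel (newton_div e :: real^'n \<Rightarrow> real)" unfolding s[abs_def] by simp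
  have "(LBINT x. newton_div e (x :: real^'n)) = e ^ CARD('n) * (LBINT x. newton_div e (e *\<^sub>R x :: real^'n))"
    using lborel_integral_affine[of "newton_div e :: real^'n \<Rightarrow> real" e 0] e by simp
  also have "\<dots> = (LBINT x. e ^ CARD('n) * newton_div e (e *\<^sub>R x :: real^'n))" by simp
  also have "\<dots> = newton_mass TYPE('n)"
    unfolding newton_div_scale[OF e] newton_mass_def ..
  finally show "(LBINT x. newton_div e (x :: real^'n)) = newton_mass TYPE('n)" .
qed

text \<open>The convolution is moved from \<open>g\<close> to the continuous \<open>P\<close>, so
  the averages of \<open>P\<close> at scale \<open>X n\<close> converge at every point. They are
  bounded by the mass times \<open>B\<close>, and the compactly supported \<open>g\<close> supplies
  the majorant.\<close>

lemma newton_div_approx_identity: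
  fixes P g :: "real^'n::finite \<Rightarrow> real"
  assumes P: "continuous_on UNIV P" "\<And>x. \<bar>P x\<bar> \<le> B" and g: "continuous_on UNIV g" "csupp g"
    and X: "\<And>n. X n > 0" "X \<longlonglongrightarrow> 0"
  shows "(\<lambda>n. LBINT x. P x * conv (newton_div (X n)) g x) \<longlonglongrightarrow> newton_mass TYPE('n) * (LBINT y. g y * P y)"
proof -
  let ?\<omega> = "newton_mass TYPE('n)"
  have [measurable]: "P \<in> borel_measurable borel" "g \<in> borel_measurable borel"
     "(newton_div 1 :: real^'n \<Rightarrow> real) \<in> borel_measurable borel"
    using P g by (auto intro!: borel_measurable_continuous_onI newton_div_continuous)
  have nd[measurable]: "(newton_div (X n) :: real^'n \<Rightarrow> real) \<in> borel_measurable borel" for n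
    using X by (auto intro!: borel_measurable_continuous_onI newton_div_continuous)
  note kc = newton_div_continuous[OF X(1)] and kI = newton_div_integrable[OF X(1)]
  define h where "h n y = (LBINT x. newton_div (X n) (x - y) * P x)" for n y
  have B: "B \<ge> 0" using P(2)[of 0] by linarith
  \<comment> \<open>The substitution \<open>x = y + X n *\<^sub>R u\<close> moves all dependence on
    \<open>X n\<close> into the argument of \<open>P\<close>.\<close>
  have hu: "h n y = (LBINT u. newton_div 1 u * P (y + X n *\<^sub>R u))" for n y
  proof -
    have "h n y = (X n) ^ CARD('n) * (LBINT u. newton_div (X n) (X n *\<^sub>R u) * P (y + X n *\<^sub>R u))"
      unfolding h_def using X(1)[of n]
      by (subst lborel_integral_affine[where c = "X n" and a = y]) auto
    also have "\<dots> = (LBINT u. (X n) ^ CARD('n) * newton_div (X n) (X n *\<^sub>R u) * P (y + X n *\<^sub>R u))"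
      by (simp add: mult.assoc)
    finally show ?thesis unfolding newton_div_scale[OF X(1)] .
  qed
  have b: "\<bar>newton_div 1 u * P (y + X n *\<^sub>R u)\<bar> \<le> newton_div 1 u * B" for u y :: "real^'n" and n
    unfolding abs_mult using P(2) newton_div_nonneg[of 1 u] by (intro mult_mono) auto
  have hb: "\<bar>h n y\<bar> \<le> ?\<omega> * B" for n y
  proof -
    have "\<bar>h n y\<bar> \<le> (LBINT u. \<bar>newton_div 1 u * P (y + X n *\<^sub>R u)\<bar>)"
      unfolding hu by (rule integral_abs_bound)
    also have "\<dots> \<le> (LBINT u. newton_div 1 (u :: real^'n) * B)"
    proof (rule integral_mono)
      show i: "integrable lborel (\<lambda>u. newton_div 1 (u :: real^'n) * B)"
        by (intro integrable_mult_left newton_div_1_integrable)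
      show "\<bar>newton_div 1 u * P (y + X n *\<^sub>R u)\<bar> \<le> newton_div 1 u * B" for u :: "real^'n"
        by (rule b)
      have "integrable lborel (\<lambda>u. newton_div 1 u * P (y + X n *\<^sub>R u))"
        by (rule Bochner_Integration.integrable_bound[OF i]) (simp, unfold real_norm_def, intro AE_I2 order_trans[OF b abs_ge_self])
      then show "integrable lborel (\<lambda>u. \<bar>newton_div 1 u * P (y + X n *\<^sub>R u)\<bar>)" by (rule integrable_abs)
    qed
    also have "\<dots> = ?\<omega> * B" by (simp add: newton_mass_def)
    finally show ?thesis .
  qed
  have hl: "(\<lambda>n. h n y) \<longlonglongrightarrow> ?\<omega> * P y" for y
  proof -
    have "(\<lambda>n. LBINT u. newton_div 1 u * P (y + X n *\<^sub>R u)) \<longlonglongrightarrow> (LBINT u. newton_div 1 (u :: real^'n) * P y)"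
    proof (rule integral_dominated_convergence[where w = "\<lambda>u. newton_div 1 u * B"])
      show "integrable lborel (\<lambda>u. newton_div 1 (u :: real^'n) * B)"
        by (intro integrable_mult_left newton_div_1_integrable)
      show "AE u::real^'n in lborel. norm (newton_div 1 u * P (y + X n *\<^sub>R u)) \<le> newton_div 1 u * B" for n
        unfolding real_norm_def by (intro AE_I2 b)
      show "AE u in lborel. (\<lambda>n. newton_div 1 u * P (y + X n *\<^sub>R u)) \<longlonglongrightarrow> newton_div 1 u * P y"
      proof (intro AE_I2 tendsto_mult tendsto_const)
        fix u
        have "isCont P y" using P(1) by (simp add: continuous_on_eq_continuous_at)
        moreover have "(\<lambda>n. y + X n *\<^sub>R u) \<longlonglongrightarrow> y + 0 *\<^sub>R u" by (intro tendsto_intros X)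
        ultimately show "(\<lambda>n. P (y + X n *\<^sub>R u)) \<longlonglongrightarrow> P y"
          by (intro isCont_tendsto_compose[of _ P]) auto
      qed
    qed auto
    then show ?thesis by (simp add: hu newton_mass_def)
  qed
  have "(\<lambda>n. LBINT y. g y * h n y) \<longlonglongrightarrow> (LBINT y. g y * (?\<omega> * P y))"
  proof (rule integral_dominated_convergence[where w = "\<lambda>y. \<bar>g y\<bar> * (?\<omega> * B)"])
    show "integrable lborel (\<lambda>y. \<bar>g y\<bar> * (?\<omega> * B))"
      by (intro integrable_mult_left integrable_abs integrable_csupp g)
    show "AE y in lborel. (\<lambda>n. g y * h n y) \<longlonglongrightarrow> g y * (?\<omega> * P y)"
      by (intro AE_I2 tendsto_intros hl)
    show "AE y in lborel. norm (g y * h n y) \<le> \<bar>g y\<bar> * (?\<omega> * B)" for n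
      unfolding real_norm_def abs_mult by (intro AE_I2 mult_left_mono hb) auto
    have [measurable]: "h n \<in> borel_measurable borel" for n
      unfolding h_def by (rule conv_swap_measurable[OF kc kI P g])
    show "(\<lambda>y. g y * h n y) \<in> borel_measurable lborel" for n by measurable
  qed auto
  moreover have "(LBINT y. g y * h n y) = (LBINT x. P x * conv (newton_div (X n)) g x)" for n
    unfolding h_def by (rule conv_swap[OF kc kI P g, symmetric])
  moreover have "(LBINT y. g y * (?\<omega> * P y)) = ?\<omega> * (LBINT y. g y * P y)"
    by (simp add: mult.left_commute)
  ultimately show ?thesis by simp
qed

section \<open>Boundary terms on annuli and the limit of the null form\<close>

lemma compact_annulus: "compact (annulus R :: (real^'n::finite) set)"
proof -
  have "annulus R = cball 0 (2 * R) - ball (0 :: real^'n) R" by (auto simp: annulus_def)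
  then show ?thesis by (simp add: compact_diff)
qed

lemma annulus_borel [measurable]: "annulus R \<in> sets borel"
  using compact_annulus by (rule borel_compact)

lemma integrable_annulus:
  fixes f :: "real^'n::finite \<Rightarrow> real"
  shows "continuous_on UNIV f \<Longrightarrow> integrable lborel (\<lambda>x. indicator (annulus R) x * f x)"
  using borel_integrable_compact[OF compact_annulus, where f = f] by (simp add: continuous_on_subset)

lemma integrable_cball:
  fixes f :: "real^'n::finite \<Rightarrow> real"
  shows "continuous_on UNIV f \<Longrightarrow> integrable lborel (\<lambda>x. indicator (cball 0 R) x * f x)"
  using borel_integrable_compact[OF compact_cball, where f = f] by (simp add: continuous_on_subset)

lemma integral_indicator_cball:
  assumes "R \<ge> 0"
  shows "(LBINT x. indicator (cball (0::real^'n::finite) R) x) = unit_ball_vol (real CARD('n)) * R ^ CARD('n)"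
  using assms by (simp add: content_cball)

lemma integral_annulus_le:
  fixes f :: "real^'n::finite \<Rightarrow> real"
  assumes f: "continuous_on UNIV f" and R: "R > 0" and M: "M \<ge> 0" "\<And>x. x \<in> annulus R \<Longrightarrow> f x \<le> M"
  shows "(LBINT x. indicator (annulus R) x * f x) \<le> M * (unit_ball_vol (real CARD('n)) * (2 * R) ^ CARD('n))"
proof -
  have "(LBINT x. indicator (annulus R) x * f x) \<le> (LBINT x. indicator (cball (0::real^'n) (2 * R)) x * M)"
    using M by (intro integral_mono integrable_annulus integrable_cball f) (auto simp: indicator_def annulus_def)
  also have "\<dots> = M * (unit_ball_vol (real CARD('n)) * (2 * R) ^ CARD('n))"
    using R integral_indicator_cball[of "2 * R", where 'n = 'n] by simp
  finally show ?thesis .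
qed

lemma integral_partial_cutoff_le:
  fixes f :: "real^'n::finite \<Rightarrow> real"
  assumes f: "continuous_on UNIV f" and R: "R > 0"
  shows "\<bar>LBINT x. f x * partial i (cutoff R) x\<bar> \<le> 6 / R * (LBINT x. indicator (annulus R) x * \<bar>f x\<bar>)"
proof -
  have I: "integrable lborel (\<lambda>x. f x * partial i (cutoff R) x)"
    by (intro integrable_csupp_mult f C1_partial_continuous C1_cutoff csupp_partial csupp_cutoff R)
  have "\<bar>LBINT x. f x * partial i (cutoff R) x\<bar> \<le> (LBINT x. \<bar>f x * partial i (cutoff R) x\<bar>)"
    by (rule integral_abs_bound)
  also have "\<dots> \<le> (LBINT x. 6 / R * (indicator (annulus R) x * \<bar>f x\<bar>))"
  proof (intro integral_mono integrable_abs I integrable_mult_right integrable_annulus continuous_intros f)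
    show "\<bar>f x * partial i (cutoff R) x\<bar> \<le> 6 / R * (indicator (annulus R) x * \<bar>f x\<bar>)" for x
      using mult_left_mono[OF partial_cutoff[OF R, of i x], of "\<bar>f x\<bar>"] by (simp add: abs_mult mult_ac)
  qed
  finally show ?thesis by simp
qed

text \<open>Summing null forms over \<open>i\<close> and \<open>j\<close> shows that the squared
  divergence and the trace of the squared gradient agree up to boundary terms, which
  \<open>err\<close> sends to 0. It serves the test field, where symmetry makes the trace the
  squared gradient, and the velocity, where the trace is only bounded by it.\<close>

lemma null_form_limit:
  fixes u :: "'n::finite \<Rightarrow> real^'n \<Rightarrow> real"
  assumes C: "\<And>i. C1 (u i)" "\<And>i j. C1 (partial i (u j))"
    and err: "\<And>i j k. (\<lambda>n. 1 / real (Suc n) * (LBINT x. indicator (annulus (real (Suc n))) x * \<bar>u i x * partial j (u k) x\<bar>)) \<longlonglongrightarrow> 0"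
  shows "(\<lambda>n. LBINT x. ((\<Sum>i\<in>UNIV. partial i (u i) x)\<^sup>2 - (\<Sum>i\<in>UNIV. \<Sum>j\<in>UNIV. partial i (u j) x * partial j (u i) x))
             * cutoff (real (Suc n)) x) \<longlonglongrightarrow> 0"
proof -
  define \<phi> :: "nat \<Rightarrow> real^'n \<Rightarrow> real" where "\<phi> n = cutoff (real (Suc n))" for n
  define A where "A n i j k = (LBINT x. indicator (annulus (real (Suc n))) x * \<bar>u i x * partial j (u k) x\<bar>)" for n i j k
  have \<phi>: "C1 (\<phi> n)" "csupp (\<phi> n)" for n by (auto simp: \<phi>_def C1_cutoff csupp_cutoff)
  define T where "T n i j = (LBINT x. partial i (u i) x * partial j (u j) x * \<phi> n x - partial j (u i) x * partial i (u j) x * \<phi> n x)" for n i j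
  have cont: "continuous_on UNIV (\<lambda>x. u i x * partial j (u k) x)" for i j k
    by (intro continuous_on_mult C1_continuous C)
  have T0: "(\<lambda>n. T n i j) \<longlonglongrightarrow> 0" for i j
  proof (rule Lim_null_comparison)
    have I: "integrable lborel (\<lambda>x. u i x * partial l (u j) x * partial k (\<phi> n) x)" for k l n
      by (intro integrable_csupp_mult cont C1_partial_continuous \<phi> csupp_partial)
    have "\<bar>T n i j\<bar> \<le> 6 * (1 / real (Suc n) * A n i i j) + 6 * (1 / real (Suc n) * A n i j j)" for n
    proof -
      have "T n i j = (LBINT x. u i x * partial i (u j) x * partial j (\<phi> n) x) - (LBINT x. u i x * partial j (u j) x * partial i (\<phi> n) x)"
        unfolding T_def null_form_identity[OF C(1) C(1) C(2) C(2) \<phi>] using I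
        by (simp add: Bochner_Integration.integral_diff)
      moreover have "\<bar>LBINT x. u i x * partial i (u j) x * partial j (\<phi> n) x\<bar> \<le> 6 / real (Suc n) * A n i i j"
        unfolding \<phi>_def A_def by (rule integral_partial_cutoff_le[OF cont]) simp
      moreover have "\<bar>LBINT x. u i x * partial j (u j) x * partial i (\<phi> n) x\<bar> \<le> 6 / real (Suc n) * A n i j j"
        unfolding \<phi>_def A_def by (rule integral_partial_cutoff_le[OF cont]) simp
      ultimately show ?thesis by simp
    qed
    then show "\<forall>\<^sub>F n in sequentially. norm (T n i j) \<le> 6 * (1 / real (Suc n) * A n i i j) + 6 * (1 / real (Suc n) * A n i j j)"
      by (simp add: always_eventually)
    show "(\<lambda>n. 6 * (1 / real (Suc n) * A n i i j) + 6 * (1 / real (Suc n) * A n i j j)) \<longlonglongrightarrow> 0"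
      unfolding A_def using tendsto_add[OF tendsto_mult_left[OF err, of 6] tendsto_mult_left[OF err, of 6]] by simp
  qed
  have I1: "integrable lborel (\<lambda>x. partial i (u j) x * partial k (u l) x * \<phi> n x)" for i j k l n
    by (intro integrable_csupp_mult continuous_on_mult C1_continuous C \<phi>)
  have "(LBINT x. ((\<Sum>i\<in>UNIV. partial i (u i) x)\<^sup>2 - (\<Sum>i\<in>UNIV. \<Sum>j\<in>UNIV. partial i (u j) x * partial j (u i) x)) * \<phi> n x)
    = (\<Sum>i\<in>UNIV. \<Sum>j\<in>UNIV. T n i j)" for n
  proof -
    have "((\<Sum>i\<in>UNIV. partial i (u i) x)\<^sup>2 - (\<Sum>i\<in>UNIV. \<Sum>j\<in>UNIV. partial i (u j) x * partial j (u i) x)) * \<phi> n x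
      = (\<Sum>i\<in>UNIV. \<Sum>j\<in>UNIV. partial i (u i) x * partial j (u j) x * \<phi> n x - partial j (u i) x * partial i (u j) x * \<phi> n x)" for x
      unfolding power2_eq_square sum_product
      by (simp add: sum_subtractf sum_distrib_left sum_distrib_right right_diff_distrib left_diff_distrib mult_ac)
    then show ?thesis using I1 by (simp add: T_def Bochner_Integration.integral_sum)
  qed
  moreover have "(\<lambda>n. \<Sum>i\<in>UNIV. \<Sum>j\<in>UNIV. T n i j) \<longlonglongrightarrow> (\<Sum>i\<in>(UNIV::'n set). \<Sum>j\<in>(UNIV::'n set). 0)"
    by (intro tendsto_sum T0)
  ultimately show ?thesis by (simp add: \<phi>_def)
qed

section \<open>The test field generated by a mean-zero function\<close>

locale newton_field =
  fixes e r :: real and g :: "real^'n::finite \<Rightarrow> real"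
  assumes e: "e > 0" and r: "r > 0" and g: "continuous_on UNIV g" "\<And>y. norm y > r \<Longrightarrow> g y = 0"
    and g_mean: "(LBINT y. g y) = 0"
begin

abbreviation w :: "'n \<Rightarrow> real^'n \<Rightarrow> real" where "w j \<equiv> conv (newton e j) g"

lemma csupp_g: "csupp g" using g(2) by (auto simp: csupp_def)

lemma carcard_ge_1: "real CARD('n) \<ge> 1"
  using zero_less_card_finite[where 'a='n] by linarith

lemma newton_le: "\<bar>newton e j x\<bar> \<le> e powr (- (real CARD('n) - 1))" for x :: "real^'n"
  by (rule order_trans[OF newton_bound[OF e] regsq_powr_le(1)[OF e]]) (use carcard_ge_1 in simp)

lemma newton_grad_le: "\<bar>newton_grad e i j x\<bar> \<le> (1 + real CARD('n)) * e powr (- real CARD('n))" for x :: "real^'n"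
  by (rule order_trans[OF newton_grad_bound[OF e] mult_left_mono[OF regsq_powr_le(1)[OF e]]]) simp_all

lemma newton_grad2_le: "\<bar>partial l (newton_grad e i j) x\<bar> \<le> (5 * real CARD('n) + (real CARD('n))\<^sup>2) * e powr (- (real CARD('n) + 1))" for x :: "real^'n"
proof -
  have "(5 * real CARD('n) + (real CARD('n))\<^sup>2) * regsq e x powr (- (real CARD('n) + 1) / 2)
     \<le> (5 * real CARD('n) + (real CARD('n))\<^sup>2) * e powr (- (real CARD('n) + 1))"
    by (intro mult_left_mono regsq_powr_le(1) e) auto
  with newton_grad2_bound[OF e, of l i j x] show ?thesis by linarith
qed

lemma partial_newton_fun: "partial i (newton e j :: real^'n \<Rightarrow> real) = newton_grad e i j"
  using partial_newton[OF e] by blast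

lemma C1_w: "C1 (w j)"
  and partial_w: "partial i (w j) = conv (newton_grad e i j) g"
proof -
  have *: "\<bar>partial i (newton e j) x\<bar> \<le> (1 + real CARD('n)) * e powr (- real CARD('n))" for i and x :: "real^'n"
    unfolding partial_newton_fun by (rule newton_grad_le)
  show "C1 (w j)" "partial i (w j) = conv (newton_grad e i j) g"
    using C1_conv[OF C1_newton[OF e] newton_le * g(1) csupp_g]
      partial_conv[OF C1_newton[OF e] newton_le * g(1) csupp_g] by (auto simp: partial_newton_fun)
qed

lemma C1_partial_w: "C1 (partial i (w j))"
  unfolding partial_w by (rule C1_conv[OF C1_newton_grad[OF e] newton_grad_le newton_grad2_le g(1) csupp_g])

lemma partial_w_sym: "partial i (w j) = partial j (w i)"
  unfolding partial_w conv_def newton_grad_sym[OF e, of i j] ..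

lemma div_w: "(\<Sum>i\<in>UNIV. partial i (w i) x) = conv (newton_div e) g x"
proof -
  have I: "integrable lborel (\<lambda>y. newton_grad e i i (x - y) * g y)" for i
    by (intro conv_integrable C1_continuous[OF C1_newton_grad[OF e]] g csupp_g)
  have "(\<Sum>i\<in>UNIV. partial i (w i) x) = (LBINT y. (\<Sum>i\<in>UNIV. newton_grad e i i (x - y) * g y))"
    unfolding partial_w conv_def using I by (simp add: Bochner_Integration.integral_sum)
  then show ?thesis by (simp add: conv_def newton_div_eq[OF e] sum_distrib_right)
qed

lemma w_decay: "norm x \<ge> 2 * r \<Longrightarrow>
  \<bar>w j x\<bar> \<le> real CARD('n) * (1 + real CARD('n)) * r * (norm x / 2) powr (- real CARD('n)) * (LBINT y. \<bar>g y\<bar>)"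
proof (rule conv_decay[OF newton_differentiable[OF e] _ _ _ g g_mean r])
  fix i and z :: "real^'n" assume "z \<noteq> 0"
  then have "(1 + real CARD('n)) * regsq e z powr (- real CARD('n) / 2) \<le> (1 + real CARD('n)) * norm z powr (- real CARD('n))"
    by (intro mult_left_mono regsq_powr_le(2) e) auto
  then show "\<bar>partial i (newton e j) z\<bar> \<le> (1 + real CARD('n)) * norm z powr (- real CARD('n))"
    unfolding partial_newton_fun using newton_grad_bound[OF e, of i j z] by linarith
qed auto

lemma partial_w_decay: "norm x \<ge> 2 * r \<Longrightarrow>
  \<bar>partial i (w j) x\<bar> \<le> real CARD('n) * (5 * real CARD('n) + (real CARD('n))\<^sup>2) * r * (norm x / 2) powr (- (real CARD('n) + 1)) * (LBINT y. \<bar>g y\<bar>)"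
  unfolding partial_w
proof (rule conv_decay[OF newton_grad_differentiable[OF e] _ _ _ g g_mean r])
  fix l and z :: "real^'n" assume "z \<noteq> 0"
  then have "(5 * real CARD('n) + (real CARD('n))\<^sup>2) * regsq e z powr (- (real CARD('n) + 1) / 2)
      \<le> (5 * real CARD('n) + (real CARD('n))\<^sup>2) * norm z powr (- (real CARD('n) + 1))"
    by (intro mult_left_mono regsq_powr_le(2) e) auto
  then show "\<bar>partial l (newton_grad e i j) z\<bar> \<le> (5 * real CARD('n) + (real CARD('n))\<^sup>2) * norm z powr (- (real CARD('n) + 1))"
    using newton_grad2_bound[OF e, of l i j z] by linarith
qed auto

text \<open>The bound depends on \<open>e\<close>, which is harmless: it enters only a boundary term
  that vanishes, for fixed \<open>e\<close>, as the radius grows.\<close>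

lemma partial_w_bounded: obtains M where "M \<ge> 0" "\<And>i j x. \<bar>partial i (w j) x\<bar> \<le> M"
proof -
  let ?B = "(1 + real CARD('n)) * e powr (- real CARD('n))"
  have gI: "integrable lborel (\<lambda>y. \<bar>g y\<bar>)" by (intro integrable_abs integrable_csupp g csupp_g)
  have "\<bar>partial i (w j) x\<bar> \<le> ?B * (LBINT y. \<bar>g y\<bar>)" for i j x
  proof -
    have I: "integrable lborel (\<lambda>y. newton_grad e i j (x - y) * g y)"
      by (intro conv_integrable C1_continuous[OF C1_newton_grad[OF e]] g csupp_g)
    have "\<bar>partial i (w j) x\<bar> \<le> (LBINT y. \<bar>newton_grad e i j (x - y) * g y\<bar>)"
      unfolding partial_w conv_def by (rule integral_abs_bound)
    also have "\<dots> \<le> (LBINT y. ?B * \<bar>g y\<bar>)"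
      using gI newton_grad_le I unfolding abs_mult
      by (intro integral_mono mult_right_mono integrable_mult_right) (auto simp: abs_mult[symmetric])
    finally show ?thesis by simp
  qed
  then show thesis by (intro that[of "?B * (LBINT y. \<bar>g y\<bar>)"]) auto
qed

text \<open>The decay \<open>norm x powr (- d)\<close> of the field balances the volume of the
  annulus, so with a bounded gradient the integral stays bounded and the prefactor sends the product
  to 0. Without mean zero the field would lose one power of decay and this count would fail.\<close>

lemma w_null_form_err:
  "(\<lambda>n. 1 / real (Suc n) * (LBINT x. indicator (annulus (real (Suc n))) x * \<bar>w i x * partial j (w k) x\<bar>)) \<longlonglongrightarrow> 0"
proof -
  let ?d = "real CARD('n)"
  obtain M where M: "M \<ge> 0" "\<And>i j x. \<bar>partial i (w j) x\<bar> \<le> M" using partial_w_bounded by blast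
  define D where "D = ?d * (1 + ?d) * r * (LBINT y. \<bar>g y\<bar>)"
  have D: "D \<ge> 0" using r by (simp add: D_def)
  let ?V = "unit_ball_vol ?d"
  have "(LBINT x. indicator (annulus R) x * \<bar>w i x * partial j (w k) x\<bar>) \<le> D * M * ?V * 4 ^ CARD('n)" if R: "R \<ge> 2 * r" for R
  proof -
    have R0: "R > 0" using R r by linarith
    have "(LBINT x. indicator (annulus R) x * \<bar>w i x * partial j (w k) x\<bar>) \<le> (D * (R / 2) powr (- ?d) * M) * (?V * (2 * R) ^ CARD('n))"
    proof (rule integral_annulus_le)
      show "continuous_on UNIV (\<lambda>x. \<bar>w i x * partial j (w k) x\<bar>)"
        by (intro continuous_intros C1_continuous C1_w C1_partial_w)
      fix x :: "real^'n" assume x: "x \<in> annulus R"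
      then have "norm x \<ge> 2 * r" using R by (simp add: annulus_def)
      then have "\<bar>w i x\<bar> \<le> D * (norm x / 2) powr (- ?d)" using w_decay[of x i] by (simp add: D_def mult_ac)
      also have "\<dots> \<le> D * (R / 2) powr (- ?d)"
        using x D R0 by (intro mult_left_mono powr_mono2') (auto simp: annulus_def)
      finally show "\<bar>w i x * partial j (w k) x\<bar> \<le> D * (R / 2) powr (- ?d) * M"
        unfolding abs_mult using M by (intro mult_mono) auto
    qed (use R0 D M in auto)
    also have "(2 * R) ^ CARD('n) = 4 ^ CARD('n) * (R / 2) powr ?d"
    proof -
      have "2 * R = 4 * (R / 2)" by simp
      then have "(2 * R) ^ CARD('n) = 4 ^ CARD('n) * (R / 2) ^ CARD('n)" by (simp only: power_mult_distrib)
      then show ?thesis using R0 by (simp only: powr_realpow[of "R / 2"] half_gt_zero)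
    qed
    also have "D * (R / 2) powr (- ?d) * M * (?V * (4 ^ CARD('n) * (R / 2) powr ?d)) = D * M * ?V * 4 ^ CARD('n) * ((R / 2) powr (- ?d) * (R / 2) powr ?d)"
      by (simp add: mult_ac)
    also have "(R / 2) powr (- ?d) * (R / 2) powr ?d = 1" unfolding powr_add[symmetric] using R0 by simp
    finally show ?thesis by simp
  qed
  note b = this
  show ?thesis
  proof (rule Lim_null_comparison)
    obtain N :: nat where N: "2 * r \<le> real N" using real_arch_simple by blast
    show "\<forall>\<^sub>F n in sequentially. norm (1 / real (Suc n) * (LBINT x. indicator (annulus (real (Suc n))) x * \<bar>w i x * partial j (w k) x\<bar>))
       \<le> 1 / real (Suc n) * (D * M * ?V * 4 ^ CARD('n))"
      unfolding eventually_sequentially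
    proof (intro exI[of _ N] allI impI)
      fix n assume "n \<ge> N"
      then have "2 * r \<le> real (Suc n)" using N by simp
      then have "(LBINT x. indicator (annulus (real (Suc n))) x * \<bar>w i x * partial j (w k) x\<bar>) \<le> D * M * ?V * 4 ^ CARD('n)" by (rule b)
      moreover have "(LBINT x. indicator (annulus (real (Suc n))) x * \<bar>w i x * partial j (w k) x\<bar>) \<ge> 0" by simp
      ultimately show "norm (1 / real (Suc n) * (LBINT x. indicator (annulus (real (Suc n))) x * \<bar>w i x * partial j (w k) x\<bar>))
       \<le> 1 / real (Suc n) * (D * M * ?V * 4 ^ CARD('n))"
        unfolding real_norm_def abs_mult by (intro mult_mono) auto
    qed
    show "(\<lambda>n. 1 / real (Suc n) * (D * M * ?V * 4 ^ CARD('n))) \<longlonglongrightarrow> 0"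
      using tendsto_mult_right[OF LIMSEQ_inverse_real_of_nat, of "D * M * ?V * 4 ^ CARD('n)"] by (simp add: inverse_eq_divide)
  qed
qed

lemma div_w_L2:
  shows "integrable lborel (\<lambda>x. (\<Sum>i\<in>UNIV. partial i (w i) x)\<^sup>2)"
    and "(LBINT x. (\<Sum>i\<in>UNIV. partial i (w i) x)\<^sup>2) \<le> (newton_mass TYPE('n))\<^sup>2 * (LBINT x. (g x)\<^sup>2)"
proof -
  have c: "continuous_on UNIV (\<lambda>x. \<Sum>i\<in>UNIV. partial i (w i) x)"
    by (intro continuous_on_sum C1_continuous C1_partial_w)
  have m: "conv (newton_div e) g \<in> borel_measurable borel"
    using c unfolding div_w by (rule borel_measurable_continuous_onI)
  have s: "newton_div e (- x) = newton_div e x" for x :: "real^'n"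
    by (simp add: newton_div_def regsq_def)
  note L = conv_L2[OF newton_div_continuous[OF e] newton_div_integrable[OF e] newton_div_nonneg s g(1) csupp_g m]
  show "integrable lborel (\<lambda>x. (\<Sum>i\<in>UNIV. partial i (w i) x)\<^sup>2)"
    and "(LBINT x. (\<Sum>i\<in>UNIV. partial i (w i) x)\<^sup>2) \<le> (newton_mass TYPE('n))\<^sup>2 * (LBINT x. (g x)\<^sup>2)"
    using L e unfolding div_w integral_newton_div[OF e] by auto
qed

text \<open>Since \<open>partial i (w j)\<close> is symmetric in \<open>i\<close> and
  \<open>j\<close>, the trace in \<open>null_form_limit\<close> is the squared gradient. The
  identity comes with a cut-off; Fatou's lemma removes it and yields integrability and the bound at
  once.\<close>

lemma grad_w_L2:
  shows "integrable lborel (\<lambda>x. \<Sum>i\<in>UNIV. \<Sum>j\<in>UNIV. (partial i (w j) x)\<^sup>2)"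
    and "(LBINT x. (\<Sum>i\<in>UNIV. \<Sum>j\<in>UNIV. (partial i (w j) x)\<^sup>2)) \<le> (newton_mass TYPE('n))\<^sup>2 * (LBINT x. (g x)\<^sup>2)"
proof -
  let ?G = "\<lambda>x. \<Sum>i\<in>UNIV. \<Sum>j\<in>UNIV. (partial i (w j) x)\<^sup>2"
  let ?H = "\<lambda>x. (\<Sum>i\<in>UNIV. partial i (w i) x)\<^sup>2"
  let ?\<phi> = "\<lambda>n. cutoff (real (Suc n)) :: real^'n \<Rightarrow> real"
  let ?B = "(newton_mass TYPE('n))\<^sup>2 * (LBINT x. (g x)\<^sup>2)"
  define E where "E n = (LBINT x. (?H x - ?G x) * ?\<phi> n x)" for n
  have "(\<lambda>n. LBINT x. ((\<Sum>i\<in>UNIV. partial i (w i) x)\<^sup>2 - (\<Sum>i\<in>UNIV. \<Sum>j\<in>UNIV. partial i (w j) x * partial j (w i) x))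
             * cutoff (real (Suc n)) x) \<longlonglongrightarrow> 0"
    by (rule null_form_limit[OF C1_w C1_partial_w w_null_form_err])
  moreover have "partial i (w j) x * partial j (w i) x = (partial i (w j) x)\<^sup>2" for i j x
    by (subst partial_w_sym[of j i]) (simp add: power2_eq_square)
  ultimately have E: "E \<longlonglongrightarrow> 0" unfolding E_def[abs_def] by simp
  have cG: "continuous_on UNIV ?G" and cH: "continuous_on UNIV ?H"
    by (intro continuous_intros C1_continuous C1_partial_w)+
  have \<phi>: "C1 (?\<phi> n)" "csupp (?\<phi> n)" for n by (auto simp: C1_cutoff csupp_cutoff)
  have IG: "integrable lborel (\<lambda>x. ?G x * ?\<phi> n x)" and IH: "integrable lborel (\<lambda>x. ?H x * ?\<phi> n x)" for n
    by (intro integrable_csupp_mult cG cH C1_continuous \<phi>)+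
  have le: "(LBINT x. ?G x * ?\<phi> n x) \<le> ?B - E n" for n
  proof -
    have "(LBINT x. ?H x * ?\<phi> n x) \<le> (LBINT x. ?H x)"
      by (intro integral_mono IH div_w_L2(1) mult_left_le cutoff_range) auto
    moreover have "E n = (LBINT x. ?H x * ?\<phi> n x) - (LBINT x. ?G x * ?\<phi> n x)"
      unfolding E_def left_diff_distrib using IG IH by (rule Bochner_Integration.integral_diff[rotated])
    ultimately show ?thesis using div_w_L2(2) by linarith
  qed
  have lim: "(\<lambda>n. ?G x * ?\<phi> n x) \<longlonglongrightarrow> ?G x" for x
    using tendsto_mult_left[OF cutoff_tendsto[of x], of "?G x"] by simp
  have nn: "0 \<le> ?G x * ?\<phi> n x" for n x by (intro mult_nonneg_nonneg sum_nonneg cutoff_range) auto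
  have "(\<lambda>n. ?B - E n) \<longlonglongrightarrow> ?B - 0" by (intro tendsto_intros E)
  then have B: "(\<lambda>n. ?B - E n) \<longlonglongrightarrow> ?B" by simp
  show "integrable lborel ?G" "(LBINT x. ?G x) \<le> ?B"
    using Fatou_integral[OF IG nn lim le B] by auto
qed

end

text \<open>For every \<open>e\<close> the field is dominated by \<open>norm z powr (1 - d)\<close>.
  Near 0 this is integrable and pairs with the bound on \<open>g\<close>; far away it is square
  integrable because \<open>2 * (d - 1) > d\<close> for \<open>d \<ge> 3\<close>, and pairs with the
  L2 norm of \<open>g\<close>. So the bound does not see the size of the support.\<close>

lemma newton_field_sup:
  assumes d: "CARD('n::finite) \<ge> 3"
  obtains C where "C \<ge> 0" "\<And>e g B j x. e > 0 \<Longrightarrow> continuous_on UNIV g \<Longrightarrow> csupp g \<Longrightarrow> (\<And>y. \<bar>g y\<bar> \<le> B) \<Longrightarrow>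
     \<bar>conv (newton e j) g (x :: real^'n)\<bar> \<le> C * (B + sqrt (LBINT y. (g y)\<^sup>2))"
proof -
  let ?d = "real CARD('n)"
  have d3: "?d \<ge> 3" using d by simp
  let ?h1 = "\<lambda>z::real^'n. indicator (cball 0 1) z * norm z powr (1 - ?d)"
  let ?h2 = "\<lambda>z::real^'n. indicator {z. 1 \<le> norm z} z * norm z powr (1 - ?d)"
  have i1: "integrable lborel ?h1" by (rule radial_head)
  \<comment> \<open>The squared tail has exponent \<open>2 - 2 * d = - (d + (d - 2))\<close>, hence
    \<open>radial_tail\<close> with \<open>m = d - 2\<close>.\<close>
  have "?d - 2 > 0" using d3 by simp
  from radial_tail[OF this, where 'n = 'n] obtain C where I:
    "\<And>R. R > 0 \<Longrightarrow> integrable lborel (\<lambda>x::real^'n. indicator {x. R \<le> norm x} x * norm x powr (- (?d + (?d - 2))))"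
    by blast
  have "integrable lborel (\<lambda>x::real^'n. indicator {x. 1 \<le> norm x} x * norm x powr (- (?d + (?d - 2))))"
    by (rule I) simp
  moreover have "(?h2 z)\<^sup>2 = indicator {x. 1 \<le> norm x} z * norm z powr (- (?d + (?d - 2)))" for z
  proof -
    have "(norm z powr (1 - ?d))\<^sup>2 = norm z powr (- (?d + (?d - 2)))"
      unfolding power2_eq_square powr_add[symmetric] by (rule arg_cong[where f = "(powr) (norm z)"]) simp
    then show ?thesis unfolding power_mult_distrib by (simp add: indicator_def)
  qed
  ultimately have i2: "integrable lborel (\<lambda>z. (?h2 z)\<^sup>2)" by simp
  define a b where "a = (LBINT z. ?h1 z)" and "b = sqrt (LBINT z. (?h2 z)\<^sup>2)"
  have ab: "a \<ge> 0" "b \<ge> 0" by (auto simp: a_def b_def)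
  have m1[measurable]: "?h1 \<in> borel_measurable borel" and m2[measurable]: "?h2 \<in> borel_measurable borel"
    by (auto intro!: borel_measurable_times powr_real_measurable)
  show thesis
  proof (rule that[of "a + b"])
    show "a + b \<ge> 0" using ab by simp
    fix e B :: real and g :: "real^'n \<Rightarrow> real" and j x
    assume e: "e > 0" and g: "continuous_on UNIV g" "csupp g" and B: "\<And>y. \<bar>g y\<bar> \<le> B"
    have B0: "B \<ge> 0" using B[of 0] by linarith
    have [measurable]: "g \<in> borel_measurable borel" using g(1) by (rule borel_measurable_continuous_onI)
    have g2: "integrable lborel (\<lambda>y. (g y)\<^sup>2)"
      using g by (intro integrable_csupp continuous_intros) (auto simp: power2_eq_square)
    have refl: "(LBINT y. f (x - y)) = (LBINT y. f y)" if "f \<in> borel_measurable borel" for f :: "real^'n \<Rightarrow> real"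
      using lborel_integral_affine[OF that, of "-1" x] by simp
    have refli: "integrable lborel (\<lambda>y. f (x - y))" if "integrable lborel f" for f :: "real^'n \<Rightarrow> real"
      using integrable_lborel_affine[OF that, of "-1" x] by simp
    have I: "integrable lborel (\<lambda>y. newton e j (x - y) * g y)"
      by (intro conv_integrable C1_continuous[OF C1_newton[OF e]] g)
    have i2': "integrable lborel (\<lambda>y. (?h2 (x - y))\<^sup>2)" using refli[OF i2] .
    have J1: "integrable lborel (\<lambda>y. ?h1 (x - y) * B)" by (intro integrable_mult_left refli i1)
    have J2: "integrable lborel (\<lambda>y. ?h2 (x - y) * g y)"
      by (rule integrable_mult_L2[OF _ _ i2' g2]) measurable
    have pw: "\<bar>newton e j (x - y) * g y\<bar> \<le> ?h1 (x - y) * B + \<bar>?h2 (x - y) * g y\<bar>" for y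
    proof (cases "x - y = 0")
      case True then show ?thesis using B0 by (simp add: newton_def)
    next
      case False
      have n: "\<bar>newton e j (x - y)\<bar> \<le> norm (x - y) powr (1 - ?d)"
        using newton_bound[OF e, of j "x - y"] regsq_powr_le(2)[OF e, of "?d - 1" "x - y"] False d3 by simp
      show ?thesis
      proof (cases "norm (x - y) \<le> 1")
        case True
        have "\<bar>newton e j (x - y) * g y\<bar> \<le> norm (x - y) powr (1 - ?d) * B"
          unfolding abs_mult using n B by (intro mult_mono) auto
        then show ?thesis using True by simp
      next
        case False
        have "\<bar>newton e j (x - y) * g y\<bar> \<le> norm (x - y) powr (1 - ?d) * \<bar>g y\<bar>"
          unfolding abs_mult using n by (intro mult_mono) auto
        then show ?thesis using False B0 by (simp add: abs_mult)
      qed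
    qed
    have "\<bar>conv (newton e j) g x\<bar> \<le> (LBINT y. \<bar>newton e j (x - y) * g y\<bar>)"
      unfolding conv_def by (rule integral_abs_bound)
    also have "\<dots> \<le> (LBINT y. ?h1 (x - y) * B + \<bar>?h2 (x - y) * g y\<bar>)"
      using I J1 J2 pw by (intro integral_mono integrable_abs Bochner_Integration.integrable_add) auto
    also have "\<dots> = (LBINT y. ?h1 (x - y) * B) + (LBINT y. \<bar>?h2 (x - y) * g y\<bar>)"
      by (intro Bochner_Integration.integral_add J1 integrable_abs J2)
    also have "(LBINT y. ?h1 (x - y) * B) = a * B"
      using refl[OF m1] by (simp add: a_def)
    also have "(LBINT y. \<bar>?h2 (x - y) * g y\<bar>) \<le> sqrt (LBINT y. (?h2 (x - y))\<^sup>2) * sqrt (LBINT y. (g y)\<^sup>2)"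
      by (rule Cauchy_Schwarz_L2[OF _ _ i2' g2]) measurable
    also have "sqrt (LBINT y. (?h2 (x - y))\<^sup>2) = b"
      unfolding b_def by (subst refl) (auto intro!: borel_measurable_power m2)
    also have "a * B + b * sqrt (LBINT y. (g y)\<^sup>2) \<le> (a + b) * (B + sqrt (LBINT y. (g y)\<^sup>2))"
      using ab B0 by (simp add: algebra_simps)
    finally show "\<bar>conv (newton e j) g x\<bar> \<le> (a + b) * (B + sqrt (LBINT y. (g y)\<^sup>2))" by simp
  qed
qed

section \<open>The energy identity\<close>

text \<open>The density may vanish, and \<open>C1_compose\<close> wants a two-sided derivative also
  at the value 0. The absolute value extends the power evenly to negative arguments, and
  \<open>a > 1\<close> makes the derivative at 0 vanish.\<close>

lemma DERIV_abs_powr: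
  fixes a z :: real
  assumes a: "a > 1" and z: "z \<ge> 0"
  shows "((\<lambda>t. \<bar>t\<bar> powr a) has_real_derivative a * z powr (a - 1)) (at z)"
proof (cases "z = 0")
  case False
  with z have z: "z > 0" by simp
  have "\<forall>\<^sub>F t in nhds z. \<bar>t\<bar> powr a = t powr a"
    using eventually_nhds_in_open[of "{0<..}" z] z by (auto elim!: eventually_mono)
  then show ?thesis
    using z by (subst DERIV_cong_ev[OF refl _ refl, of _ "\<lambda>t. t powr a"]) (auto intro!: derivative_eq_intros)
next
  case True
  have "((\<lambda>h. (\<bar>0 + h\<bar> powr a - \<bar>0\<bar> powr a) / h) \<longlongrightarrow> 0) (at 0)"
  proof (rule Lim_null_comparison)
    have "norm ((\<bar>0 + h\<bar> powr a - \<bar>0\<bar> powr a) / h) \<le> \<bar>h\<bar> powr (a - 1)" for h :: real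
      by (cases "h = 0") (auto simp: powr_diff abs_divide)
    then show "\<forall>\<^sub>F h in at 0. norm ((\<bar>0 + h\<bar> powr a - \<bar>0\<bar> powr a) / h) \<le> \<bar>h\<bar> powr (a - 1)"
      by (intro always_eventually allI)
    have "((\<lambda>h. \<bar>h\<bar> powr (a - 1)) \<longlongrightarrow> 0 powr (a - 1)) (at (0::real))"
      using a by (intro tendsto_powr') (auto intro!: tendsto_eq_intros)
    then show "((\<lambda>h. \<bar>h\<bar> powr (a - 1)) \<longlongrightarrow> 0) (at (0::real))" by simp
  qed
  then show ?thesis using True by (simp add: DERIV_def)
qed

lemma
  assumes f: "C1 f" and nn: "\<And>x. f x \<ge> 0" and a: "a > 1"
  shows C1_powr: "C1 (\<lambda>x. f x powr a)"
    and partial_powr: "partial i (\<lambda>x. f x powr a) x = a * f x powr (a - 1) * partial i f x"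
proof -
  have eq: "(\<lambda>x. f x powr a) = (\<lambda>x. \<bar>f x\<bar> powr a)" using nn by simp
  have c: "continuous_on (range f) (\<lambda>z. a * z powr (a - 1))"
    using nn a by (intro continuous_on_mult continuous_on_const continuous_on_powr' continuous_on_id) auto
  note D = DERIV_abs_powr[OF a nn]
  show "C1 (\<lambda>x. f x powr a)" "partial i (\<lambda>x. f x powr a) x = a * f x powr (a - 1) * partial i f x"
    unfolding eq using C1_compose[OF f D c] partial_compose[OF f D c] by auto
qed

text \<open>The expression on the left is \<open>t\<close> times
  \<open>t powr (\<gamma> - 1) - c powr (\<gamma> - 1)\<close>; by monotonicity it lies between 0
  and \<open>t powr \<gamma> - c powr \<gamma>\<close>. This lets a constant subtracted from the
  pressure be traded for a multiple of the density.\<close>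

lemma powr_tangent_le:
  fixes c t \<gamma> :: real
  assumes "t \<ge> 0" "c \<ge> 0" "\<gamma> > 1"
  shows "\<bar>t powr \<gamma> - c powr (\<gamma> - 1) * t\<bar> \<le> \<bar>t powr \<gamma> - c powr \<gamma>\<bar>"
proof -
  have *: "c powr (\<gamma> - 1) * c = c powr \<gamma>" "t powr (\<gamma> - 1) * t = t powr \<gamma>"
    using powr_mult_base[of c "\<gamma> - 1"] powr_mult_base[of t "\<gamma> - 1"] assms by (auto simp: mult.commute)
  show ?thesis
  proof (cases "c \<le> t")
    case True
    have "c powr (\<gamma> - 1) * t \<le> t powr (\<gamma> - 1) * t" "c powr (\<gamma> - 1) * c \<le> c powr (\<gamma> - 1) * t"
      using True assms by (auto intro!: mult_right_mono mult_left_mono powr_mono2)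
    then show ?thesis using * by (simp add: abs_le_iff)
  next
    case False
    have "t powr (\<gamma> - 1) * t \<le> c powr (\<gamma> - 1) * t" "c powr (\<gamma> - 1) * t \<le> c powr (\<gamma> - 1) * c"
      using False assms by (auto intro!: mult_right_mono mult_left_mono powr_mono2)
    then show ?thesis using * by (simp add: abs_le_iff)
  qed
qed

section \<open>The flow equations in weak form\<close>

definition L2norm :: "(real^'n::finite \<Rightarrow> real) \<Rightarrow> real" where
  "L2norm f = sqrt (LBINT x. (f x)\<^sup>2)"

lemma L2norm_nonneg: "L2norm f \<ge> 0" by (simp add: L2norm_def)

text \<open>All dimensions share this setting: \<open>q\<close> will be 6, 9/2 or
  \<open>2 * d / (d - 2)\<close>, and \<open>M\<close> bounds the density. The velocity is a family
  of components \<open>u\<close>, to which the scalar calculus of \<open>C1\<close> applies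
  directly.\<close>

locale flow =
  fixes \<rho> :: "real^'n::finite \<Rightarrow> real" and u :: "'n \<Rightarrow> real^'n \<Rightarrow> real" and \<mu> lam A \<gamma> M q :: real
  assumes mu_pos: "\<mu> > 0" and visc: "lam + 2 * \<mu> > 0" and A_pos: "A > 0" and gamma: "\<gamma> > 1"
    and rho: "C1 \<rho>" and rho_nonneg: "\<And>x. \<rho> x \<ge> 0" and rho_le: "\<And>x. \<rho> x \<le> M"
    and u: "\<And>i. C1 (u i)" and du: "\<And>i j. C1 (partial i (u j))"
    and continuity: "\<And>x. (\<Sum>i\<in>UNIV. partial i (\<lambda>y. \<rho> y * u i y) x) = 0"
    and momentum: "\<And>x j. (\<Sum>i\<in>UNIV. partial i (\<lambda>y. \<rho> y * u i y * u j y) x)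
        = - partial j (\<lambda>y. A * \<rho> y powr \<gamma>) x + \<mu> * (\<Sum>i\<in>UNIV. partial i (partial i (u j)) x)
          + (\<mu> + lam) * partial j (\<lambda>y. \<Sum>i\<in>UNIV. partial i (u i) y) x"
    and grad_L2: "integrable lborel (\<lambda>x. \<Sum>i\<in>UNIV. \<Sum>j\<in>UNIV. (partial i (u j) x)\<^sup>2)"
    and q: "q > 2" and Lq: "integrable lborel (\<lambda>x. (\<Sum>i\<in>UNIV. (u i x)\<^sup>2) powr (q / 2))"
begin

definition "P x = A * \<rho> x powr \<gamma>"
definition "divu x = (\<Sum>i\<in>UNIV. partial i (u i) x)"
definition "usq x = (\<Sum>i\<in>UNIV. (u i x)\<^sup>2)"
definition "gsq x = (\<Sum>i\<in>UNIV. \<Sum>j\<in>UNIV. (partial i (u j) x)\<^sup>2)"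

lemma M_nonneg: "M \<ge> 0" using rho_nonneg rho_le order_trans by blast

lemma C1_P: "C1 P" and partial_P: "partial i P x = A * (\<gamma> * \<rho> x powr (\<gamma> - 1) * partial i \<rho> x)"
  unfolding P_def[abs_def] using C1_powr[OF rho rho_nonneg gamma] partial_powr[OF rho rho_nonneg gamma]
  by (auto simp: partial_cmult)

lemma P_nonneg: "P x \<ge> 0" using A_pos by (simp add: P_def)

lemma P_le: "P x \<le> A * M powr \<gamma>"
  unfolding P_def using A_pos gamma rho_nonneg rho_le by (intro mult_left_mono powr_mono2) auto

lemma C1_divu: "C1 divu" unfolding divu_def[abs_def] using du by (intro C1_sum)

lemma C1_usq: "C1 usq" and partial_usq: "partial i usq x = (\<Sum>j\<in>UNIV. 2 * (u j x * partial i (u j) x))"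
  unfolding usq_def[abs_def] power2_eq_square
  using C1_sum[of UNIV "\<lambda>i y. u i y * u i y", OF C1_mult[OF u u]]
    partial_sum[of UNIV "\<lambda>i y. u i y * u i y", OF C1_mult[OF u u], of i x]
  by (auto simp: partial_mult[OF u u] mult.commute)

lemma usq_nonneg: "usq x \<ge> 0" unfolding usq_def by (intro sum_nonneg) auto
lemma gsq_nonneg: "gsq x \<ge> 0" unfolding gsq_def by (intro sum_nonneg) auto

lemma abs_u_le: "\<bar>u i x\<bar> \<le> sqrt (usq x)"
proof -
  have "(u i x)\<^sup>2 \<le> usq x" unfolding usq_def by (rule member_le_sum) auto
  then show ?thesis using real_le_rsqrt[of "\<bar>u i x\<bar>" "usq x"] by simp
qed

lemma abs_du_le: "\<bar>partial i (u j) x\<bar> \<le> sqrt (gsq x)"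
proof -
  have "(partial i (u j) x)\<^sup>2 \<le> (\<Sum>j\<in>UNIV. (partial i (u j) x)\<^sup>2)" by (rule member_le_sum) auto
  also have "\<dots> \<le> gsq x" unfolding gsq_def by (rule member_le_sum) (auto intro: sum_nonneg)
  finally show ?thesis using real_le_rsqrt[of "\<bar>partial i (u j) x\<bar>" "gsq x"] by simp
qed

lemma abs_divu_le: "\<bar>divu x\<bar> \<le> real CARD('n) * sqrt (gsq x)"
proof -
  have "\<bar>divu x\<bar> \<le> (\<Sum>i\<in>(UNIV::'n set). sqrt (gsq x))"
    unfolding divu_def by (rule order_trans[OF sum_abs sum_mono]) (rule abs_du_le)
  then show ?thesis by simp
qed

lemmas cont_u = C1_continuous[OF u] and cont_du = C1_partial_continuous[OF u] and cont_rho = C1_continuous[OF rho]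
  and cont_P = C1_continuous[OF C1_P] and cont_divu = C1_continuous[OF C1_divu] and cont_usq = C1_continuous[OF C1_usq]

lemma cont_gsq: "continuous_on S gsq"
  unfolding gsq_def[abs_def] by (intro continuous_on_sum continuous_on_power cont_du)

text \<open>The product rule and the continuity equation: the term in which \<open>f\<close> is not
  differentiated is \<open>f\<close> times the divergence of the momentum, which is 0.\<close>

lemma transport:
  assumes f: "C1 f"
  shows "(\<Sum>i\<in>UNIV. partial i (\<lambda>y. \<rho> y * u i y * f y) x) = \<rho> x * (\<Sum>i\<in>UNIV. u i x * partial i f x)"
proof -
  have "(\<Sum>i\<in>UNIV. partial i (\<lambda>y. \<rho> y * u i y * f y) x) =
      (\<Sum>i\<in>UNIV. partial i (\<lambda>y. \<rho> y * u i y) x) * f x + (\<Sum>i\<in>UNIV. \<rho> x * u i x * partial i f x)"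
    unfolding partial_mult[OF C1_mult[OF rho u] f] by (simp add: sum.distrib sum_distrib_right)
  then show ?thesis by (simp add: continuity sum_distrib_left mult_ac)
qed

lemma weak_div:
  assumes F: "\<And>i. C1 (F i)" and \<phi>: "C1 \<phi>" "csupp \<phi>"
  shows "(LBINT x. (\<Sum>i\<in>(UNIV::'n set). partial i (F i) x) * \<phi> x) = - (LBINT x. (\<Sum>i\<in>UNIV. F i x * partial i \<phi> x))"
proof -
  have I1: "integrable lborel (\<lambda>x. partial i (F i) x * \<phi> x)" for i
    by (intro integrable_csupp_mult C1_partial_continuous F C1_continuous \<phi>)
  have I2: "integrable lborel (\<lambda>x. F i x * partial i \<phi> x)" for i
    by (intro integrable_csupp_mult C1_partial_continuous[OF \<phi>(1)] C1_continuous[OF F] csupp_partial \<phi>)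
  have "(LBINT x. (\<Sum>i\<in>UNIV. partial i (F i) x) * \<phi> x) = (\<Sum>i\<in>UNIV. LBINT x. partial i (F i) x * \<phi> x)"
    unfolding sum_distrib_right using I1 by (rule Bochner_Integration.integral_sum)
  also have "\<dots> = (\<Sum>i\<in>UNIV. - (LBINT x. F i x * partial i \<phi> x))"
    by (intro sum.cong refl integration_by_parts F \<phi>)
  also have "\<dots> = - (LBINT x. (\<Sum>i\<in>UNIV. F i x * partial i \<phi> x))"
    using I2 by (simp add: sum_negf Bochner_Integration.integral_sum)
  finally show ?thesis .
qed

lemma weak_transport:
  assumes f: "C1 f" and \<phi>: "C1 \<phi>" "csupp \<phi>"
  shows "(LBINT x. \<rho> x * (\<Sum>i\<in>UNIV. u i x * partial i f x) * \<phi> x) = - (LBINT x. \<rho> x * f x * (\<Sum>i\<in>UNIV. u i x * partial i \<phi> x))"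
  using weak_div[of "\<lambda>i y. \<rho> y * u i y * f y", OF C1_mult[OF C1_mult[OF rho u] f] \<phi>]
  unfolding transport[OF f] by (simp add: sum_distrib_left mult_ac)

lemma weak_momentum:
  assumes \<Phi>: "\<And>j. C1 (\<Phi> j)" "\<And>j. csupp (\<Phi> j)"
  shows "(LBINT x. (\<Sum>j\<in>UNIV. \<rho> x * (\<Sum>i\<in>UNIV. u i x * partial i (u j) x) * \<Phi> j x))
    = (LBINT x. P x * (\<Sum>j\<in>UNIV. partial j (\<Phi> j) x))
      - \<mu> * (LBINT x. (\<Sum>j\<in>UNIV. \<Sum>i\<in>UNIV. partial i (u j) x * partial i (\<Phi> j) x))
      - (\<mu> + lam) * (LBINT x. divu x * (\<Sum>j\<in>UNIV. partial j (\<Phi> j) x))"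
proof -
  have mom: "\<rho> x * (\<Sum>i\<in>UNIV. u i x * partial i (u j) x) = - partial j P x + \<mu> * (\<Sum>i\<in>UNIV. partial i (partial i (u j)) x)
      + (\<mu> + lam) * partial j divu x" for x j
    using momentum[of j x] unfolding transport[OF u] P_def[abs_def] divu_def[abs_def] .
  have I1: "integrable lborel (\<lambda>x. partial i f x * \<Phi> j x)" if "C1 f" for i j f
    by (intro integrable_csupp_mult C1_partial_continuous that C1_continuous \<Phi>)
  have I2: "integrable lborel (\<lambda>x. f x * partial i (\<Phi> j) x)" if "C1 f" for i j f
    by (intro integrable_csupp_mult C1_partial_continuous[OF \<Phi>(1)] C1_continuous[OF that] csupp_partial \<Phi>)
  have eq: "(\<Sum>j\<in>UNIV. \<rho> x * (\<Sum>i\<in>UNIV. u i x * partial i (u j) x) * \<Phi> j x) =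
     (\<Sum>j\<in>UNIV. - (partial j P x * \<Phi> j x)) + \<mu> * (\<Sum>j\<in>UNIV. \<Sum>i\<in>UNIV. partial i (partial i (u j)) x * \<Phi> j x)
      + (\<mu> + lam) * (\<Sum>j\<in>UNIV. partial j divu x * \<Phi> j x)" for x
    unfolding mom
    by (simp add: sum_distrib_left sum_distrib_right sum.distrib sum_negf sum_subtractf algebra_simps)
  have S: "(LBINT x. (\<Sum>j\<in>UNIV. partial j f x * \<Phi> j x)) = - (LBINT x. f x * (\<Sum>j\<in>UNIV. partial j (\<Phi> j) x))" if f: "C1 f" for f
  proof -
    have "(LBINT x. (\<Sum>j\<in>UNIV. partial j f x * \<Phi> j x)) = (\<Sum>j\<in>UNIV. - (LBINT x. f x * partial j (\<Phi> j) x))"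
      using I1[OF f] by (simp add: Bochner_Integration.integral_sum integration_by_parts[OF f \<Phi>])
    also have "\<dots> = - (LBINT x. f x * (\<Sum>j\<in>UNIV. partial j (\<Phi> j) x))"
      using I2[OF f] by (simp add: sum_negf Bochner_Integration.integral_sum sum_distrib_left)
    finally show ?thesis .
  qed
  have S2: "(LBINT x. (\<Sum>j\<in>UNIV. \<Sum>i\<in>UNIV. partial i (partial i (u j)) x * \<Phi> j x))
     = - (LBINT x. (\<Sum>j\<in>UNIV. \<Sum>i\<in>UNIV. partial i (u j) x * partial i (\<Phi> j) x))"
    using I1[OF du] I2[OF du] by (simp add: Bochner_Integration.integral_sum integration_by_parts[OF du \<Phi>] sum_negf)
  have J: "integrable lborel (\<lambda>x. \<Sum>j\<in>UNIV. partial j f x * \<Phi> j x)" if "C1 f" for f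
    using I1[OF that] by (intro Bochner_Integration.integrable_sum)
  have J2: "integrable lborel (\<lambda>x. \<Sum>j\<in>UNIV. \<Sum>i\<in>UNIV. partial i (partial i (u j)) x * \<Phi> j x)"
    using I1[OF du] by (intro Bochner_Integration.integrable_sum)
  show ?thesis
    unfolding eq sum_negf using J[OF C1_P] J[OF C1_divu] J2
    by (simp add: S[OF C1_P] S[OF C1_divu] S2)
qed

text \<open>By mass conservation the divergence of pressure times velocity is
  \<open>(1 - \<gamma>) * (P x * divu x)\<close>, and a multiple of the divergence-free momentum may
  be subtracted for free. Both terms on the left are therefore multiples of one flux integral, with
  factors \<open>1 / (\<gamma> - 1)\<close> and 1, whose sum is
  \<open>\<gamma> / (\<gamma> - 1)\<close>.\<close>

lemma weak_pressure:
  assumes \<eta>: "C1 \<eta>" "csupp \<eta>"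
  shows "(LBINT x. P x * divu x * \<eta> x) + (LBINT x. P x * (\<Sum>i\<in>UNIV. u i x * partial i \<eta> x))
     = \<gamma> / (\<gamma> - 1) * (LBINT x. (P x - \<kappa> * \<rho> x) * (\<Sum>i\<in>UNIV. u i x * partial i \<eta> x))"
proof -
  have CF: "C1 (\<lambda>x. P x * u i x - \<kappa> * (\<rho> x * u i x))" for i
    by (intro C1_diff C1_mult C1_cmult C1_P rho u)
  have cont: "(\<Sum>i\<in>UNIV. \<rho> x * partial i (u i) x + u i x * partial i \<rho> x) = 0" for x
    using continuity[of x] unfolding partial_mult[OF rho u] by (simp add: add.commute mult.commute)
  have pw: "(\<Sum>i\<in>UNIV. partial i (\<lambda>x. P x * u i x - \<kappa> * (\<rho> x * u i x)) x) = (1 - \<gamma>) * (P x * divu x)" for x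
  proof -
    have "(\<Sum>i\<in>UNIV. partial i (\<lambda>x. P x * u i x - \<kappa> * (\<rho> x * u i x)) x)
       = (\<Sum>i\<in>UNIV. partial i P x * u i x) + P x * divu x - \<kappa> * (\<Sum>i\<in>UNIV. partial i (\<lambda>x. \<rho> x * u i x) x)"
      unfolding partial_diff[OF C1_mult[OF C1_P u] C1_cmult[OF C1_mult[OF rho u]]] partial_cmult[OF C1_mult[OF rho u]]
        partial_mult[OF C1_P u] by (simp add: sum.distrib sum_subtractf sum_distrib_left divu_def)
    also have "(\<Sum>i\<in>UNIV. partial i P x * u i x) = A * \<gamma> * \<rho> x powr (\<gamma> - 1) * (\<Sum>i\<in>UNIV. u i x * partial i \<rho> x)"
      unfolding partial_P by (simp add: sum_distrib_left mult_ac)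
    also have "(\<Sum>i\<in>UNIV. u i x * partial i \<rho> x) = - (\<rho> x * divu x)"
      using cont[of x] by (simp add: sum.distrib divu_def sum_distrib_left)
    also have "A * \<gamma> * \<rho> x powr (\<gamma> - 1) * (- (\<rho> x * divu x)) = - \<gamma> * (A * (\<rho> x * \<rho> x powr (\<gamma> - 1))) * divu x"
      by (simp add: mult_ac)
    also have "\<rho> x * \<rho> x powr (\<gamma> - 1) = \<rho> x powr \<gamma>"
      using powr_mult_base[of "\<rho> x" "\<gamma> - 1"] rho_nonneg[of x] by simp
    finally show ?thesis by (simp add: continuity P_def algebra_simps)
  qed
  have Z: "integrable lborel (\<lambda>x. f x * (\<Sum>i\<in>UNIV. u i x * partial i \<eta> x))" if f: "continuous_on UNIV f" for f
  proof -
    have "integrable lborel (\<lambda>x. \<Sum>i\<in>UNIV. f x * u i x * partial i \<eta> x)"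
      by (intro Bochner_Integration.integrable_sum integrable_csupp_mult continuous_on_mult f cont_u C1_partial_continuous \<eta> csupp_partial)
    then show ?thesis by (simp add: sum_distrib_left mult_ac)
  qed
  define X where "X = (LBINT x. (P x - \<kappa> * \<rho> x) * (\<Sum>i\<in>UNIV. u i x * partial i \<eta> x))"
  have 1: "(1 - \<gamma>) * (LBINT x. P x * divu x * \<eta> x) = - X"
  proof -
    have "(LBINT x. (1 - \<gamma>) * (P x * divu x) * \<eta> x) = - (LBINT x. (\<Sum>i\<in>UNIV. (P x * u i x - \<kappa> * (\<rho> x * u i x)) * partial i \<eta> x))"
      using weak_div[of "\<lambda>i x. P x * u i x - \<kappa> * (\<rho> x * u i x)", OF CF \<eta>] unfolding pw .
    also have "(\<lambda>x. \<Sum>i\<in>UNIV. (P x * u i x - \<kappa> * (\<rho> x * u i x)) * partial i \<eta> x) = (\<lambda>x. (P x - \<kappa> * \<rho> x) * (\<Sum>i\<in>UNIV. u i x * partial i \<eta> x))"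
      unfolding sum_distrib_left by (intro ext sum.cong refl) (simp add: algebra_simps)
    finally show ?thesis unfolding X_def mult.assoc[of "1 - \<gamma>"] by simp
  qed
  have "(LBINT x. \<rho> x * (\<Sum>i\<in>UNIV. u i x * partial i \<eta> x)) = 0"
    using weak_transport[OF C1_const[of 1] \<eta>] by simp
  then have 2: "(LBINT x. P x * (\<Sum>i\<in>UNIV. u i x * partial i \<eta> x)) = X"
    using Z[OF cont_P] Z[OF cont_rho] unfolding X_def left_diff_distrib mult.assoc
    by (subst Bochner_Integration.integral_diff) auto
  have "(LBINT x. P x * divu x * \<eta> x) = X / (\<gamma> - 1)" using 1 gamma by (simp add: field_simps)
  then show ?thesis using gamma unfolding 2 X_def[symmetric] by (simp add: field_simps)
qed

text \<open>The test field is the velocity times \<open>\<psi>\<close>, and \<open>\<Psi>\<close> is the primitive of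
  \<open>\<psi>\<close> as a function of |u|^2. The value 0 of the parameter means no truncation.\<close>

definition "\<psi> \<epsilon> x = 1 / (1 + \<epsilon> * usq x)\<^sup>2"
definition "\<Psi> \<epsilon> x = usq x / (1 + \<epsilon> * usq x)"

context
  fixes \<epsilon> :: real
  assumes eps: "\<epsilon> \<ge> 0"
begin

lemma den_ge: "1 + \<epsilon> * usq x \<ge> 1" using eps usq_nonneg by simp

lemma den_nonzero: "s \<in> range usq \<Longrightarrow> 1 + \<epsilon> * s \<noteq> 0"
  using den_ge by (metis imageE not_one_le_zero)

lemma C1_\<psi>: "C1 (\<psi> \<epsilon>)" and partial_\<psi>: "partial i (\<psi> \<epsilon>) x = - 2 * \<epsilon> / (1 + \<epsilon> * usq x) ^ 3 * partial i usq x"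
proof -
  have D: "((\<lambda>s. 1 / (1 + \<epsilon> * s)\<^sup>2) has_real_derivative (\<lambda>s. - 2 * \<epsilon> / (1 + \<epsilon> * s) ^ 3) (usq x)) (at (usq x))" for x
  proof -
    have z: "1 + \<epsilon> * usq x \<noteq> 0" using den_ge[of x] by linarith
    have "((\<lambda>z. 1 / z\<^sup>2) has_real_derivative - 2 / z ^ 3) (at z)" if "z \<noteq> 0" for z :: real
      using that by (auto intro!: derivative_eq_intros simp: power2_eq_square power3_eq_cube)
    moreover have "((\<lambda>s. 1 + \<epsilon> * s) has_real_derivative \<epsilon>) (at (usq x))"
      by (auto intro!: derivative_eq_intros)
    ultimately have "((\<lambda>s. 1 / (1 + \<epsilon> * s)\<^sup>2) has_real_derivative - 2 / (1 + \<epsilon> * usq x) ^ 3 * \<epsilon>) (at (usq x))"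
      using z by (intro DERIV_chain2[where f = "\<lambda>z. 1 / z\<^sup>2"])
    then show ?thesis by simp
  qed
  have c: "continuous_on (range usq) (\<lambda>s. - 2 * \<epsilon> / (1 + \<epsilon> * s) ^ 3)"
    by (intro continuous_intros) (use den_nonzero in auto)
  show "C1 (\<psi> \<epsilon>)" "partial i (\<psi> \<epsilon>) x = - 2 * \<epsilon> / (1 + \<epsilon> * usq x) ^ 3 * partial i usq x"
    unfolding \<psi>_def[abs_def] using C1_compose[OF C1_usq D c] partial_compose[OF C1_usq D c] by auto
qed

lemma C1_\<Psi>: "C1 (\<Psi> \<epsilon>)" and partial_\<Psi>: "partial i (\<Psi> \<epsilon>) x = \<psi> \<epsilon> x * partial i usq x"
proof -
  have D: "((\<lambda>s. s / (1 + \<epsilon> * s)) has_real_derivative (\<lambda>s. 1 / (1 + \<epsilon> * s)\<^sup>2) (usq x)) (at (usq x))" for x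
    using den_ge[of x] by (auto intro!: derivative_eq_intros simp: power2_eq_square field_simps)
  have c: "continuous_on (range usq) (\<lambda>s. 1 / (1 + \<epsilon> * s)\<^sup>2)"
    by (intro continuous_intros) (use den_nonzero in auto)
  show "C1 (\<Psi> \<epsilon>)" "partial i (\<Psi> \<epsilon>) x = \<psi> \<epsilon> x * partial i usq x"
    unfolding \<Psi>_def[abs_def] \<psi>_def using C1_compose[OF C1_usq D c] partial_compose[OF C1_usq D c] by auto
qed

lemma \<psi>_range: "0 \<le> \<psi> \<epsilon> x" "\<psi> \<epsilon> x \<le> 1"
  using den_ge[of x] by (auto simp: \<psi>_def)

lemma \<Psi>_nonneg: "0 \<le> \<Psi> \<epsilon> x" and eps_\<Psi>_le: "\<epsilon> * \<Psi> \<epsilon> x \<le> 1"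
  using den_ge[of x] usq_nonneg[of x] by (auto simp: \<Psi>_def divide_le_eq)

lemma partial_usq_le: "\<bar>partial i usq x\<bar> \<le> 2 * real CARD('n) * (sqrt (usq x) * sqrt (gsq x))"
proof -
  have "\<bar>partial i usq x\<bar> \<le> (\<Sum>j\<in>(UNIV::'n set). 2 * (sqrt (usq x) * sqrt (gsq x)))"
    unfolding partial_usq
  proof (rule order_trans[OF sum_abs sum_mono])
    fix j show "\<bar>2 * (u j x * partial i (u j) x)\<bar> \<le> 2 * (sqrt (usq x) * sqrt (gsq x))"
      unfolding abs_mult using mult_mono[OF abs_u_le[of j x] abs_du_le[of i j x]] usq_nonneg by simp
  qed
  then show ?thesis by simp
qed

text \<open>Of the three denominators one is kept, to form
  \<open>\<epsilon> * \<Psi> \<epsilon> x\<close>, which is at most 1 and tends to 0 with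
  \<open>\<epsilon>\<close> at each point. This factor makes the truncation error disappear in the
  end.\<close>

lemma u_partial_\<psi>_le: "\<bar>u k x * partial i (\<psi> \<epsilon>) x\<bar> \<le> 4 * real CARD('n) * (\<epsilon> * \<Psi> \<epsilon> x * sqrt (gsq x))"
proof -
  let ?D = "1 + \<epsilon> * usq x" and ?U = "sqrt (usq x)" and ?G = "sqrt (gsq x)"
  have D: "?D > 0" using den_ge[of x] by linarith
  have "\<bar>u k x * partial i (\<psi> \<epsilon>) x\<bar> = 2 * \<epsilon> / ?D ^ 3 * (\<bar>u k x\<bar> * \<bar>partial i usq x\<bar>)"
    unfolding partial_\<psi> using eps den_ge[of x] by (simp add: abs_mult)
  also have "\<dots> \<le> 2 * \<epsilon> / ?D ^ 3 * (?U * (2 * real CARD('n) * (?U * ?G)))"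
    using eps den_ge[of x] usq_nonneg by (intro mult_left_mono mult_mono abs_u_le partial_usq_le) auto
  also have "\<dots> = 2 * \<epsilon> / ?D ^ 3 * (2 * real CARD('n) * ((?U * ?U) * ?G))"
    by (simp only: mult_ac)
  also have "?U * ?U = usq x" using usq_nonneg[of x] by simp
  also have "2 * \<epsilon> / ?D ^ 3 * (2 * real CARD('n) * (usq x * ?G)) = 4 * real CARD('n) * (\<epsilon> * usq x * ?G) * (1 / ?D ^ 3)"
    by simp
  also have "\<dots> \<le> 4 * real CARD('n) * (\<epsilon> * usq x * ?G) * (1 / ?D)"
    using eps D usq_nonneg[of x] gsq_nonneg[of x] self_le_power[OF den_ge[of x], of 3]
    by (intro mult_left_mono divide_left_mono) (auto intro!: mult_pos_pos)
  finally show ?thesis by (simp add: \<Psi>_def)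
qed

text \<open>The momentum equation tested with \<open>u j x * \<eta> x\<close>. The constant
  \<open>\<kappa>\<close> is left free, to be matched later with the constant that is subtracted
  from the pressure.\<close>

lemma energy_identity:
  assumes \<phi>: "C1 \<phi>" "csupp \<phi>"
  defines "\<eta> \<equiv> \<lambda>x. \<psi> \<epsilon> x * \<phi> x"
  shows "(LBINT x. (\<mu> * gsq x + (\<mu> + lam) * (divu x)\<^sup>2) * \<eta> x)
    = (LBINT x. \<rho> x * \<Psi> \<epsilon> x * (\<Sum>i\<in>UNIV. u i x * partial i \<phi> x)) / 2
      + \<gamma> / (\<gamma> - 1) * (LBINT x. (P x - \<kappa> * \<rho> x) * (\<Sum>i\<in>UNIV. u i x * partial i \<eta> x))
      - \<mu> * (LBINT x. (\<Sum>j\<in>UNIV. \<Sum>i\<in>UNIV. partial i (u j) x * (u j x * partial i \<eta> x)))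
      - (\<mu> + lam) * (LBINT x. divu x * (\<Sum>i\<in>UNIV. u i x * partial i \<eta> x))"
proof -
  have \<eta>: "C1 \<eta>" "csupp \<eta>" unfolding \<eta>_def using \<phi> C1_\<psi> by auto
  let ?Z = "\<lambda>x. \<Sum>i\<in>UNIV. u i x * partial i \<eta> x"
  let ?W = "\<lambda>x. \<Sum>j\<in>UNIV. \<Sum>i\<in>UNIV. partial i (u j) x * (u j x * partial i \<eta> x)"
  have \<Phi>: "C1 (\<lambda>x. u j x * \<eta> x)" "csupp (\<lambda>x. u j x * \<eta> x)" for j using u \<eta> by auto
  note p\<Phi> = partial_mult[OF u \<eta>(1)]
  have I\<eta>: "integrable lborel (\<lambda>x. f x * \<eta> x)" if "continuous_on UNIV f" for f
    by (intro integrable_csupp_mult that C1_continuous \<eta>)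
  have IZ: "integrable lborel (\<lambda>x. f x * ?Z x)" if f: "continuous_on UNIV f" for f
  proof -
    have "integrable lborel (\<lambda>x. \<Sum>i\<in>UNIV. f x * u i x * partial i \<eta> x)"
      by (intro Bochner_Integration.integrable_sum integrable_csupp_mult continuous_on_mult f cont_u C1_partial_continuous \<eta> csupp_partial)
    then show ?thesis by (simp add: sum_distrib_left mult_ac)
  qed
  have IW: "integrable lborel ?W"
    unfolding mult.assoc[symmetric]
    by (intro Bochner_Integration.integrable_sum integrable_csupp_mult continuous_on_mult cont_u cont_du C1_partial_continuous \<eta> csupp_partial)
  have conv: "(LBINT x. (\<Sum>j\<in>UNIV. \<rho> x * (\<Sum>i\<in>UNIV. u i x * partial i (u j) x) * (u j x * \<eta> x)))
     = - (LBINT x. \<rho> x * \<Psi> \<epsilon> x * (\<Sum>i\<in>UNIV. u i x * partial i \<phi> x)) / 2"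
  proof -
    have eq: "(\<Sum>j\<in>UNIV. \<rho> x * (\<Sum>i\<in>UNIV. u i x * partial i (u j) x) * (u j x * \<eta> x))
      = \<rho> x * (\<Sum>i\<in>UNIV. u i x * partial i (\<Psi> \<epsilon>) x) * \<phi> x / 2" for x
    proof -
      have "(\<Sum>j\<in>UNIV. \<rho> x * (\<Sum>i\<in>UNIV. u i x * partial i (u j) x) * (u j x * \<eta> x))
        = (\<Sum>j\<in>UNIV. \<Sum>i\<in>UNIV. \<rho> x * u i x * \<eta> x * (u j x * partial i (u j) x))"
        by (simp add: sum_distrib_left sum_distrib_right mult_ac)
      also have "\<dots> = (\<Sum>i\<in>UNIV. \<Sum>j\<in>UNIV. \<rho> x * u i x * \<eta> x * (u j x * partial i (u j) x))" by (rule sum.swap)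
      \<comment> \<open>Since \<open>\<Psi>\<close> is a primitive, \<open>\<psi>\<close> times the
        derivative of \<open>usq\<close> is the derivative of \<open>\<Psi>\<close>; the factor 2
        from differentiating squares becomes the division by 2.\<close>
      also have "\<dots> = \<rho> x * (\<Sum>i\<in>UNIV. u i x * partial i (\<Psi> \<epsilon>) x) * \<phi> x / 2"
        unfolding partial_\<Psi> partial_usq by (simp add: sum_distrib_left sum_distrib_right sum_divide_distrib \<eta>_def mult_ac)
      finally show ?thesis .
    qed
    show ?thesis unfolding eq using weak_transport[OF C1_\<Psi> \<phi>] by simp
  qed
  have d1: "(\<Sum>j\<in>UNIV. partial j (\<lambda>x. u j x * \<eta> x) x) = divu x * \<eta> x + ?Z x" for x
    unfolding p\<Phi> by (simp add: sum.distrib divu_def sum_distrib_right)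
  have d2: "(\<Sum>j\<in>UNIV. \<Sum>i\<in>UNIV. partial i (u j) x * partial i (\<lambda>x. u j x * \<eta> x) x) = gsq x * \<eta> x + ?W x" for x
  proof -
    have "(\<Sum>j\<in>UNIV. \<Sum>i\<in>UNIV. partial i (u j) x * partial i (\<lambda>x. u j x * \<eta> x) x)
       = (\<Sum>j\<in>UNIV. \<Sum>i\<in>UNIV. (partial i (u j) x)\<^sup>2 * \<eta> x) + ?W x"
      unfolding p\<Phi> by (simp add: sum.distrib[symmetric] power2_eq_square algebra_simps)
    also have "(\<Sum>j\<in>UNIV. \<Sum>i\<in>UNIV. (partial i (u j) x)\<^sup>2 * \<eta> x) = gsq x * \<eta> x"
      unfolding gsq_def sum_distrib_right by (rule sum.swap)
    finally show ?thesis .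
  qed
  have e1: "(LBINT x. P x * (divu x * \<eta> x + ?Z x)) = (LBINT x. P x * divu x * \<eta> x) + (LBINT x. P x * ?Z x)"
    using I\<eta>[OF continuous_on_mult[OF cont_P cont_divu]] IZ[OF cont_P] by (simp add: distrib_left mult.assoc)
  have e2: "(LBINT x. divu x * (divu x * \<eta> x + ?Z x)) = (LBINT x. (divu x)\<^sup>2 * \<eta> x) + (LBINT x. divu x * ?Z x)"
    using I\<eta>[OF continuous_on_mult[OF cont_divu cont_divu]] IZ[OF cont_divu] by (simp add: distrib_left mult.assoc power2_eq_square)
  have e3: "(LBINT x. gsq x * \<eta> x + ?W x) = (LBINT x. gsq x * \<eta> x) + (LBINT x. ?W x)"
    using I\<eta>[OF cont_gsq] IW by simp
  have e4: "(LBINT x. (\<mu> * gsq x + (\<mu> + lam) * (divu x)\<^sup>2) * \<eta> x) = \<mu> * (LBINT x. gsq x * \<eta> x) + (\<mu> + lam) * (LBINT x. (divu x)\<^sup>2 * \<eta> x)"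
    using I\<eta>[OF cont_gsq] I\<eta>[OF continuous_on_power[OF cont_divu], of 2] by (simp only: distrib_right mult.assoc) simp
  show ?thesis
    using weak_momentum[of "\<lambda>j x. u j x * \<eta> x", OF \<Phi>] weak_pressure[OF \<eta>, of \<kappa>]
    unfolding conv d1 d2 e1 e2 e3 e4 by (simp only: distrib_left)
qed

end

end

section \<open>Square-integrable functions and the bound of the energy errors\<close>

definition L2 :: "(real^'n::finite \<Rightarrow> real) \<Rightarrow> bool" where
  "L2 f \<longleftrightarrow> f \<in> borel_measurable borel \<and> integrable lborel (\<lambda>x. (f x)\<^sup>2)"

lemma L2_mult:
  assumes "L2 f" "L2 g"
  shows "integrable lborel (\<lambda>x. f x * g x)" "(LBINT x. \<bar>f x * g x\<bar>) \<le> L2norm f * L2norm g"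
  using assms integrable_mult_L2[of f lborel g] Cauchy_Schwarz_L2[of f lborel g] by (auto simp: L2_def L2norm_def)

lemma L2_mono:
  assumes "L2 g" "f \<in> borel_measurable borel" "\<And>x. \<bar>f x\<bar> \<le> \<bar>g x\<bar>"
  shows "L2 f" "L2norm f \<le> L2norm g"
proof -
  have le: "(f x)\<^sup>2 \<le> (g x)\<^sup>2" for x using assms(3) by (simp add: abs_le_square_iff)
  have I: "integrable lborel (\<lambda>x. (f x)\<^sup>2)"
    by (rule Bochner_Integration.integrable_bound[of lborel "\<lambda>x. (g x)\<^sup>2"]) (use assms le in \<open>auto simp: L2_def\<close>)
  then show "L2 f" using assms by (simp add: L2_def)
  show "L2norm f \<le> L2norm g" unfolding L2norm_def
    using I assms(1) le by (intro real_sqrt_le_mono integral_mono) (auto simp: L2_def)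
qed

lemma L2_cball:
  fixes f :: "real^'n::finite \<Rightarrow> real"
  shows "continuous_on UNIV f \<Longrightarrow> L2 (\<lambda>x. indicator (cball 0 R) x * f x)"
proof -
  assume f: "continuous_on UNIV f"
  have "(indicator (cball 0 R) x * f x)\<^sup>2 = indicator (cball 0 R) x * (f x)\<^sup>2" for x :: "real^'n"
    by (simp add: indicator_def)
  then show "L2 (\<lambda>x. indicator (cball 0 R) x * f x)"
    using integrable_cball[OF continuous_on_power[OF f, of 2], of R] borel_measurable_continuous_onI[OF f] unfolding L2_def by simp
qed

lemma L2_annulus:
  fixes f :: "real^'n::finite \<Rightarrow> real"
  shows "continuous_on UNIV f \<Longrightarrow> L2 (\<lambda>x. indicator (annulus R) x * f x)"
proof -
  assume f: "continuous_on UNIV f"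
  have "(indicator (annulus R) x * f x)\<^sup>2 = indicator (annulus R) x * (f x)\<^sup>2" for x :: "real^'n"
    by (simp add: indicator_def)
  then show "L2 (\<lambda>x. indicator (annulus R) x * f x)"
    using integrable_annulus[OF continuous_on_power[OF f, of 2], of R] borel_measurable_continuous_onI[OF f] unfolding L2_def by simp
qed

text \<open>A non-integrable \<open>f\<close> has integral 0 by convention, and \<open>Y\<close> is
  nonnegative, so the inequality survives. In applications only the majorant is checked for
  integrability.\<close>

lemma abs_integral_le:
  fixes f Y :: "'a \<Rightarrow> real"
  assumes "integrable M Y" "\<And>x. \<bar>f x\<bar> \<le> Y x"
  shows "\<bar>\<integral>x. f x \<partial>M\<bar> \<le> (\<integral>x. Y x \<partial>M)"
proof (cases "integrable M f")
  case True
  have "\<bar>\<integral>x. f x \<partial>M\<bar> \<le> (\<integral>x. \<bar>f x\<bar> \<partial>M)" by (rule integral_abs_bound)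
  also have "\<dots> \<le> (\<integral>x. Y x \<partial>M)" using True assms by (intro integral_mono) auto
  finally show ?thesis .
next
  case False
  have "0 \<le> Y x" for x using assms(2)[of x] by linarith
  then show ?thesis using False by (simp add: not_integrable_integral_eq)
qed

lemma cutoff_le_indicator: "R > 0 \<Longrightarrow> cutoff R x \<le> indicator (cball 0 (2 * R)) x"
  using cutoff_range[of R x] cutoff_eq_0[of R x] by (cases "norm x \<le> 2 * R") auto

context flow
begin

abbreviation "U x \<equiv> sqrt (usq x)"
abbreviation "G x \<equiv> sqrt (gsq x)"

lemma card_ge_1: "real CARD('n) \<ge> 1"
  using zero_less_card_finite[where 'a='n] by linarith

lemma cont_U: "continuous_on S U" by (intro continuous_on_real_sqrt cont_usq)
lemma cont_G: "continuous_on S G" by (intro continuous_on_real_sqrt cont_gsq)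

lemma L2_G: "L2 G"
  unfolding L2_def using grad_L2 gsq_nonneg cont_G by (auto simp: gsq_def[symmetric] intro: borel_measurable_continuous_onI)

text \<open>Here \<open>c0\<close> is the density whose pressure is \<open>c\<close>, and
  \<open>\<kappa> = A * c0 powr (\<gamma> - 1)\<close> makes
  \<open>P x - \<kappa> * \<rho> x\<close> vanish where the density equals \<open>c0\<close>. Thus
  the oscillation of the pressure controls the pressure flux.\<close>

lemma kappa_exists:
  assumes "c \<ge> 0" obtains \<kappa> where "\<And>x. \<bar>P x - \<kappa> * \<rho> x\<bar> \<le> \<bar>P x - c\<bar>"
proof -
  define c0 where "c0 = (c / A) powr (1 / \<gamma>)"
  have c0: "c0 \<ge> 0" "c0 powr \<gamma> = c / A" using assms A_pos gamma by (auto simp: c0_def powr_powr)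
  have "\<bar>P x - A * c0 powr (\<gamma> - 1) * \<rho> x\<bar> \<le> \<bar>P x - c\<bar>" for x
  proof -
    have "P x - A * c0 powr (\<gamma> - 1) * \<rho> x = A * (\<rho> x powr \<gamma> - c0 powr (\<gamma> - 1) * \<rho> x)" by (simp add: P_def algebra_simps)
    moreover have "P x - c = A * (\<rho> x powr \<gamma> - c0 powr \<gamma>)" using A_pos by (simp add: c0(2) P_def algebra_simps)
    ultimately show ?thesis
      using powr_tangent_le[OF rho_nonneg[of x] c0(1) gamma] A_pos by (simp add: abs_mult)
  qed
  then show thesis by (rule that)
qed

lemma cont_\<Psi>: "\<epsilon> \<ge> 0 \<Longrightarrow> continuous_on S (\<Psi> \<epsilon>)"
  by (rule C1_continuous[OF C1_\<Psi>])

lemma eps_Psi_G_le: "\<epsilon> \<ge> 0 \<Longrightarrow> \<bar>\<epsilon> * \<Psi> \<epsilon> x * G x\<bar> \<le> \<bar>G x\<bar>"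
  using mult_right_mono[OF eps_\<Psi>_le[of \<epsilon> x], of "G x"] \<Psi>_nonneg[of \<epsilon> x] gsq_nonneg[of x] by (simp add: abs_mult)

lemma L2_\<Psi>_G: "\<epsilon> \<ge> 0 \<Longrightarrow> L2 (\<lambda>x. \<epsilon> * \<Psi> \<epsilon> x * G x)"
  by (rule L2_mono(1)[OF L2_G])
     (auto intro!: borel_measurable_continuous_onI continuous_intros cont_\<Psi> cont_G eps_Psi_G_le simp del: real_sqrt_abs)

text \<open>\<open>S\<close> measures the kinetic term, \<open>T\<close> the oscillation of the
  pressure, \<open>W\<close> the velocity on the annulus and \<open>Q\<close> the error of the
  truncation. A derivative on the cut-off costs \<open>6 / R\<close> and brings \<open>W\<close>; a
  derivative on \<open>\<psi>\<close> brings \<open>Q\<close> and no power of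
  \<open>R\<close>.\<close>

lemma energy_bound:
  assumes eps: "\<epsilon> \<ge> 0" and R: "R > 0" and c: "c \<ge> 0"
  defines "S \<equiv> L2norm (\<lambda>x. indicator (cball 0 (2 * R)) x * \<Psi> \<epsilon> x)"
    and "T \<equiv> L2norm (\<lambda>x. indicator (cball 0 (2 * R)) x * \<bar>P x - c\<bar>)"
    and "Q \<equiv> L2norm (\<lambda>x. \<epsilon> * \<Psi> \<epsilon> x * G x)"
    and "W \<equiv> L2norm (\<lambda>x. indicator (annulus R) x * U x)"
  shows "(LBINT x. (\<mu> * gsq x + (\<mu> + lam) * (divu x)\<^sup>2) * (\<psi> \<epsilon> x * cutoff R x))
    \<le> ((M + \<gamma> / (\<gamma> - 1) + \<mu> + \<bar>\<mu> + lam\<bar>) * (real CARD('n))\<^sup>2) * (6 / R * ((S + T + L2norm G) * W) + 4 * real CARD('n) * ((T + L2norm G) * Q))"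
proof -
  obtain \<kappa> where \<kappa>: "\<And>x. \<bar>P x - \<kappa> * \<rho> x\<bar> \<le> \<bar>P x - c\<bar>" using kappa_exists[OF c] by blast
  let ?B = "indicator (cball (0::real^'n) (2 * R)) :: _ \<Rightarrow> real"
  let ?A = "indicator (annulus R) :: real^'n \<Rightarrow> real"
  let ?\<phi> = "cutoff R :: real^'n \<Rightarrow> real"
  let ?\<eta> = "\<lambda>x. \<psi> \<epsilon> x * ?\<phi> x"
  let ?h = "\<lambda>x. ?A x * U x" and ?k = "\<lambda>x. \<epsilon> * \<Psi> \<epsilon> x * G x" and ?f1 = "\<lambda>x. ?B x * \<Psi> \<epsilon> x" and ?f2 = "\<lambda>x. ?B x * \<bar>P x - c\<bar>"
  \<comment> \<open>One majorant for the integrands of all four error terms, so that Cauchy-Schwarz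
    is applied once, to its five products.\<close>
  define Y where "Y x = 6 / R * (?f1 x * ?h x + ?f2 x * ?h x + G x * ?h x) + 4 * real CARD('n) * (?f2 x * ?k x + G x * ?k x)" for x
  have L: "L2 ?h" "L2 ?k" "L2 ?f1" "L2 ?f2"
    by (intro L2_annulus L2_cball L2_\<Psi>_G eps cont_U cont_\<Psi> continuous_intros cont_P)+
  note I = L2_mult(1)[OF L(3,1)] L2_mult(1)[OF L(4,1)] L2_mult(1)[OF L2_G L(1)] L2_mult(1)[OF L(4,2)] L2_mult(1)[OF L2_G L(2)]
  have nn: "0 \<le> ?h x" "0 \<le> ?k x" "0 \<le> ?f1 x" "0 \<le> ?f2 x" "0 \<le> G x" "0 \<le> U x" "0 \<le> \<Psi> \<epsilon> x" for x
    using usq_nonneg[of x] gsq_nonneg[of x] \<Psi>_nonneg[OF eps, of x] eps by auto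
  have IY: "integrable lborel Y" unfolding Y_def using I by auto
  have Iab: "(LBINT x. f x * g x) \<le> L2norm f * L2norm g" if "L2 f" "L2 g" for f g :: "real^'n \<Rightarrow> real"
  proof -
    have "(LBINT x. f x * g x) \<le> \<bar>LBINT x. f x * g x\<bar>" by simp
    also have "\<dots> \<le> (LBINT x. \<bar>f x * g x\<bar>)" by (rule integral_abs_bound)
    finally show ?thesis using L2_mult(2)[OF that] by linarith
  qed
  have Yle: "(LBINT x. Y x) \<le> 6 / R * ((S + T + L2norm G) * W) + 4 * real CARD('n) * ((T + L2norm G) * Q)"
  proof -
    have "(LBINT x. Y x) = 6 / R * ((LBINT x. ?f1 x * ?h x) + (LBINT x. ?f2 x * ?h x) + (LBINT x. G x * ?h x))
       + 4 * real CARD('n) * ((LBINT x. ?f2 x * ?k x) + (LBINT x. G x * ?k x))"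
      unfolding Y_def using I
      by (subst Bochner_Integration.integral_add, simp, simp, subst integral_mult_right_zero, subst integral_mult_right_zero,
         subst Bochner_Integration.integral_add, simp, simp, subst Bochner_Integration.integral_add, simp, simp,
         subst Bochner_Integration.integral_add, simp, simp) (rule refl)
    also have "\<dots> \<le> 6 / R * (S * W + T * W + L2norm G * W) + 4 * real CARD('n) * (T * Q + L2norm G * Q)"
      unfolding S_def T_def W_def Q_def using R
      by (intro add_mono mult_left_mono Iab L L2_G) auto
    finally show ?thesis by (simp add: distrib_right)
  qed
  \<comment> \<open>Product rule for the weight: the derivative of \<open>\<psi>\<close> contributes
    on the ball, the derivative of the cut-off on the annulus.\<close>
  have Z: "\<bar>u k x * partial i ?\<eta> x\<bar> \<le> 4 * real CARD('n) * (?B x * ?k x) + 6 / R * ?h x" for k i x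
  proof -
    have "u k x * partial i ?\<eta> x = (u k x * partial i (\<psi> \<epsilon>) x) * ?\<phi> x + u k x * \<psi> \<epsilon> x * partial i ?\<phi> x"
      unfolding partial_mult[OF C1_\<psi>[OF eps] C1_cutoff] by (simp add: algebra_simps)
    also have "\<bar>\<dots>\<bar> \<le> \<bar>(u k x * partial i (\<psi> \<epsilon>) x) * ?\<phi> x\<bar> + \<bar>u k x * \<psi> \<epsilon> x * partial i ?\<phi> x\<bar>" by (rule abs_triangle_ineq)
    also have "\<dots> \<le> (4 * real CARD('n) * ?k x) * ?B x + U x * 1 * (6 / R * ?A x)"
      unfolding abs_mult[of "u k x * partial i (\<psi> \<epsilon>) x"] abs_mult[of "u k x * \<psi> \<epsilon> x"] abs_mult[of "u k x" "\<psi> \<epsilon> x"]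
      using cutoff_range[of R x] cutoff_le_indicator[OF R, of x] \<psi>_range[OF eps, of x] nn(2,6)[of x] R
      by (intro add_mono mult_mono u_partial_\<psi>_le[OF eps] abs_u_le partial_cutoff R) auto
    finally show ?thesis by (simp add: mult_ac)
  qed
  have SZ: "\<bar>\<Sum>i\<in>UNIV. u i x * partial i ?\<eta> x\<bar> \<le> real CARD('n) * (4 * real CARD('n) * (?B x * ?k x) + 6 / R * ?h x)" for x
  proof -
    have "\<bar>\<Sum>i\<in>UNIV. u i x * partial i ?\<eta> x\<bar> \<le> (\<Sum>i\<in>(UNIV::'n set). 4 * real CARD('n) * (?B x * ?k x) + 6 / R * ?h x)"
      by (intro order_trans[OF sum_abs] sum_mono Z)
    then show ?thesis by simp
  qed
  \<comment> \<open>On the annulus the ball indicator is 1, so it may be inserted next to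
    \<open>?h\<close> to recreate \<open>?f1\<close> and \<open>?f2\<close>.\<close>
  have AB: "?A x \<le> ?B x" "?h x = ?B x * ?h x" for x by (auto simp: indicator_def annulus_def)
  have dd: "real CARD('n) \<le> (real CARD('n))\<^sup>2" "0 < (real CARD('n))\<^sup>2" using card_ge_1 self_le_power[of "real CARD('n)" 2] by auto
  have r6: "0 \<le> 6 / R" and d4: "0 \<le> 4 * real CARD('n)" using R by auto
  have two: "0 \<le> 6 / R * (?f1 x * ?h x)" "0 \<le> 6 / R * (?f2 x * ?h x)" "0 \<le> 6 / R * (G x * ?h x)"
      "0 \<le> 4 * real CARD('n) * (?f2 x * ?k x)" "0 \<le> 4 * real CARD('n) * (G x * ?k x)" for x
      by (rule mult_nonneg_nonneg[OF r6 mult_nonneg_nonneg[OF nn(3) nn(1)]] mult_nonneg_nonneg[OF r6 mult_nonneg_nonneg[OF nn(4) nn(1)]]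
         mult_nonneg_nonneg[OF r6 mult_nonneg_nonneg[OF nn(5) nn(1)]] mult_nonneg_nonneg[OF d4 mult_nonneg_nonneg[OF nn(4) nn(2)]]
         mult_nonneg_nonneg[OF d4 mult_nonneg_nonneg[OF nn(5) nn(2)]])+
  have FZ: "f * (4 * real CARD('n) * (?B x * ?k x) + 6 / R * ?h x) \<le> Y x" if "f = \<bar>P x - c\<bar> \<or> f = G x" for f x
  proof -
    have "?B x * ?k x * G x \<le> ?k x * G x" using nn[of x] by (intro mult_right_mono mult_left_le_one_le) auto
    then have 1: "4 * real CARD('n) * (?B x * ?k x * G x) \<le> 4 * real CARD('n) * (?k x * G x)" by (intro mult_left_mono) auto
    from that show ?thesis
    proof
      assume f: "f = \<bar>P x - c\<bar>"
      have "f * (4 * real CARD('n) * (?B x * ?k x) + 6 / R * ?h x) = 4 * real CARD('n) * (?f2 x * ?k x) + 6 / R * (?f2 x * ?h x)"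
        unfolding f by (subst AB(2)) (simp add: algebra_simps)
      then show ?thesis using two[of x] unfolding Y_def distrib_left by linarith
    next
      assume f: "f = G x"
      have "f * (4 * real CARD('n) * (?B x * ?k x) + 6 / R * ?h x) = 4 * real CARD('n) * (?B x * ?k x * G x) + 6 / R * (G x * ?h x)"
        unfolding f by (simp add: algebra_simps)
      also have "\<dots> \<le> 4 * real CARD('n) * (G x * ?k x) + 6 / R * (G x * ?h x)" using 1 by (simp add: mult.commute[of "G x" "?k x"])
      finally show ?thesis using two[of x] unfolding Y_def distrib_left by linarith
    qed
  qed
  have Ynn: "0 \<le> Y x" for x using FZ[of "G x" x] R nn[of x] eps by (intro order_trans[OF _ FZ[of "G x" x]] mult_nonneg_nonneg add_nonneg_nonneg) auto
  have B1: "\<bar>LBINT x. \<rho> x * \<Psi> \<epsilon> x * (\<Sum>i\<in>UNIV. u i x * partial i ?\<phi> x)\<bar> \<le> (LBINT x. M * (real CARD('n))\<^sup>2 * Y x)"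
  proof (rule abs_integral_le)
    fix x
    have "\<bar>\<Sum>i\<in>UNIV. u i x * partial i ?\<phi> x\<bar> \<le> (\<Sum>i\<in>(UNIV::'n set). U x * (6 / R * ?A x))"
      by (rule order_trans[OF sum_abs sum_mono]) (unfold abs_mult, intro mult_mono abs_u_le partial_cutoff R, use nn in auto)
    then have s: "\<bar>\<Sum>i\<in>UNIV. u i x * partial i ?\<phi> x\<bar> \<le> real CARD('n) * (6 / R * ?h x)" by (simp add: mult_ac)
    have "\<bar>\<rho> x * \<Psi> \<epsilon> x * (\<Sum>i\<in>UNIV. u i x * partial i ?\<phi> x)\<bar> \<le> M * \<Psi> \<epsilon> x * (real CARD('n) * (6 / R * ?h x))"
      unfolding abs_mult using s rho_nonneg[of x] rho_le[of x] nn[of x] M_nonneg by (intro mult_mono) auto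
    also have "\<dots> = M * real CARD('n) * (6 / R * (?f1 x * ?h x))" by (subst AB(2)) (simp add: mult_ac)
    also have "\<dots> \<le> M * real CARD('n) * Y x"
    proof -
      have "6 / R * (?f1 x * ?h x) \<le> Y x" using two[of x] unfolding Y_def distrib_left by linarith
      then show ?thesis using M_nonneg by (intro mult_left_mono) auto
    qed
    also have "\<dots> \<le> M * (real CARD('n))\<^sup>2 * Y x" using M_nonneg dd Ynn[of x] by (intro mult_right_mono mult_left_mono) auto
    finally show "\<bar>\<rho> x * \<Psi> \<epsilon> x * (\<Sum>i\<in>UNIV. u i x * partial i ?\<phi> x)\<bar> \<le> M * (real CARD('n))\<^sup>2 * Y x" .
  qed (use IY in simp)
  have B2: "\<bar>LBINT x. (P x - \<kappa> * \<rho> x) * (\<Sum>i\<in>UNIV. u i x * partial i ?\<eta> x)\<bar> \<le> (LBINT x. (real CARD('n))\<^sup>2 * Y x)"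
  proof (rule abs_integral_le)
    fix x
    have "\<bar>(P x - \<kappa> * \<rho> x) * (\<Sum>i\<in>UNIV. u i x * partial i ?\<eta> x)\<bar> \<le> \<bar>P x - c\<bar> * (real CARD('n) * (4 * real CARD('n) * (?B x * ?k x) + 6 / R * ?h x))"
      unfolding abs_mult by (intro mult_mono \<kappa> SZ) auto
    also have "\<dots> = real CARD('n) * (\<bar>P x - c\<bar> * (4 * real CARD('n) * (?B x * ?k x) + 6 / R * ?h x))" by simp
    also have "\<dots> \<le> (real CARD('n))\<^sup>2 * Y x" using dd Ynn[of x] FZ[of "\<bar>P x - c\<bar>" x]
      by (intro order_trans[OF mult_left_mono[OF FZ] mult_right_mono]) auto
    finally show "\<bar>(P x - \<kappa> * \<rho> x) * (\<Sum>i\<in>UNIV. u i x * partial i ?\<eta> x)\<bar> \<le> (real CARD('n))\<^sup>2 * Y x" .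
  qed (use IY in simp)
  have B3: "\<bar>LBINT x. (\<Sum>j\<in>UNIV. \<Sum>i\<in>UNIV. partial i (u j) x * (u j x * partial i ?\<eta> x))\<bar> \<le> (LBINT x. (real CARD('n))\<^sup>2 * Y x)"
  proof (rule abs_integral_le)
    fix x
    have "\<bar>\<Sum>j\<in>UNIV. \<Sum>i\<in>UNIV. partial i (u j) x * (u j x * partial i ?\<eta> x)\<bar> \<le> (\<Sum>j\<in>(UNIV::'n set). \<Sum>i\<in>(UNIV::'n set). Y x)"
    proof (intro order_trans[OF sum_abs] sum_mono)
      fix i j
      have "\<bar>partial i (u j) x * (u j x * partial i ?\<eta> x)\<bar> \<le> G x * (4 * real CARD('n) * (?B x * ?k x) + 6 / R * ?h x)"
        unfolding abs_mult[of "partial i (u j) x"] using nn[of x] by (intro mult_mono abs_du_le Z) auto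
      then show "\<bar>partial i (u j) x * (u j x * partial i ?\<eta> x)\<bar> \<le> Y x" using FZ[of "G x" x] by linarith
    qed
    then show "\<bar>\<Sum>j\<in>UNIV. \<Sum>i\<in>UNIV. partial i (u j) x * (u j x * partial i ?\<eta> x)\<bar> \<le> (real CARD('n))\<^sup>2 * Y x" by (simp add: power2_eq_square)
  qed (use IY in simp)
  have B4: "\<bar>LBINT x. divu x * (\<Sum>i\<in>UNIV. u i x * partial i ?\<eta> x)\<bar> \<le> (LBINT x. (real CARD('n))\<^sup>2 * Y x)"
  proof (rule abs_integral_le)
    fix x
    have "\<bar>divu x * (\<Sum>i\<in>UNIV. u i x * partial i ?\<eta> x)\<bar> \<le> (real CARD('n) * G x) * (real CARD('n) * (4 * real CARD('n) * (?B x * ?k x) + 6 / R * ?h x))"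
      unfolding abs_mult using nn[of x] by (intro mult_mono abs_divu_le SZ) auto
    also have "\<dots> = (real CARD('n))\<^sup>2 * (G x * (4 * real CARD('n) * (?B x * ?k x) + 6 / R * ?h x))" by (simp add: power2_eq_square)
    also have "\<dots> \<le> (real CARD('n))\<^sup>2 * Y x" by (intro mult_left_mono FZ) auto
    finally show "\<bar>divu x * (\<Sum>i\<in>UNIV. u i x * partial i ?\<eta> x)\<bar> \<le> (real CARD('n))\<^sup>2 * Y x" .
  qed (use IY in simp)
  define y where "y = (real CARD('n))\<^sup>2 * (LBINT x. Y x)"
  have y: "y \<ge> 0" unfolding y_def using Ynn by simp
  have gam: "\<gamma> / (\<gamma> - 1) \<ge> 0" using gamma by simp
  have ml: "a * b \<le> \<bar>a\<bar> * y" "- (a * b) \<le> \<bar>a\<bar> * y" if "\<bar>b\<bar> \<le> y" for a b :: real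
  proof -
    have "\<bar>a * b\<bar> \<le> \<bar>a\<bar> * y" unfolding abs_mult using that by (intro mult_left_mono) auto
    then show "a * b \<le> \<bar>a\<bar> * y" "- (a * b) \<le> \<bar>a\<bar> * y" by linarith+
  qed
  have B: "\<bar>LBINT x. \<rho> x * \<Psi> \<epsilon> x * (\<Sum>i\<in>UNIV. u i x * partial i ?\<phi> x)\<bar> \<le> M * y"
    "\<bar>LBINT x. (P x - \<kappa> * \<rho> x) * (\<Sum>i\<in>UNIV. u i x * partial i ?\<eta> x)\<bar> \<le> y"
    "\<bar>LBINT x. (\<Sum>j\<in>UNIV. \<Sum>i\<in>UNIV. partial i (u j) x * (u j x * partial i ?\<eta> x))\<bar> \<le> y"
    "\<bar>LBINT x. divu x * (\<Sum>i\<in>UNIV. u i x * partial i ?\<eta> x)\<bar> \<le> y"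
    using B1 B2 B3 B4 by (simp_all add: y_def mult.assoc)
  have My: "M * y \<ge> 0" using M_nonneg y by simp
  have "(LBINT x. (\<mu> * gsq x + (\<mu> + lam) * (divu x)\<^sup>2) * ?\<eta> x) \<le> M * y + \<gamma> / (\<gamma> - 1) * y + \<mu> * y + \<bar>\<mu> + lam\<bar> * y"
    unfolding energy_identity[OF eps C1_cutoff csupp_cutoff[OF R], of \<kappa>]
    using B(1) My ml(1)[OF B(2), of "\<gamma> / (\<gamma> - 1)"] ml(2)[OF B(3), of \<mu>] ml(2)[OF B(4), of "\<mu> + lam"] gam mu_pos
    by (simp only: abs_of_nonneg abs_of_pos)
  also have "\<dots> = ((M + \<gamma> / (\<gamma> - 1) + \<mu> + \<bar>\<mu> + lam\<bar>) * (real CARD('n))\<^sup>2) * (LBINT x. Y x)" by (simp add: y_def algebra_simps)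
  also have "\<dots> \<le> ((M + \<gamma> / (\<gamma> - 1) + \<mu> + \<bar>\<mu> + lam\<bar>) * (real CARD('n))\<^sup>2) * (6 / R * ((S + T + L2norm G) * W) + 4 * real CARD('n) * ((T + L2norm G) * Q))"
    using M_nonneg gam mu_pos by (intro mult_left_mono Yle mult_nonneg_nonneg) auto
  finally show ?thesis .
qed

end

section \<open>The limit of infinite radius and coercivity of the energy\<close>

lemma continuous_nonneg_integral_0:
  fixes f :: "real^'n::finite \<Rightarrow> real"
  assumes f: "continuous_on UNIV f" "\<And>x. 0 \<le> f x" "integrable lborel f" "(LBINT x. f x) \<le> 0"
  shows "f x = 0"
proof (rule ccontr)
  assume "f x \<noteq> 0"
  have "(LBINT x. f x) = 0" using f by (intro antisym) auto
  then have "AE x in lborel. f x = 0" using f by (simp add: integral_nonneg_eq_0_iff_AE)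
  \<comment> \<open>A nonempty open set is not negligible, which upgrades the almost everywhere
    statement to every point.\<close>
  moreover have o: "open {x. f x \<noteq> 0}" using f(1) by (intro open_Collect_neq) (auto intro: continuous_intros)
  ultimately have "{x. f x \<noteq> 0} \<in> null_sets lborel"
    using AE_iff_null_sets[of "{x. f x \<noteq> 0}" lborel] by (simp add: borel_open)
  then have "negligible {x. f x \<noteq> 0}" by (simp add: negligible_iff_null_sets null_sets_completionI)
  with o show False using open_not_negligible \<open>f x \<noteq> 0\<close> by blast
qed

lemma integral_cutoff_tendsto:
  fixes f :: "real^'n::finite \<Rightarrow> real"
  assumes f: "integrable lborel f"
  shows "(\<lambda>n. LBINT x. f x * cutoff (real (Suc n)) x) \<longlonglongrightarrow> (LBINT x. f x)"
proof (rule integral_dominated_convergence[where w = "\<lambda>x. \<bar>f x\<bar>"])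
  have [measurable]: "cutoff R \<in> borel_measurable borel" for R
    by (intro borel_measurable_continuous_onI C1_continuous C1_cutoff)
  show "(\<lambda>x. f x * cutoff (real (Suc n)) x) \<in> borel_measurable lborel" for n using f by measurable
  show "AE x in lborel. (\<lambda>n. f x * cutoff (real (Suc n)) x) \<longlonglongrightarrow> f x"
    using tendsto_mult_left[OF cutoff_tendsto] by (intro AE_I2) auto
  show "AE x in lborel. norm (f x * cutoff (real (Suc n)) x) \<le> \<bar>f x\<bar>" for n
    unfolding real_norm_def abs_mult abs_of_nonneg[OF cutoff_range(1)] by (intro AE_I2 mult_left_le cutoff_range) auto
qed (use f in auto)

context flow
begin

lemma gsq_integrable: "integrable lborel gsq"
  using grad_L2 unfolding gsq_def[abs_def] .

lemma divu_sq_le: "(divu x)\<^sup>2 \<le> (real CARD('n))\<^sup>2 * gsq x"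
  using power_mono[OF abs_divu_le[of x], of 2] gsq_nonneg[of x] by (simp add: power_mult_distrib)

lemma divu_sq_integrable: "integrable lborel (\<lambda>x. (divu x)\<^sup>2)"
  by (rule Bochner_Integration.integrable_bound[of lborel "\<lambda>x. (real CARD('n))\<^sup>2 * gsq x"])
     (use divu_sq_le gsq_integrable in \<open>auto intro!: borel_measurable_continuous_onI continuous_intros cont_divu intro: order_trans[OF divu_sq_le abs_ge_self]\<close>)

text \<open>The exponent \<open>\<alpha>\<close> measures the growth of the local L2 norms. With a truncation
  the last error term survives the limit of large radii, so no growth is allowed there.\<close>

lemma energy_limit:
  assumes eps: "\<epsilon> \<ge> 0" and \<alpha>: "\<alpha> \<ge> 0" and C: "C \<ge> 0" and c: "\<And>n. c n \<ge> 0"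
    and T: "\<And>n. L2norm (\<lambda>x. indicator (cball 0 (2 * real (Suc n))) x * \<bar>P x - c n\<bar>) \<le> C * real (Suc n) powr \<alpha>"
    and S: "\<And>n. L2norm (\<lambda>x. indicator (cball 0 (2 * real (Suc n))) x * \<Psi> \<epsilon> x) \<le> C' * real (Suc n) powr \<alpha>"
    and W: "(\<lambda>n. real (Suc n) powr (\<alpha> - 1) * L2norm (\<lambda>x. indicator (annulus (real (Suc n))) x * U x)) \<longlonglongrightarrow> 0"
    and alt: "\<epsilon> = 0 \<or> \<alpha> = 0"
  shows "(LBINT x. (\<mu> * gsq x + (\<mu> + lam) * (divu x)\<^sup>2) * \<psi> \<epsilon> x)
    \<le> ((M + \<gamma> / (\<gamma> - 1) + \<mu> + \<bar>\<mu> + lam\<bar>) * (real CARD('n))\<^sup>2) * (4 * real CARD('n) * ((C + L2norm G) * L2norm (\<lambda>x. \<epsilon> * \<Psi> \<epsilon> x * G x)))"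
proof -
  let ?K = "(M + \<gamma> / (\<gamma> - 1) + \<mu> + \<bar>\<mu> + lam\<bar>) * (real CARD('n))\<^sup>2"
  let ?Q = "L2norm (\<lambda>x. \<epsilon> * \<Psi> \<epsilon> x * G x)"
  let ?F = "\<lambda>x. (\<mu> * gsq x + (\<mu> + lam) * (divu x)\<^sup>2) * \<psi> \<epsilon> x"
  let ?R = "\<lambda>n. real (Suc n)"
  let ?W = "\<lambda>n. L2norm (\<lambda>x. indicator (annulus (?R n)) x * U x)"
  have K: "?K \<ge> 0" using M_nonneg gamma mu_pos by (intro mult_nonneg_nonneg add_nonneg_nonneg) auto
  have IF: "integrable lborel ?F"
  proof (rule Bochner_Integration.integrable_bound)
    show "integrable lborel (\<lambda>x. \<mu> * gsq x + (\<mu> + lam) * (divu x)\<^sup>2)"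
      using gsq_integrable divu_sq_integrable by auto
    show "?F \<in> borel_measurable lborel"
      using eps by (simp, intro borel_measurable_continuous_onI continuous_intros cont_gsq cont_divu C1_continuous[OF C1_\<psi>])
    show "AE x in lborel. norm (?F x) \<le> norm (\<mu> * gsq x + (\<mu> + lam) * (divu x)\<^sup>2)"
      unfolding real_norm_def abs_mult abs_of_nonneg[OF \<psi>_range(1)[OF eps]] by (intro AE_I2 mult_left_le \<psi>_range[OF eps]) auto
  qed
  have lim: "(\<lambda>n. LBINT x. ?F x * cutoff (?R n) x) \<longlonglongrightarrow> (LBINT x. ?F x)"
    by (rule integral_cutoff_tendsto[OF IF])
  define B where "B n = ?K * (6 * ((C + C' + L2norm G) * (?R n powr (\<alpha> - 1) * ?W n)) + 4 * real CARD('n) * ((C + L2norm G) * ?Q))" for n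
  have "B \<longlonglongrightarrow> ?K * (6 * ((C + C' + L2norm G) * 0) + 4 * real CARD('n) * ((C + L2norm G) * ?Q))"
    unfolding B_def by (intro tendsto_intros W)
  then have B: "B \<longlonglongrightarrow> ?K * (4 * real CARD('n) * ((C + L2norm G) * ?Q))" by simp
  have le: "(LBINT x. ?F x * cutoff (?R n) x) \<le> B n" for n
  proof -
    let ?p = "?R n powr \<alpha>"
    have p: "?p \<ge> 1" using \<alpha> by (simp add: ge_one_powr_ge_zero)
    have pm: "?p * (1 / ?R n) = ?R n powr (\<alpha> - 1)" by (simp add: powr_diff)
    have nn: "?W n \<ge> 0" "?Q \<ge> 0" "L2norm G \<ge> 0" by (simp_all add: L2norm_nonneg)
    let ?S = "L2norm (\<lambda>x. indicator (cball 0 (2 * ?R n)) x * \<Psi> \<epsilon> x)"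
    let ?T = "L2norm (\<lambda>x. indicator (cball 0 (2 * ?R n)) x * \<bar>P x - c n\<bar>)"
    have "(LBINT x. ?F x * cutoff (?R n) x) \<le> ?K * (6 / ?R n * ((?S + ?T + L2norm G) * ?W n) + 4 * real CARD('n) * ((?T + L2norm G) * ?Q))"
      using energy_bound[OF eps _ c, of "?R n" n] by (simp add: mult.assoc)
    also have "\<dots> \<le> B n"
      unfolding B_def
    proof (intro mult_left_mono[OF _ K] add_mono)
      have "?S + ?T + L2norm G \<le> (C + C' + L2norm G) * ?p"
        using S[of n] T[of n] mult_left_mono[OF p nn(3)] by (simp add: algebra_simps)
      then have "6 / ?R n * ((?S + ?T + L2norm G) * ?W n) \<le> 6 / ?R n * ((C + C' + L2norm G) * ?p * ?W n)"
        using nn by (intro mult_left_mono mult_right_mono) auto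
      also have "\<dots> = 6 * ((C + C' + L2norm G) * ((?p * (1 / ?R n)) * ?W n))" by simp
      finally show "6 / ?R n * ((?S + ?T + L2norm G) * ?W n) \<le> 6 * ((C + C' + L2norm G) * (?R n powr (\<alpha> - 1) * ?W n))"
        unfolding pm .
      \<comment> \<open>Without truncation \<open>?Q\<close> is 0, so the growth of
        \<open>?T\<close> does not matter; with truncation \<open>\<alpha> = 0\<close> keeps
        \<open>?T\<close> bounded.\<close>
      show "4 * real CARD('n) * ((?T + L2norm G) * ?Q) \<le> 4 * real CARD('n) * ((C + L2norm G) * ?Q)"
        using alt
      proof
        assume "\<epsilon> = 0" then show ?thesis by (simp add: L2norm_def)
      next
        assume "\<alpha> = 0" then show ?thesis using T[of n] nn by (intro mult_left_mono mult_right_mono) auto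
      qed
    qed
    finally show ?thesis .
  qed
  show ?thesis by (rule LIMSEQ_le[OF lim B]) (use le in auto)
qed

text \<open>The null form, applied to the velocity, equates the integral of
  \<open>(divu x)\<^sup>2\<close> with that of the trace of the squared gradient, which the
  inequality of arithmetic and geometric means bounds by \<open>gsq\<close>. A negative
  \<open>\<mu> + lam\<close> calls for this.\<close>

lemma integral_divu_sq_le_aux:
  assumes W: "(\<lambda>n. 1 / real (Suc n) * L2norm (\<lambda>x. indicator (annulus (real (Suc n))) x * U x)) \<longlonglongrightarrow> 0"
  shows "(LBINT x. (divu x)\<^sup>2) \<le> (LBINT x. gsq x)"
proof -
  let ?R = "\<lambda>n. real (Suc n)"
  let ?W = "\<lambda>n. L2norm (\<lambda>x. indicator (annulus (?R n)) x * U x)"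
  have err: "(\<lambda>n. 1 / ?R n * (LBINT x. indicator (annulus (?R n)) x * \<bar>u i x * partial j (u k) x\<bar>)) \<longlonglongrightarrow> 0" for i j k
  proof (rule Lim_null_comparison)
    show "(\<lambda>n. L2norm G * (1 / ?R n * ?W n)) \<longlonglongrightarrow> 0"
      using tendsto_mult_left[OF W, of "L2norm G"] by simp
    have "\<bar>LBINT x. indicator (annulus (?R n)) x * \<bar>u i x * partial j (u k) x\<bar>\<bar> \<le> ?W n * L2norm G" for n
    proof -
      note L = L2_annulus[OF cont_U, of "?R n"]
      have "\<bar>LBINT x. indicator (annulus (?R n)) x * \<bar>u i x * partial j (u k) x\<bar>\<bar> \<le> (LBINT x. \<bar>indicator (annulus (?R n)) x * U x * G x\<bar>)"
      proof (rule abs_integral_le)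
        show "integrable lborel (\<lambda>x. \<bar>indicator (annulus (?R n)) x * U x * G x\<bar>)" by (intro integrable_abs L2_mult(1) L L2_G)
        fix x
        have "\<bar>u i x * partial j (u k) x\<bar> \<le> U x * G x" unfolding abs_mult using usq_nonneg by (intro mult_mono abs_u_le abs_du_le) auto
        moreover have "0 \<le> U x * G x" using usq_nonneg gsq_nonneg by simp
        ultimately show "\<bar>indicator (annulus (?R n)) x * \<bar>u i x * partial j (u k) x\<bar>\<bar> \<le> \<bar>indicator (annulus (?R n)) x * U x * G x\<bar>"
          by (simp add: indicator_def)
      qed
      then show ?thesis using L2_mult(2)[OF L L2_G] by linarith
    qed
    then show "\<forall>\<^sub>F n in sequentially. norm (1 / ?R n * (LBINT x. indicator (annulus (?R n)) x * \<bar>u i x * partial j (u k) x\<bar>)) \<le> L2norm G * (1 / ?R n * ?W n)"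
      by (intro always_eventually allI) (simp add: abs_mult divide_right_mono mult.commute)
  qed
  let ?N = "\<lambda>x. \<Sum>i\<in>UNIV. \<Sum>j\<in>UNIV. partial i (u j) x * partial j (u i) x"
  have Nle: "\<bar>?N x\<bar> \<le> gsq x" for x
  proof -
    have "\<bar>?N x\<bar> \<le> (\<Sum>i\<in>UNIV. \<Sum>j\<in>UNIV. ((partial i (u j) x)\<^sup>2 + (partial j (u i) x)\<^sup>2) / 2)"
    proof (intro order_trans[OF sum_abs] sum_mono)
      fix i j
      show "\<bar>partial i (u j) x * partial j (u i) x\<bar> \<le> ((partial i (u j) x)\<^sup>2 + (partial j (u i) x)\<^sup>2) / 2"
        using sum_squares_bound[of "\<bar>partial i (u j) x\<bar>" "\<bar>partial j (u i) x\<bar>"] by (simp add: abs_mult)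
    qed
    also have "\<dots> = (gsq x + (\<Sum>i\<in>UNIV. \<Sum>j\<in>UNIV. (partial j (u i) x)\<^sup>2)) / 2"
      by (simp add: gsq_def sum.distrib sum_divide_distrib[symmetric])
    also have "(\<Sum>i\<in>UNIV. \<Sum>j\<in>UNIV. (partial j (u i) x)\<^sup>2) = gsq x" unfolding gsq_def by (rule sum.swap)
    finally show ?thesis by simp
  qed
  have IN: "integrable lborel ?N"
    by (rule Bochner_Integration.integrable_bound[OF gsq_integrable])
       (use Nle in \<open>auto intro!: borel_measurable_continuous_onI continuous_on_sum continuous_on_mult cont_du intro: order_trans[OF Nle abs_ge_self]\<close>)
  have "(\<lambda>n. LBINT x. ((\<Sum>i\<in>UNIV. partial i (u i) x)\<^sup>2 - ?N x) * cutoff (?R n) x) \<longlonglongrightarrow> 0"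
    by (rule null_form_limit[OF u du err])
  moreover have "(\<lambda>n. LBINT x. ((divu x)\<^sup>2 - ?N x) * cutoff (?R n) x) \<longlonglongrightarrow> (LBINT x. (divu x)\<^sup>2 - ?N x)"
    by (intro integral_cutoff_tendsto Bochner_Integration.integrable_diff divu_sq_integrable IN)
  ultimately have "(LBINT x. (divu x)\<^sup>2 - ?N x) = 0" unfolding divu_def using LIMSEQ_unique by blast
  then have "(LBINT x. (divu x)\<^sup>2) = (LBINT x. ?N x)" using divu_sq_integrable IN by simp
  also have "\<dots> \<le> (LBINT x. gsq x)" using Nle by (intro integral_mono IN gsq_integrable) (auto simp: abs_le_iff)
  finally show ?thesis .
qed

text \<open>For \<open>\<mu> + lam \<ge> 0\<close> both terms are nonnegative. Otherwise the
  divergence term is replaced by its largest possible size, that of the full gradient; the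
  coefficient left is \<open>lam + 2 * \<mu>\<close>, and here that ellipticity condition
  acts.\<close>

lemma gsq_eq_0:
  assumes E: "(LBINT x. \<mu> * gsq x + (\<mu> + lam) * (divu x)\<^sup>2) \<le> 0"
    and D: "(LBINT x. (divu x)\<^sup>2) \<le> (LBINT x. gsq x)"
  shows "gsq x = 0"
proof -
  let ?g = "LBINT x. gsq x" and ?e = "LBINT x. (divu x)\<^sup>2"
  have nn: "?e \<ge> 0" by simp
  have E': "\<mu> * ?g + (\<mu> + lam) * ?e \<le> 0" using E gsq_integrable divu_sq_integrable by simp
  have "?g \<le> 0"
  proof (cases "\<mu> + lam \<ge> 0")
    case True
    then have "0 \<le> (\<mu> + lam) * ?e" by simp
    then have "\<mu> * ?g \<le> 0" using E' by linarith
    then show ?thesis using mu_pos by (simp add: mult_le_0_iff)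
  next
    case False
    then have "(\<mu> + lam) * ?g \<le> (\<mu> + lam) * ?e" using D by (intro mult_left_mono_neg) auto
    then have "(lam + 2 * \<mu>) * ?g \<le> 0" using E' by (simp add: algebra_simps)
    then show ?thesis using visc by (simp add: mult_le_0_iff)
  qed
  then show ?thesis by (intro continuous_nonneg_integral_0 cont_gsq gsq_nonneg gsq_integrable)
qed

end

section \<open>The pressure estimate\<close>

text \<open>On the annulus the field is of size \<open>R powr (- d)\<close>. Against the constant
  \<open>k\<close> this balances the volume, against the integrable \<open>h\<close> it is smaller
  still, and the derivative of the cut-off contributes the vanishing factor
  \<open>6 / R\<close>.\<close>

lemma (in newton_field) cutoff_err:
  assumes f: "continuous_on UNIV f" and fb: "\<And>x. \<bar>f x\<bar> \<le> k + h x" and k: "k \<ge> 0"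
    and h: "integrable lborel h" "\<And>x. 0 \<le> h x"
  shows "(\<lambda>n. LBINT x. f x * w j x * partial i (cutoff (real (Suc n))) x) \<longlonglongrightarrow> 0"
proof -
  let ?d = "real CARD('n)"
  let ?V = "unit_ball_vol ?d"
  define D where "D = ?d * (1 + ?d) * r * (LBINT y. \<bar>g y\<bar>)"
  have D: "D \<ge> 0" using r by (simp add: D_def)
  have V: "?V \<ge> 0" by (simp add: unit_ball_vol_def)
  have hI: "(LBINT x. h x) \<ge> 0" using h by simp
  define L where "L = D * 4 ^ CARD('n) * (k * ?V + (LBINT x. h x))"
  have b: "\<bar>LBINT x. f x * w j x * partial i (cutoff R) x\<bar> \<le> 6 / R * L" if R: "R \<ge> 2 * r" "R \<ge> 1" for R
  proof -
    have R0: "R > 0" using R by linarith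
    let ?t = "(R / 2) powr (- ?d)"
    have tR: "?t * (2 * R) ^ CARD('n) = 4 ^ CARD('n)"
    proof -
      have "2 * R = 4 * (R / 2)" by simp
      then have "(2 * R) ^ CARD('n) = 4 ^ CARD('n) * (R / 2) ^ CARD('n)" by (simp only: power_mult_distrib)
      then show ?thesis using R0 by (simp add: powr_minus powr_realpow)
    qed
    have t4: "?t \<le> 4 ^ CARD('n)"
    proof -
      have "?t * 1 \<le> ?t * (2 * R) ^ CARD('n)" using R by (intro mult_left_mono one_le_power) auto
      then show ?thesis using tR by simp
    qed
    have "(LBINT x. indicator (annulus R) x * \<bar>f x * w j x\<bar>) \<le> (LBINT x. D * ?t * (k * indicator (cball 0 (2 * R)) x + h x))"
    proof (rule integral_mono)
      show "integrable lborel (\<lambda>x. indicator (annulus R) x * \<bar>f x * w j x\<bar>)"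
        by (intro integrable_annulus continuous_intros f C1_continuous C1_w)
      show "integrable lborel (\<lambda>x. D * ?t * (k * indicator (cball 0 (2 * R)) x + h x))"
        using h(1) integrable_cball[of "\<lambda>_::real^'n. 1" "2 * R"] by simp
      fix x :: "real^'n"
      show "indicator (annulus R) x * \<bar>f x * w j x\<bar> \<le> D * ?t * (k * indicator (cball 0 (2 * R)) x + h x)"
      proof (cases "x \<in> annulus R")
        case True
        then have "norm x \<ge> 2 * r" using R by (simp add: annulus_def)
        then have "\<bar>w j x\<bar> \<le> D * (norm x / 2) powr (- ?d)" using w_decay[of x j] by (simp add: D_def mult_ac)
        also have "\<dots> \<le> D * ?t" using True D R0 by (intro mult_left_mono powr_mono2') (auto simp: annulus_def)
        finally have "\<bar>w j x\<bar> * \<bar>f x\<bar> \<le> D * ?t * (k + h x)" using fb D by (intro mult_mono) auto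
        then show ?thesis using True by (simp add: abs_mult mult.commute annulus_def)
      next
        case False then show ?thesis using D k h(2)[of x] by (simp add: indicator_def)
      qed
    qed
    also have "\<dots> = D * ?t * (k * (?V * (2 * R) ^ CARD('n)) + (LBINT x. h x))"
      using h(1) integrable_cball[of "\<lambda>_::real^'n. 1" "2 * R"] integral_indicator_cball[of "2 * R", where 'n = 'n] R0 by simp
    also have "\<dots> = D * (k * ?V * (?t * (2 * R) ^ CARD('n)) + ?t * (LBINT x. h x))" by (simp add: algebra_simps)
    also have "\<dots> \<le> D * (k * ?V * 4 ^ CARD('n) + 4 ^ CARD('n) * (LBINT x. h x))"
      unfolding tR using t4 hI D by (intro mult_left_mono add_mono mult_right_mono order_refl) auto
    also have "\<dots> = L" by (simp add: L_def algebra_simps)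
    finally have "(LBINT x. indicator (annulus R) x * \<bar>f x * w j x\<bar>) \<le> L" .
    then have "6 / R * (LBINT x. indicator (annulus R) x * \<bar>f x * w j x\<bar>) \<le> 6 / R * L" using R0 by (intro mult_left_mono) auto
    then show ?thesis
      using integral_partial_cutoff_le[OF continuous_on_mult[OF f C1_continuous[OF C1_w]] R0, of j i] by linarith
  qed
  show ?thesis
  proof (rule Lim_null_comparison)
    obtain N :: nat where N: "2 * r \<le> real N" using real_arch_simple by blast
    show "\<forall>\<^sub>F n in sequentially. norm (LBINT x. f x * w j x * partial i (cutoff (real (Suc n))) x) \<le> 6 * L * (1 / real (Suc n))"
      unfolding eventually_sequentially
    proof (intro exI[of _ N] allI impI)
      fix n assume "n \<ge> N"
      then have "2 * r \<le> real (Suc n)" using N by simp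
      then show "norm (LBINT x. f x * w j x * partial i (cutoff (real (Suc n))) x) \<le> 6 * L * (1 / real (Suc n))"
        using b[of "real (Suc n)"] by simp
    qed
    show "(\<lambda>n. 6 * L * (1 / real (Suc n))) \<longlonglongrightarrow> 0"
      using tendsto_mult_left[OF LIMSEQ_inverse_real_of_nat, of "6 * L"] by (simp add: inverse_eq_divide)
  qed
qed

lemma (in newton_field) L2_partial_w:
  shows "L2 (partial i (w j))" and "L2norm (partial i (w j)) \<le> newton_mass TYPE('n) * L2norm g"
    and "L2 (\<lambda>x. \<Sum>i\<in>UNIV. partial i (w i) x)" and "L2norm (\<lambda>x. \<Sum>i\<in>UNIV. partial i (w i) x) \<le> newton_mass TYPE('n) * L2norm g"
proof -
  let ?H = "\<lambda>x. \<Sum>i\<in>UNIV. \<Sum>j\<in>UNIV. (partial i (w j) x)\<^sup>2"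
  have le: "(partial i (w j) x)\<^sup>2 \<le> ?H x" for x
  proof -
    have "(partial i (w j) x)\<^sup>2 \<le> (\<Sum>j\<in>UNIV. (partial i (w j) x)\<^sup>2)" by (rule member_le_sum) auto
    also have "\<dots> \<le> ?H x" by (rule member_le_sum[of i UNIV "\<lambda>i. \<Sum>j\<in>UNIV. (partial i (w j) x)\<^sup>2"]) (auto intro: sum_nonneg)
    finally show ?thesis .
  qed
  have c: "continuous_on UNIV (partial i (w j))" for i j by (rule C1_continuous[OF C1_partial_w])
  have I: "integrable lborel (\<lambda>x. (partial i (w j) x)\<^sup>2)"
    by (rule Bochner_Integration.integrable_bound[OF grad_w_L2(1)])
       (use le in \<open>auto intro!: borel_measurable_continuous_onI continuous_on_power c intro: order_trans[OF le abs_ge_self]\<close>)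
  have om: "newton_mass TYPE('n) \<ge> 0" using newton_mass_pos less_imp_le by blast
  have sq: "sqrt ((newton_mass TYPE('n))\<^sup>2 * (LBINT x. (g x)\<^sup>2)) = newton_mass TYPE('n) * L2norm g"
    using om by (simp add: L2norm_def real_sqrt_mult)
  show "L2 (partial i (w j))" using I c by (auto simp: L2_def intro: borel_measurable_continuous_onI)
  have "(LBINT x. (partial i (w j) x)\<^sup>2) \<le> (LBINT x. ?H x)" by (intro integral_mono I grad_w_L2(1) le)
  then show "L2norm (partial i (w j)) \<le> newton_mass TYPE('n) * L2norm g"
    unfolding sq[symmetric] unfolding L2norm_def using grad_w_L2(2) by (intro real_sqrt_le_mono) linarith
  show "L2 (\<lambda>x. \<Sum>i\<in>UNIV. partial i (w i) x)"
    using div_w_L2(1) by (auto simp: L2_def intro!: borel_measurable_continuous_onI continuous_on_sum c)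
  show "L2norm (\<lambda>x. \<Sum>i\<in>UNIV. partial i (w i) x) \<le> newton_mass TYPE('n) * L2norm g"
    unfolding sq[symmetric] unfolding L2norm_def using div_w_L2(2) by (intro real_sqrt_le_mono)
qed

context flow
begin

lemma usq_le_Lq: "usq x \<le> 1 + usq x powr (q / 2)"
proof (cases "usq x \<le> 1")
  case True then show ?thesis using powr_ge_zero[of "usq x" "q / 2"] by linarith
next
  case False
  then have "usq x powr 1 \<le> usq x powr (q / 2)" using q by (intro powr_mono) auto
  then show ?thesis using False by simp
qed

lemma Lq_integrable: "integrable lborel (\<lambda>x. usq x powr (q / 2))"
  using Lq unfolding usq_def[abs_def] .

lemma G_le: "G x \<le> 1 + gsq x"
  using gsq_nonneg[of x] sum_squares_bound[of 1 "G x"] by simp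

text \<open>For the part \<open>a\<close> of the convected velocity the transport derivative is
  thrown onto the test field; for \<open>b\<close> it stays in place. The splitting is left abstract
  because low dimensions take \<open>b = 0\<close>. The velocity gradient and that of the test field
  meet by Cauchy-Schwarz, which gives the last term.\<close>

lemma pressure_test:
  assumes nf: "newton_field e r g"
    and ab: "\<And>j. C1 (a j)" "\<And>j. C1 (b j)" "\<And>j. u j = (\<lambda>x. a j x + b j x)" "\<And>j x. \<bar>a j x\<bar> \<le> U x"
    and I1: "\<And>i j. integrable lborel (\<lambda>x. u i x * a j x * partial i (conv (newton e j) g) x)"
    and I2: "\<And>i j. integrable lborel (\<lambda>x. u i x * partial i (b j) x * conv (newton e j) g x)"
  shows "(LBINT x. P x * conv (newton_div e) g x)
    \<le> M * (\<Sum>i\<in>UNIV. \<Sum>j\<in>UNIV. LBINT x. \<bar>u i x * a j x * partial i (conv (newton e j) g) x\<bar>)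
      + M * (\<Sum>i\<in>UNIV. \<Sum>j\<in>UNIV. LBINT x. \<bar>u i x * partial i (b j) x * conv (newton e j) g x\<bar>)
      + (\<mu> + \<bar>\<mu> + lam\<bar>) * (real CARD('n))\<^sup>2 * L2norm G * (newton_mass TYPE('n) * L2norm g)"
proof -
  interpret newton_field e r g by (rule nf)
  let ?\<zeta> = "\<lambda>n. cutoff (real (Suc n)) :: real^'n \<Rightarrow> real"
  let ?dw = "\<lambda>x. \<Sum>i\<in>UNIV. partial i (w i) x"
  let ?\<omega>g = "newton_mass TYPE('n) * L2norm g"
  have \<zeta>: "C1 (?\<zeta> n)" "csupp (?\<zeta> n)" for n by (auto simp: C1_cutoff csupp_cutoff)
  note cw = C1_continuous[OF C1_w] and cdw = C1_continuous[OF C1_partial_w] and ca = C1_continuous[OF ab(1)]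
    and cdb = C1_partial_continuous[OF ab(2)] and c\<zeta> = C1_continuous[OF \<zeta>(1)] and cd\<zeta> = C1_partial_continuous[OF \<zeta>(1)]
  have I\<zeta>: "integrable lborel (\<lambda>x. f x * ?\<zeta> n x)" "integrable lborel (\<lambda>x. f x * partial i (?\<zeta> n) x)"
     if "continuous_on UNIV f" for f n i
    by (intro integrable_csupp_mult that c\<zeta> cd\<zeta> \<zeta> csupp_partial)+
  have du_ab: "partial i (u j) x = partial i (a j) x + partial i (b j) x" for i j x
    unfolding ab(3)[of j] by (rule partial_add[OF ab(1,2)])
  \<comment> \<open>All terms in which a derivative falls on the cut-off; by
    \<open>cutoff_err\<close> each vanishes as the radius grows with \<open>e\<close> fixed.\<close>
  define E where "E n = - (\<Sum>j\<in>UNIV. \<Sum>i\<in>UNIV. LBINT x. \<rho> x * a j x * u i x * w j x * partial i (?\<zeta> n) x)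
      - (\<Sum>j\<in>UNIV. LBINT x. P x * w j x * partial j (?\<zeta> n) x)
      + \<mu> * (\<Sum>j\<in>UNIV. \<Sum>i\<in>UNIV. LBINT x. partial i (u j) x * w j x * partial i (?\<zeta> n) x)
      + (\<mu> + lam) * (\<Sum>j\<in>UNIV. LBINT x. divu x * w j x * partial j (?\<zeta> n) x)" for n
  have E0: "E \<longlonglongrightarrow> 0"
  proof -
    have 1: "(\<lambda>n. LBINT x. \<rho> x * a j x * u i x * w j x * partial i (?\<zeta> n) x) \<longlonglongrightarrow> 0" for i j
    \<comment> \<open>The convective flux is at most \<open>M * usq x\<close>, and
      \<open>usq_le_Lq\<close> splits this into a bounded and an integrable part, as
      \<open>cutoff_err\<close> wants.\<close>
    proof (rule cutoff_err[where k = M and h = "\<lambda>x. M * usq x powr (q / 2)"])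
      show "\<bar>\<rho> x * a j x * u i x\<bar> \<le> M + M * usq x powr (q / 2)" for x
      proof -
        have "\<bar>\<rho> x * a j x * u i x\<bar> \<le> M * U x * U x"
          unfolding abs_mult using rho_nonneg[of x] rho_le[of x] M_nonneg usq_nonneg[of x] by (intro mult_mono ab(4) abs_u_le) auto
        also have "\<dots> = M * usq x" using usq_nonneg[of x] by simp
        also have "\<dots> \<le> M * (1 + usq x powr (q / 2))" by (intro mult_left_mono usq_le_Lq M_nonneg)
        finally show ?thesis by (simp add: distrib_left)
      qed
    qed (use M_nonneg Lq_integrable in \<open>auto intro!: continuous_intros cont_rho ca cont_u\<close>)
    have 2: "(\<lambda>n. LBINT x. P x * w j x * partial j (?\<zeta> n) x) \<longlonglongrightarrow> 0" for j
      using P_nonneg P_le A_pos by (intro cutoff_err[where k = "A * M powr \<gamma>" and h = "\<lambda>x. 0"] cont_P) auto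
    have 3: "(\<lambda>n. LBINT x. partial i (u j) x * w j x * partial i (?\<zeta> n) x) \<longlonglongrightarrow> 0" for i j
      by (rule cutoff_err[OF cont_du _ _ gsq_integrable gsq_nonneg, where k = 1]) (use order_trans[OF abs_du_le G_le] in auto)
    have 4: "(\<lambda>n. LBINT x. divu x * w j x * partial j (?\<zeta> n) x) \<longlonglongrightarrow> 0" for j
    proof (rule cutoff_err[where k = "real CARD('n)" and h = "\<lambda>x. real CARD('n) * gsq x"])
      show "\<bar>divu x\<bar> \<le> real CARD('n) + real CARD('n) * gsq x" for x
        using abs_divu_le[of x] mult_left_mono[OF G_le[of x], of "real CARD('n)"] by (simp add: distrib_left)
    qed (use gsq_integrable gsq_nonneg cont_divu in auto)
    have "E \<longlonglongrightarrow> - (\<Sum>j\<in>(UNIV::'n set). \<Sum>i\<in>(UNIV::'n set). 0) - (\<Sum>j\<in>(UNIV::'n set). 0) + \<mu> * (\<Sum>j\<in>(UNIV::'n set). \<Sum>i\<in>(UNIV::'n set). 0) + (\<mu> + lam) * (\<Sum>j\<in>(UNIV::'n set). 0)"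
      unfolding E_def by (intro tendsto_intros 1 2 3 4)
    then show ?thesis by simp
  qed
  have main: "(LBINT x. P x * ?dw x * ?\<zeta> n x) =
      - (\<Sum>j\<in>UNIV. \<Sum>i\<in>UNIV. LBINT x. \<rho> x * a j x * u i x * partial i (w j) x * ?\<zeta> n x)
      + (\<Sum>j\<in>UNIV. \<Sum>i\<in>UNIV. LBINT x. \<rho> x * u i x * partial i (b j) x * w j x * ?\<zeta> n x)
      + \<mu> * (\<Sum>j\<in>UNIV. \<Sum>i\<in>UNIV. LBINT x. partial i (u j) x * partial i (w j) x * ?\<zeta> n x)
      + (\<mu> + lam) * (LBINT x. divu x * ?dw x * ?\<zeta> n x) + E n" for n
  proof -
    let ?\<Phi> = "\<lambda>j x. w j x * ?\<zeta> n x"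
    have \<Phi>: "C1 (?\<Phi> j)" "csupp (?\<Phi> j)" for j using C1_w \<zeta> by auto
    have p\<Phi>: "partial i (?\<Phi> j) x = partial i (w j) x * ?\<zeta> n x + w j x * partial i (?\<zeta> n) x" for i j x
      by (rule partial_mult[OF C1_w \<zeta>(1)])
    have cdws: "continuous_on UNIV ?dw" by (intro continuous_on_sum cdw)
    have Q: "(LBINT x. f x * partial i (?\<Phi> j) x) = (LBINT x. f x * partial i (w j) x * ?\<zeta> n x) + (LBINT x. f x * w j x * partial i (?\<zeta> n) x)"
       and QI: "integrable lborel (\<lambda>x. f x * partial i (?\<Phi> j) x)"
      if f: "continuous_on UNIV f" for f i j
    proof -
      have k: "continuous_on UNIV (\<lambda>x. f x * partial i (w j) x)" "continuous_on UNIV (\<lambda>x. f x * w j x)"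
        by (intro continuous_on_mult f cdw cw)+
      note I = I\<zeta>(1)[OF k(1), of n] I\<zeta>(2)[OF k(2), where n = n and i = i]
      have eq: "f x * partial i (?\<Phi> j) x = f x * partial i (w j) x * ?\<zeta> n x + f x * w j x * partial i (?\<zeta> n) x" for x
        unfolding p\<Phi> by (simp add: algebra_simps)
      show "integrable lborel (\<lambda>x. f x * partial i (?\<Phi> j) x)" unfolding eq using I by simp
      show "(LBINT x. f x * partial i (?\<Phi> j) x) = (LBINT x. f x * partial i (w j) x * ?\<zeta> n x) + (LBINT x. f x * w j x * partial i (?\<zeta> n) x)"
        unfolding eq using I by simp
    qed
    have D: "(LBINT x. f x * (\<Sum>j\<in>UNIV. partial j (?\<Phi> j) x)) = (LBINT x. f x * ?dw x * ?\<zeta> n x) + (\<Sum>j\<in>UNIV. LBINT x. f x * w j x * partial j (?\<zeta> n) x)"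
      if f: "continuous_on UNIV f" for f
    proof -
      have "(LBINT x. f x * (\<Sum>j\<in>UNIV. partial j (?\<Phi> j) x)) = (\<Sum>j\<in>UNIV. LBINT x. f x * partial j (?\<Phi> j) x)"
        unfolding sum_distrib_left using QI[OF f] by (rule Bochner_Integration.integral_sum)
      also have "\<dots> = (\<Sum>j\<in>UNIV. LBINT x. f x * partial j (w j) x * ?\<zeta> n x) + (\<Sum>j\<in>UNIV. LBINT x. f x * w j x * partial j (?\<zeta> n) x)"
        unfolding Q[OF f] by (rule sum.distrib)
      also have "(\<Sum>j\<in>UNIV. LBINT x. f x * partial j (w j) x * ?\<zeta> n x) = (LBINT x. (\<Sum>j\<in>UNIV. f x * partial j (w j) x * ?\<zeta> n x))"
        by (rule Bochner_Integration.integral_sum[symmetric]) (intro I\<zeta> continuous_on_mult f cdw)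
      also have "(\<lambda>x. \<Sum>j\<in>UNIV. f x * partial j (w j) x * ?\<zeta> n x) = (\<lambda>x. f x * ?dw x * ?\<zeta> n x)"
        by (simp add: sum_distrib_left sum_distrib_right)
      finally show ?thesis .
    qed
    have T1: "(LBINT x. \<rho> x * (\<Sum>i\<in>UNIV. u i x * partial i (a j) x) * ?\<Phi> j x) =
       - (\<Sum>i\<in>UNIV. (LBINT x. \<rho> x * a j x * u i x * partial i (w j) x * ?\<zeta> n x) + (LBINT x. \<rho> x * a j x * u i x * w j x * partial i (?\<zeta> n) x))" for j
    proof -
      have "(LBINT x. \<rho> x * a j x * (\<Sum>i\<in>UNIV. u i x * partial i (?\<Phi> j) x)) = (\<Sum>i\<in>UNIV. LBINT x. \<rho> x * a j x * u i x * partial i (?\<Phi> j) x)"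
        unfolding sum_distrib_left mult.assoc[symmetric]
        by (rule Bochner_Integration.integral_sum) (intro QI continuous_on_mult cont_rho ca cont_u)
      then show ?thesis
        unfolding weak_transport[OF ab(1) \<Phi>] Q[OF continuous_on_mult[OF continuous_on_mult[OF cont_rho ca] cont_u]] by simp
    qed
    have T2: "(LBINT x. \<rho> x * (\<Sum>i\<in>UNIV. u i x * partial i (b j) x) * ?\<Phi> j x) = (\<Sum>i\<in>UNIV. LBINT x. \<rho> x * u i x * partial i (b j) x * w j x * ?\<zeta> n x)" for j
    proof -
      have "(\<Sum>i\<in>UNIV. LBINT x. \<rho> x * u i x * partial i (b j) x * w j x * ?\<zeta> n x) = (LBINT x. (\<Sum>i\<in>UNIV. \<rho> x * u i x * partial i (b j) x * w j x * ?\<zeta> n x))"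
        by (rule Bochner_Integration.integral_sum[symmetric]) (intro I\<zeta> continuous_on_mult cont_rho cont_u cdb cw)
      also have "(\<lambda>x. \<Sum>i\<in>UNIV. \<rho> x * u i x * partial i (b j) x * w j x * ?\<zeta> n x) = (\<lambda>x. \<rho> x * (\<Sum>i\<in>UNIV. u i x * partial i (b j) x) * ?\<Phi> j x)"
        by (simp add: sum_distrib_left sum_distrib_right mult.assoc)
      finally show ?thesis by simp
    qed
    have J: "integrable lborel (\<lambda>x. \<rho> x * (\<Sum>i\<in>UNIV. u i x * partial i f x) * ?\<Phi> j x)" if f: "C1 f" for f j
      by (intro integrable_csupp_mult continuous_on_mult continuous_on_sum cont_rho cont_u C1_partial_continuous[OF f] C1_continuous[OF \<Phi>(1)] \<Phi>)
    have lhs: "(LBINT x. (\<Sum>j\<in>UNIV. \<rho> x * (\<Sum>i\<in>UNIV. u i x * partial i (u j) x) * ?\<Phi> j x))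
      = (\<Sum>j\<in>UNIV. (LBINT x. \<rho> x * (\<Sum>i\<in>UNIV. u i x * partial i (a j) x) * ?\<Phi> j x) + (LBINT x. \<rho> x * (\<Sum>i\<in>UNIV. u i x * partial i (b j) x) * ?\<Phi> j x))"
    proof -
      have "\<rho> x * (\<Sum>i\<in>UNIV. u i x * partial i (u j) x) * ?\<Phi> j x = \<rho> x * (\<Sum>i\<in>UNIV. u i x * partial i (a j) x) * ?\<Phi> j x + \<rho> x * (\<Sum>i\<in>UNIV. u i x * partial i (b j) x) * ?\<Phi> j x" for j x
        unfolding du_ab by (simp add: distrib_left distrib_right sum.distrib)
      then show ?thesis
        using J[OF ab(1)] J[OF ab(2)] by (simp add: Bochner_Integration.integral_sum)
    qed
    have visc: "(LBINT x. (\<Sum>j\<in>UNIV. \<Sum>i\<in>UNIV. partial i (u j) x * partial i (?\<Phi> j) x))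
      = (\<Sum>j\<in>UNIV. \<Sum>i\<in>UNIV. (LBINT x. partial i (u j) x * partial i (w j) x * ?\<zeta> n x) + (LBINT x. partial i (u j) x * w j x * partial i (?\<zeta> n) x))"
      unfolding Q[OF cont_du, symmetric] using QI[OF cont_du] by (simp add: Bochner_Integration.integral_sum)
    show ?thesis
      using weak_momentum[of ?\<Phi>, OF \<Phi>] unfolding lhs T1 T2 visc D[OF cont_P] D[OF cont_divu] E_def
      by (simp only: sum.distrib sum_negf distrib_left)
  qed
  define A1 where "A1 i j = (LBINT x. \<bar>u i x * a j x * partial i (w j) x\<bar>)" for i j
  define A2 where "A2 i j = (LBINT x. \<bar>u i x * partial i (b j) x * w j x\<bar>)" for i j
  let ?B = "M * (\<Sum>i\<in>UNIV. \<Sum>j\<in>UNIV. A1 i j) + M * (\<Sum>i\<in>UNIV. \<Sum>j\<in>UNIV. A2 i j) + (\<mu> + \<bar>\<mu> + lam\<bar>) * (real CARD('n))\<^sup>2 * L2norm G * ?\<omega>g"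
  have z1: "\<bar>?\<zeta> n x\<bar> \<le> 1" for n x using cutoff_range[of "real (Suc n)" x] by simp
  have rz: "\<bar>\<rho> x * s * ?\<zeta> n x\<bar> \<le> M * \<bar>s\<bar>" for s n x
  proof -
    have "\<bar>\<rho> x * s * ?\<zeta> n x\<bar> \<le> M * \<bar>s\<bar> * 1"
      unfolding abs_mult using rho_nonneg[of x] rho_le[of x] M_nonneg by (intro mult_mono z1) auto
    then show ?thesis by simp
  qed
  have S1: "\<bar>LBINT x. \<rho> x * a j x * u i x * partial i (w j) x * ?\<zeta> n x\<bar> \<le> M * A1 i j" for i j n
  proof -
    have "\<bar>LBINT x. \<rho> x * a j x * u i x * partial i (w j) x * ?\<zeta> n x\<bar> \<le> (LBINT x. M * \<bar>u i x * a j x * partial i (w j) x\<bar>)"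
      using rz[of _ "u i _ * a j _ * partial i (w j) _" n]
      by (intro abs_integral_le integrable_mult_right integrable_abs I1) (simp add: mult_ac)
    then show ?thesis by (simp add: A1_def)
  qed
  have S2: "\<bar>LBINT x. \<rho> x * u i x * partial i (b j) x * w j x * ?\<zeta> n x\<bar> \<le> M * A2 i j" for i j n
  proof -
    have "\<bar>LBINT x. \<rho> x * u i x * partial i (b j) x * w j x * ?\<zeta> n x\<bar> \<le> (LBINT x. M * \<bar>u i x * partial i (b j) x * w j x\<bar>)"
      using rz[of _ "u i _ * partial i (b j) _ * w j _" n]
      by (intro abs_integral_le integrable_mult_right integrable_abs I2) (simp add: mult_ac)
    then show ?thesis by (simp add: A2_def)
  qed
  have om: "0 \<le> ?\<omega>g" using newton_mass_pos[where 'n = 'n] L2norm_nonneg[of g] by simp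
  have L2g: "L2norm G \<ge> 0" by (rule L2norm_nonneg)
  have CSz: "\<bar>LBINT x. f x * h x * ?\<zeta> n x\<bar> \<le> F * ?\<omega>g"
    if "L2 f" "L2 h" "L2norm f \<le> F" "L2norm h \<le> ?\<omega>g" for f h n F
  proof -
    have "\<bar>LBINT x. f x * h x * ?\<zeta> n x\<bar> \<le> (LBINT x. \<bar>f x * h x\<bar>)"
      by (intro abs_integral_le integrable_abs L2_mult(1) that) (unfold abs_mult[of _ "?\<zeta> n _"], intro mult_left_le z1 abs_ge_zero)
    also have "\<dots> \<le> L2norm f * L2norm h" by (rule L2_mult(2)[OF that(1,2)])
    also have "\<dots> \<le> F * ?\<omega>g" using that L2norm_nonneg[of f] L2norm_nonneg[of h] by (intro mult_mono) linarith+
    finally show ?thesis .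
  qed
  have Ldu: "L2 (partial i (u j))" "L2norm (partial i (u j)) \<le> L2norm G" for i j
    using L2_mono[OF L2_G, of "partial i (u j)"] abs_du_le[of i j] gsq_nonneg by (auto intro: borel_measurable_continuous_onI cont_du)
  have Ldd: "L2 divu" "L2norm divu \<le> real CARD('n) * L2norm G"
  proof -
    have L: "L2 (\<lambda>x. real CARD('n) * G x)" using L2_G by (auto simp: L2_def power_mult_distrib)
    have N: "L2norm (\<lambda>x. real CARD('n) * G x) = real CARD('n) * L2norm G" by (simp add: L2norm_def power_mult_distrib real_sqrt_mult)
    show "L2 divu" "L2norm divu \<le> real CARD('n) * L2norm G"
      using L2_mono[OF L, of divu] abs_divu_le gsq_nonneg unfolding N by (auto intro: borel_measurable_continuous_onI cont_divu)
  qed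
  have S3: "\<bar>LBINT x. partial i (u j) x * partial i (w j) x * ?\<zeta> n x\<bar> \<le> L2norm G * ?\<omega>g" for i j n
    by (intro CSz Ldu L2_partial_w)
  have S4: "\<bar>LBINT x. divu x * ?dw x * ?\<zeta> n x\<bar> \<le> real CARD('n) * L2norm G * ?\<omega>g" for n
    by (intro CSz Ldd L2_partial_w)
  have le: "(LBINT x. P x * ?dw x * ?\<zeta> n x) \<le> ?B + E n" for n
  proof -
    have s1: "- (\<Sum>j\<in>UNIV. \<Sum>i\<in>UNIV. LBINT x. \<rho> x * a j x * u i x * partial i (w j) x * ?\<zeta> n x) \<le> M * (\<Sum>i\<in>UNIV. \<Sum>j\<in>UNIV. A1 i j)"
    proof -
      have "(\<Sum>j\<in>UNIV. \<Sum>i\<in>UNIV. - (LBINT x. \<rho> x * a j x * u i x * partial i (w j) x * ?\<zeta> n x)) \<le> (\<Sum>j\<in>UNIV. \<Sum>i\<in>UNIV. M * A1 i j)"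
        by (intro sum_mono) (use S1 in \<open>simp add: abs_le_iff\<close>)
      also have "\<dots> = M * (\<Sum>i\<in>UNIV. \<Sum>j\<in>UNIV. A1 i j)" unfolding sum_distrib_left by (rule sum.swap)
      finally show ?thesis by (simp add: sum_negf)
    qed
    have s2: "(\<Sum>j\<in>UNIV. \<Sum>i\<in>UNIV. LBINT x. \<rho> x * u i x * partial i (b j) x * w j x * ?\<zeta> n x) \<le> M * (\<Sum>i\<in>UNIV. \<Sum>j\<in>UNIV. A2 i j)"
    proof -
      have "(\<Sum>j\<in>UNIV. \<Sum>i\<in>UNIV. LBINT x. \<rho> x * u i x * partial i (b j) x * w j x * ?\<zeta> n x) \<le> (\<Sum>j\<in>UNIV. \<Sum>i\<in>UNIV. M * A2 i j)"
        by (intro sum_mono) (use S2 in \<open>simp add: abs_le_iff\<close>)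
      also have "\<dots> = M * (\<Sum>i\<in>UNIV. \<Sum>j\<in>UNIV. A2 i j)" unfolding sum_distrib_left by (rule sum.swap)
      finally show ?thesis .
    qed
    have s3: "\<mu> * (\<Sum>j\<in>UNIV. \<Sum>i\<in>UNIV. LBINT x. partial i (u j) x * partial i (w j) x * ?\<zeta> n x) \<le> \<mu> * ((real CARD('n))\<^sup>2 * (L2norm G * ?\<omega>g))"
    proof (intro mult_left_mono)
      have "(\<Sum>j\<in>UNIV. \<Sum>i\<in>UNIV. LBINT x. partial i (u j) x * partial i (w j) x * ?\<zeta> n x) \<le> (\<Sum>j\<in>(UNIV::'n set). \<Sum>i\<in>(UNIV::'n set). L2norm G * ?\<omega>g)"
        by (intro sum_mono) (use S3 in \<open>simp add: abs_le_iff\<close>)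
      then show "(\<Sum>j\<in>UNIV. \<Sum>i\<in>UNIV. LBINT x. partial i (u j) x * partial i (w j) x * ?\<zeta> n x) \<le> (real CARD('n))\<^sup>2 * (L2norm G * ?\<omega>g)"
        by (simp add: power2_eq_square mult.assoc)
    qed (use mu_pos in simp)
    have s4: "(\<mu> + lam) * (LBINT x. divu x * ?dw x * ?\<zeta> n x) \<le> \<bar>\<mu> + lam\<bar> * ((real CARD('n))\<^sup>2 * (L2norm G * ?\<omega>g))"
    proof -
      have "(\<mu> + lam) * (LBINT x. divu x * ?dw x * ?\<zeta> n x) \<le> \<bar>\<mu> + lam\<bar> * \<bar>LBINT x. divu x * ?dw x * ?\<zeta> n x\<bar>"
        unfolding abs_mult[symmetric] by simp
      also have "\<dots> \<le> \<bar>\<mu> + lam\<bar> * (real CARD('n) * (L2norm G * ?\<omega>g))" using S4[of n] by (intro mult_left_mono) (auto simp: mult.assoc)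
      also have "\<dots> \<le> \<bar>\<mu> + lam\<bar> * ((real CARD('n))\<^sup>2 * (L2norm G * ?\<omega>g))"
        using card_ge_1 self_le_power[of "real CARD('n)" 2] om L2g by (intro mult_left_mono mult_right_mono) auto
      finally show ?thesis .
    qed
    have "?B = M * (\<Sum>i\<in>UNIV. \<Sum>j\<in>UNIV. A1 i j) + M * (\<Sum>i\<in>UNIV. \<Sum>j\<in>UNIV. A2 i j) + \<mu> * ((real CARD('n))\<^sup>2 * (L2norm G * ?\<omega>g)) + \<bar>\<mu> + lam\<bar> * ((real CARD('n))\<^sup>2 * (L2norm G * ?\<omega>g))"
      by (simp add: algebra_simps)
    then show ?thesis unfolding main using s1 s2 s3 s4 by linarith
  qed
  have Pb: "\<bar>P x\<bar> \<le> A * M powr \<gamma>" for x using P_nonneg[of x] P_le[of x] by simp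
  \<comment> \<open>The pressure need not decay, but the divergence of the field is a convolution
    with an integrable kernel; so the product is integrable and the cut-off can be removed.\<close>
  have I: "integrable lborel (\<lambda>x. P x * ?dw x)"
    unfolding div_w by (rule conv_mult_integrable[OF newton_div_continuous[OF e] newton_div_integrable[OF e] cont_P Pb g(1) csupp_g])
  have "(\<lambda>n. LBINT x. P x * ?dw x * ?\<zeta> n x) \<longlonglongrightarrow> (LBINT x. P x * ?dw x)" by (rule integral_cutoff_tendsto[OF I])
  moreover have "(\<lambda>n. ?B + E n) \<longlonglongrightarrow> ?B + 0" by (intro tendsto_intros E0)
  ultimately have "(LBINT x. P x * ?dw x) \<le> ?B + 0" by (rule LIMSEQ_le) (use le in auto)
  then show ?thesis unfolding div_w A1_def A2_def by simp
qed

end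

section \<open>Absorption, scaled interpolation and the bounded pressure estimate\<close>

lemma le_of_square_le_affine:
  fixes N a b :: real
  assumes "N\<^sup>2 \<le> a + b * N" "a \<ge> 0" "b \<ge> 0" "N \<ge> 0"
  shows "N \<le> b + sqrt a"
proof (rule ccontr)
  assume "\<not> N \<le> b + sqrt a"
  then have *: "N > b + sqrt a" by simp
  have "a \<le> (b + sqrt a) * sqrt a" using assms by (simp add: distrib_right)
  also have "\<dots> \<le> N * sqrt a" using * assms by (intro mult_right_mono) auto
  also have "\<dots> < N * (N - b)" using * assms by (intro mult_strict_left_mono) (auto intro: le_less_trans[OF _ *])
  finally show False using assms(1) by (simp add: power2_eq_square algebra_simps)
qed

text \<open>A pointwise substitute for Hoelder's inequality. With \<open>m\<close> the dimension,
  integration over a ball of radius \<open>R\<close> balances both terms: the volume against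
  \<open>R powr m\<close> times a fixed integral. The parameter \<open>\<delta>\<close> is 1 for
  mere bounds, and small where the integral tends to 0 and the first term must be
  negligible.\<close>

lemma le_const_plus_powr:
  fixes s R \<delta> :: real
  assumes s: "s \<ge> 0" and R: "R > 0" and \<delta>: "\<delta> > 0" and k: "k > 0" "q > k" and q: "q > 0"
  shows "s powr (k / 2) \<le> R powr (- k * m / q) * (\<delta> + \<delta> powr (1 - q / k) * (R powr m * s powr (q / 2)))"
proof -
  \<comment> \<open>In this scaling \<open>t powr (q / k)\<close> is exactly
    \<open>R powr m * s powr (q / 2)\<close>, and the claim becomes \<open>t \<le> \<delta> +
    \<delta> powr (1 - q / k) * t powr (q / k)\<close>.\<close>
  define t where "t = s powr (k / 2) * R powr (k * m / q)"
  have t: "t \<ge> 0" by (simp add: t_def)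
  have tq: "t powr (q / k) = R powr m * s powr (q / 2)"
    using k q s by (simp add: t_def powr_mult powr_powr mult.commute)
  have "t \<le> \<delta> + \<delta> powr (1 - q / k) * t powr (q / k)"
  proof (cases "t \<le> \<delta>")
    case True
    moreover have "0 \<le> \<delta> powr (1 - q / k) * t powr (q / k)" by simp
    ultimately show ?thesis by linarith
  next
    case False
    have "t = t powr (1 - q / k) * t powr (q / k)" using False \<delta> by (simp add: powr_add[symmetric])
    also have "\<dots> \<le> \<delta> powr (1 - q / k) * t powr (q / k)"
      using False \<delta> k by (intro mult_right_mono powr_mono2') auto
    finally show ?thesis using \<delta> by linarith
  qed
  moreover have "s powr (k / 2) = R powr (- k * m / q) * t"
    using R by (simp add: t_def powr_minus divide_simps)
  ultimately show ?thesis unfolding tq by (simp add: mult_left_mono)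
qed

context flow
begin

text \<open>\<open>c\<close> is the mean of the pressure weighted by the cut-off, so that
  \<open>g\<close> has mean zero, and \<open>N\<^sup>2\<close> is the integral of
  \<open>(P x - c)\<^sup>2\<close> against the cut-off. As the cut-off has values between 0 and 1
  and is 1 on the ball, \<open>N\<close> dominates both L2 norms. By mean zero, pairing
  \<open>g\<close> with \<open>P\<close> returns \<open>N\<^sup>2\<close>, and the approximate
  identity turns a bound uniform in \<open>e\<close> into a bound on it.\<close>

lemma pressure_mean:
  assumes R: "R > 0"
  obtains c g N where "c \<ge> 0" "\<And>e. e > 0 \<Longrightarrow> newton_field e (2 * R) g" "\<And>x. \<bar>g x\<bar> \<le> A * M powr \<gamma>"
    "N \<ge> 0" "L2norm g \<le> N" "L2norm (\<lambda>x. indicator (cball 0 R) x * \<bar>P x - c\<bar>) \<le> N"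
    "\<And>B. (\<And>e. e > 0 \<Longrightarrow> (LBINT x. P x * conv (newton_div e) g x) \<le> B) \<Longrightarrow> newton_mass TYPE('n) * N\<^sup>2 \<le> B"
proof -
  let ?\<chi> = "cutoff R :: real^'n \<Rightarrow> real"
  let ?p = "A * M powr \<gamma>"
  have \<chi>: "continuous_on UNIV ?\<chi>" "csupp ?\<chi>" using R by (auto intro: C1_continuous C1_cutoff csupp_cutoff)
  have I: "integrable lborel (\<lambda>x. f x * ?\<chi> x)" if "continuous_on UNIV f" for f by (intro integrable_csupp_mult that \<chi>)
  have I1: "integrable lborel ?\<chi>" by (rule integrable_csupp[OF \<chi>])
  define I0 where "I0 = (LBINT x. ?\<chi> x)"
  have ind: "(LBINT x. indicator (cball (0::real^'n) R) x) \<le> I0"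
    unfolding I0_def
  proof (rule integral_mono[OF _ I1])
    show "integrable lborel (indicator (cball (0::real^'n) R) :: _ \<Rightarrow> real)"
      using integrable_cball[of "\<lambda>_::real^'n. 1" R] by simp
    show "indicator (cball 0 R) x \<le> ?\<chi> x" for x using cutoff_eq_1[OF R, of x] cutoff_range[of R x] by (simp add: indicator_def)
  qed
  have I0: "I0 > 0"
    by (rule less_le_trans[OF content_cball_pos[OF R, of "0::real^'n"]]) (use ind in simp)
  define c where "c = (LBINT x. P x * ?\<chi> x) / I0"
  have c0: "c \<ge> 0" unfolding c_def using I0 P_nonneg cutoff_range by (intro divide_nonneg_pos Bochner_Integration.integral_nonneg mult_nonneg_nonneg) auto
  have "(LBINT x. P x * ?\<chi> x) \<le> (LBINT x. ?p * ?\<chi> x)"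
    by (intro integral_mono I cont_P continuous_on_const mult_right_mono P_le cutoff_range)
  then have c1: "c \<le> ?p" using I0 by (simp add: c_def I0_def[symmetric] divide_le_eq)
  have Pc: "\<bar>P x - c\<bar> \<le> ?p" for x using c0 c1 P_nonneg[of x] P_le[of x] by linarith
  define g where "g x = (P x - c) * ?\<chi> x" for x
  have cPc: "continuous_on UNIV (\<lambda>x. P x - c)" by (intro continuous_intros cont_P)
  have gc: "continuous_on UNIV g" unfolding g_def[abs_def] by (intro continuous_on_mult cPc \<chi>)
  have gs: "csupp g" unfolding g_def[abs_def] using \<chi> by auto
  have g0: "(LBINT y. g y) = 0"
    unfolding g_def left_diff_distrib using I[OF cont_P] I1 I0 by (simp add: c_def I0_def[symmetric])
  have gb: "\<bar>g x\<bar> \<le> ?p" for x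
    using mult_mono[OF Pc[of x], of "\<bar>?\<chi> x\<bar>" 1] cutoff_range[of R x] order_trans[OF abs_ge_zero Pc[of x]] by (simp add: g_def abs_mult)
  have nf: "newton_field e (2 * R) g" if "e > 0" for e
    by unfold_locales (use that R gc g0 cutoff_eq_0[OF R less_imp_le] in \<open>auto simp: g_def\<close>)
  let ?N2 = "LBINT x. (P x - c)\<^sup>2 * ?\<chi> x"
  have N2I: "integrable lborel (\<lambda>x. (P x - c)\<^sup>2 * ?\<chi> x)" by (intro I continuous_on_power cPc)
  define N where "N = sqrt ?N2"
  have N2nn: "?N2 \<ge> 0" using cutoff_range by (intro Bochner_Integration.integral_nonneg mult_nonneg_nonneg) auto
  have N: "N \<ge> 0" "N\<^sup>2 = ?N2" using N2nn by (auto simp: N_def)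
  have gle: "(g x)\<^sup>2 \<le> (P x - c)\<^sup>2 * ?\<chi> x" for x
    unfolding g_def power_mult_distrib using cutoff_range[of R x]
    by (intro mult_left_mono) (auto simp: power2_eq_square mult_left_le)
  have 1: "L2norm g \<le> N"
    unfolding L2norm_def N_def
    by (intro real_sqrt_le_mono integral_mono N2I gle integrable_csupp continuous_on_power gc) (use gs in \<open>auto simp: power2_eq_square\<close>)
  have 2: "L2norm (\<lambda>x. indicator (cball 0 R) x * \<bar>P x - c\<bar>) \<le> N"
    unfolding L2norm_def N_def
  proof (intro real_sqrt_le_mono integral_mono N2I)
    show "integrable lborel (\<lambda>x. (indicator (cball 0 R) x * \<bar>P x - c\<bar>)\<^sup>2)"
      using L2_cball[OF continuous_on_rabs[OF cPc], of R] unfolding L2_def by simp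
    show "(indicator (cball 0 R) x * \<bar>P x - c\<bar>)\<^sup>2 \<le> (P x - c)\<^sup>2 * ?\<chi> x" for x
      using cutoff_eq_1[OF R, of x] cutoff_range[of R x] by (simp add: indicator_def)
  qed
  have 3: "newton_mass TYPE('n) * N\<^sup>2 \<le> B" if B: "\<And>e. e > 0 \<Longrightarrow> (LBINT x. P x * conv (newton_div e) g x) \<le> B" for B
  proof -
    have Pb: "\<bar>P x\<bar> \<le> ?p" for x using P_nonneg[of x] P_le[of x] by simp
    have "(\<lambda>n. LBINT x. P x * conv (newton_div (inverse (real (Suc n)))) g x) \<longlonglongrightarrow> newton_mass TYPE('n) * (LBINT y. g y * P y)"
      by (rule newton_div_approx_identity[OF cont_P Pb gc gs _ LIMSEQ_inverse_real_of_nat]) simp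
    then have "newton_mass TYPE('n) * (LBINT y. g y * P y) \<le> B"
      by (rule LIMSEQ_le_const2) (use B in auto)
    moreover have "(LBINT y. g y * P y) = ?N2"
    proof -
      have gI: "integrable lborel (\<lambda>x. P x * g x)" "integrable lborel g" by (intro integrable_csupp_mult integrable_csupp cont_P gc gs)+
      have "?N2 = (LBINT x. P x * g x - c * g x)"
        by (intro Bochner_Integration.integral_cong) (auto simp: g_def power2_eq_square algebra_simps)
      also have "\<dots> = (LBINT x. P x * g x)" using gI g0 by simp
      finally show ?thesis by (simp add: mult.commute)
    qed
    ultimately show ?thesis using N by simp
  qed
  show thesis by (rule that[OF c0 nf gb N(1) 1 2 3])
qed

abbreviation "Iq \<equiv> \<integral>x. usq x powr (q / 2) \<partial>lborel"

lemma L2_of_le_Lq: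
  assumes f: "continuous_on UNIV f" and le: "\<And>x. (f x)\<^sup>2 \<le> k * usq x powr (q / 2)" and k: "k \<ge> 0"
  shows "L2 f" and "L2norm f \<le> sqrt (k * Iq)"
proof -
  have I: "integrable lborel (\<lambda>x. (f x)\<^sup>2)"
    by (rule Bochner_Integration.integrable_bound[of lborel "\<lambda>x. k * usq x powr (q / 2)"])
       (use Lq_integrable le in \<open>auto intro!: borel_measurable_continuous_onI continuous_on_power f intro: order_trans[OF le abs_ge_self]\<close>)
  then show "L2 f" using f by (simp add: L2_def borel_measurable_continuous_onI)
  have "(LBINT x. (f x)\<^sup>2) \<le> (LBINT x. k * usq x powr (q / 2))"
    using Lq_integrable by (intro integral_mono I le) auto
  then show "L2norm f \<le> sqrt (k * Iq)" unfolding L2norm_def by (intro real_sqrt_le_mono) simp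
qed

text \<open>Here \<open>q / 2\<close> lies between 1 and 2. Up to 1 the square is below
  \<open>s powr (q / 2)\<close>, beyond 1 the first power is; the truncations have to follow one of
  them in each regime.\<close>

lemma min_power_le:
  assumes "s \<ge> 0" "q \<le> 4"
  shows "min 1 (s\<^sup>2) \<le> s powr (q / 2)" and "s * min 1 (s\<^sup>2) \<le> s powr (q / 2)"
proof -
  have "min 1 (s\<^sup>2) \<le> s powr (q / 2) \<and> s * min 1 (s\<^sup>2) \<le> s powr (q / 2)"
  proof (cases "s \<le> 1")
    case True
    have "s powr 2 \<le> s powr (q / 2)" using True assms by (intro powr_mono') auto
    then have "s\<^sup>2 \<le> s powr (q / 2)" using assms by (cases "s = 0") auto
    moreover have "s * min 1 (s\<^sup>2) \<le> 1 * s\<^sup>2" using True assms by (intro mult_mono) auto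
    ultimately show ?thesis by (auto simp: min_def)
  next
    case False
    have "s powr 1 \<le> s powr (q / 2)" using False q by (intro powr_mono) auto
    moreover have "s * min 1 (s\<^sup>2) \<le> s * 1" using assms by (intro mult_left_mono) auto
    moreover have "min 1 (s\<^sup>2) \<le> 1" by simp
    ultimately show ?thesis using False by (auto simp del: min.absorb1 min.absorb2 intro: order_trans)
  qed
  then show "min 1 (s\<^sup>2) \<le> s powr (q / 2)" "s * min 1 (s\<^sup>2) \<le> s powr (q / 2)" by auto
qed

lemma \<Psi>_sq_le:
  assumes "\<epsilon> > 0"
  shows "(\<Psi> \<epsilon> x)\<^sup>2 \<le> (1 + 1 / \<epsilon>\<^sup>2) * min 1 ((usq x)\<^sup>2)"
proof -
  have D: "1 + \<epsilon> * usq x \<ge> 1" using assms usq_nonneg by simp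
  have 1: "\<Psi> \<epsilon> x \<le> usq x" using D usq_nonneg[of x] mult_left_mono[OF D usq_nonneg[of x]] by (simp add: \<Psi>_def divide_le_eq)
  have 2: "\<Psi> \<epsilon> x \<le> 1 / \<epsilon>" using D assms by (simp add: \<Psi>_def divide_simps)
  have nn: "0 \<le> \<Psi> \<epsilon> x" using \<Psi>_nonneg[of \<epsilon>] assms by simp
  have "(\<Psi> \<epsilon> x)\<^sup>2 \<le> (usq x)\<^sup>2" "(\<Psi> \<epsilon> x)\<^sup>2 \<le> (1 / \<epsilon>)\<^sup>2" using 1 2 nn by (auto intro: power_mono)
  moreover have "0 \<le> 1 / \<epsilon>\<^sup>2 * (usq x)\<^sup>2" by simp
  ultimately show ?thesis
    by (auto simp: min_def power_divide distrib_right intro: add_increasing2)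
qed

lemma \<Psi>_L2:
  assumes "\<epsilon> > 0" "q \<le> 4"
  shows "L2 (\<Psi> \<epsilon>)" and "L2norm (\<Psi> \<epsilon>) \<le> sqrt ((1 + 1 / \<epsilon>\<^sup>2) * Iq)"
proof -
  have le: "(\<Psi> \<epsilon> x)\<^sup>2 \<le> (1 + 1 / \<epsilon>\<^sup>2) * usq x powr (q / 2)" for x
    by (rule order_trans[OF \<Psi>_sq_le[OF assms(1)] mult_left_mono[OF min_power_le(1)[OF usq_nonneg assms(2)]]]) simp
  show "L2 (\<Psi> \<epsilon>)" "L2norm (\<Psi> \<epsilon>) \<le> sqrt ((1 + 1 / \<epsilon>\<^sup>2) * Iq)"
    using L2_of_le_Lq[OF cont_\<Psi> le] assms by auto
qed

text \<open>The products \<open>u i x * a j x\<close> are below \<open>\<Psi> 1 x\<close>, quadratic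
  for small speeds and bounded for large ones, hence in L2 by \<open>min_power_le\<close>. The
  derivative of \<open>b\<close> carries \<open>1 - \<psi> 1 x\<close> or a derivative of
  \<open>\<psi>\<close>, both of order \<open>\<Psi> 1 x\<close>, so that \<open>u\<close> times it
  is below a multiple of \<open>G x * h2 x\<close> with \<open>h2\<close> in L2. The sup bound on
  the field contains \<open>N\<close> only linearly; the estimate is therefore affine in
  \<open>N\<close>, with coefficients independent of \<open>R\<close>.\<close>

lemma pressure_L2_bounded:
  assumes d: "CARD('n) \<ge> 3" and q4: "q \<le> 4"
  obtains C where "C \<ge> 0" "\<And>R. R > 0 \<Longrightarrow> \<exists>c\<ge>0. L2norm (\<lambda>x. indicator (cball 0 R) x * \<bar>P x - c\<bar>) \<le> C"
proof -
  let ?\<omega> = "newton_mass TYPE('n)"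
  let ?d = "real CARD('n)"
  let ?p = "A * M powr \<gamma>"
  have om: "?\<omega> > 0" by (rule newton_mass_pos)
  define a where "a j x = u j x * \<psi> 1 x" for j x
  define b where "b j x = u j x * (1 - \<psi> 1 x)" for j x
  define h2 where "h2 x = U x * \<Psi> 1 x" for x
  have p0: "?p \<ge> 0" using A_pos by simp
  have C\<psi>: "C1 (\<psi> 1)" by (rule C1_\<psi>) simp
  have C1\<psi>: "C1 (\<lambda>x. 1 - \<psi> 1 x)" by (rule C1_diff[OF C1_const C\<psi>])
  have ab: "C1 (a j)" "C1 (b j)" "u j = (\<lambda>x. a j x + b j x)" for j
    unfolding a_def[abs_def] b_def[abs_def] by (auto intro!: C1_mult u C\<psi> C1\<psi> simp: algebra_simps)
  have \<psi>r: "0 \<le> \<psi> 1 x" "\<psi> 1 x \<le> 1" for x using \<psi>_range[of 1] by auto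
  have aU: "\<bar>a j x\<bar> \<le> U x" for j x
    unfolding a_def abs_mult using mult_mono[OF abs_u_le[of j x], of "\<psi> 1 x" 1] \<psi>r[of x] usq_nonneg[of x] by simp
  have \<psi>\<Psi>: "usq x * \<psi> 1 x \<le> \<Psi> 1 x" "1 - \<psi> 1 x \<le> 2 * \<Psi> 1 x" for x
  proof -
    have D: "1 + usq x > 0" using usq_nonneg[of x] by linarith
    have "1 / (1 + usq x)\<^sup>2 \<le> 1 / (1 + usq x)" using usq_nonneg[of x]
      by (intro divide_left_mono) (auto simp: power2_eq_square)
    then show "usq x * \<psi> 1 x \<le> \<Psi> 1 x" using mult_left_mono[OF _ usq_nonneg[of x]] by (force simp: \<psi>_def \<Psi>_def)
    \<comment> \<open>With \<open>z = 1 + usq x\<close>, this inequality is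
      \<open>(1 - 1 / z)\<^sup>2 \<ge> 0\<close> rearranged.\<close>
    have "1 - 1 / z\<^sup>2 \<le> 2 * ((z - 1) / z)" if "z \<ge> 1" for z :: real
    proof -
      have "0 \<le> (1 - 1 / z)\<^sup>2" by simp
      then show ?thesis using that by (simp add: power2_diff power_divide diff_divide_distrib)
    qed
    from this[of "1 + usq x"] show "1 - \<psi> 1 x \<le> 2 * \<Psi> 1 x" using usq_nonneg[of x] by (simp add: \<psi>_def \<Psi>_def)
  qed
  have \<Psi>1: "0 \<le> \<Psi> 1 x" for x using \<Psi>_nonneg[of 1] by simp
  have L\<Psi>: "L2 (\<Psi> 1)" using \<Psi>_L2[of 1] q4 by simp
  have c\<Psi>: "continuous_on UNIV (\<Psi> 1)" by (rule cont_\<Psi>) simp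
  have Lh: "L2 h2"
  proof (rule L2_of_le_Lq(1)[where k = 2])
    show "continuous_on UNIV h2" unfolding h2_def[abs_def] by (intro continuous_on_mult cont_U c\<Psi>)
    fix x
    have "(h2 x)\<^sup>2 = usq x * (\<Psi> 1 x)\<^sup>2" using usq_nonneg[of x] by (simp add: h2_def power_mult_distrib)
    also have "\<dots> \<le> usq x * (2 * min 1 ((usq x)\<^sup>2))" using \<Psi>_sq_le[of 1 x] by (intro mult_left_mono usq_nonneg) simp
    also have "\<dots> = 2 * (usq x * min 1 ((usq x)\<^sup>2))" by simp
    also have "\<dots> \<le> 2 * usq x powr (q / 2)" by (intro mult_left_mono min_power_le usq_nonneg q4) simp
    finally show "(h2 x)\<^sup>2 \<le> 2 * usq x powr (q / 2)" .
  qed simp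
  have ua: "\<bar>u i x * a j x\<bar> \<le> \<bar>\<Psi> 1 x\<bar>" for i j x
  proof -
    have "\<bar>u i x * a j x\<bar> = \<bar>u i x\<bar> * \<bar>u j x\<bar> * \<psi> 1 x" using \<psi>r[of x] by (simp add: a_def abs_mult)
    also have "\<dots> \<le> U x * U x * \<psi> 1 x" using \<psi>r usq_nonneg by (intro mult_mono abs_u_le) auto
    also have "\<dots> = usq x * \<psi> 1 x" using usq_nonneg[of x] by simp
    finally show ?thesis using \<psi>\<Psi>(1)[of x] \<Psi>1[of x] by simp
  qed
  have Lua: "L2 (\<lambda>x. u i x * a j x)" "L2norm (\<lambda>x. u i x * a j x) \<le> L2norm (\<Psi> 1)" for i j
    using L2_mono[OF L\<Psi>, of "\<lambda>x. u i x * a j x"] ua by (auto intro!: borel_measurable_continuous_onI continuous_on_mult cont_u C1_continuous[OF ab(1)])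
  have ub: "\<bar>u i x * partial i (b j) x\<bar> \<le> (2 + 4 * ?d) * (G x * h2 x)" for i j x
  proof -
    have "partial i (b j) x = partial i (u j) x * (1 - \<psi> 1 x) - u j x * partial i (\<psi> 1) x"
      unfolding b_def[abs_def] partial_mult[OF u C1\<psi>] partial_diff[OF C1_const C\<psi>] by simp
    then have "\<bar>u i x * partial i (b j) x\<bar> \<le> \<bar>u i x * (partial i (u j) x * (1 - \<psi> 1 x))\<bar> + \<bar>u i x * (u j x * partial i (\<psi> 1) x)\<bar>"
      by (simp add: right_diff_distrib)
    also have "\<dots> \<le> U x * (G x * (2 * \<Psi> 1 x)) + U x * (4 * ?d * (1 * \<Psi> 1 x * G x))"
      unfolding abs_mult[of "u i x"] abs_mult[of _ "1 - \<psi> 1 x"]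
      using \<psi>r[of x] \<psi>\<Psi>(2)[of x] usq_nonneg[of x] gsq_nonneg[of x]
      by (intro add_mono mult_mono abs_u_le abs_du_le u_partial_\<psi>_le) auto
    also have "\<dots> = (2 + 4 * ?d) * (G x * h2 x)" by (simp add: h2_def algebra_simps)
    finally show ?thesis .
  qed
  obtain Cs where Cs: "Cs \<ge> 0" "\<And>e g B j x. e > 0 \<Longrightarrow> continuous_on UNIV g \<Longrightarrow> csupp g \<Longrightarrow> (\<And>y. \<bar>g y\<bar> \<le> B) \<Longrightarrow>
     \<bar>conv (newton e j) g (x :: real^'n)\<bar> \<le> Cs * (B + sqrt (LBINT y. (g y)\<^sup>2))"
    by (rule newton_field_sup[OF d]) blast
  define k1 where "k1 = M * (?d\<^sup>2 * (L2norm (\<Psi> 1) * ?\<omega>))"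
  define k2 where "k2 = M * (?d\<^sup>2 * ((2 + 4 * ?d) * (L2norm G * L2norm h2) * Cs))"
  define k3 where "k3 = (\<mu> + \<bar>\<mu> + lam\<bar>) * ?d\<^sup>2 * L2norm G * ?\<omega>"
  have k: "k1 \<ge> 0" "k2 \<ge> 0" "k3 \<ge> 0"
    unfolding k1_def k2_def k3_def using M_nonneg om mu_pos Cs(1) L2norm_nonneg[of G] L2norm_nonneg[of h2] L2norm_nonneg[of "\<Psi> 1"] by auto
  \<comment> \<open>The value that \<open>le_of_square_le_affine\<close> returns for
    \<open>?\<omega> * N\<^sup>2 \<le> k2 * ?p + (k1 + k2 + k3) * N\<close>.\<close>
  define C where "C = (k1 + k2 + k3) / ?\<omega> + sqrt (k2 * ?p / ?\<omega>)"
  have C: "C \<ge> 0" unfolding C_def using k om p0 by simp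
  show thesis
  proof (rule that[OF C])
    fix R :: real assume R: "R > 0"
    obtain c g N where c: "c \<ge> 0" and nf: "\<And>e. e > 0 \<Longrightarrow> newton_field e (2 * R) g" and gb: "\<And>x. \<bar>g x\<bar> \<le> ?p"
      and N: "N \<ge> 0" "L2norm g \<le> N" "L2norm (\<lambda>x. indicator (cball 0 R) x * \<bar>P x - c\<bar>) \<le> N"
      and lim: "\<And>B. (\<And>e. e > 0 \<Longrightarrow> (LBINT x. P x * conv (newton_div e) g x) \<le> B) \<Longrightarrow> ?\<omega> * N\<^sup>2 \<le> B"
      by (rule pressure_mean[OF R]) blast
    have "(LBINT x. P x * conv (newton_div e) g x) \<le> k2 * ?p + (k1 + k2 + k3) * N" if e: "e > 0" for e
    proof -
      interpret newton_field e "2 * R" g by (rule nf[OF e])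
      have wb: "\<bar>w j x\<bar> \<le> Cs * (?p + N)" for j x
      proof -
        have "\<bar>w j x\<bar> \<le> Cs * (?p + L2norm g)" using Cs(2)[OF e g(1) csupp_g gb] by (simp add: L2norm_def)
        also have "\<dots> \<le> Cs * (?p + N)" using N Cs(1) by (intro mult_left_mono) auto
        finally show ?thesis .
      qed
      have I1: "integrable lborel (\<lambda>x. u i x * a j x * partial i (w j) x)" for i j
        by (rule L2_mult(1)[OF Lua(1) L2_partial_w(1)])
      have A1: "(LBINT x. \<bar>u i x * a j x * partial i (w j) x\<bar>) \<le> L2norm (\<Psi> 1) * ?\<omega> * N" for i j
      proof -
        have "(LBINT x. \<bar>u i x * a j x * partial i (w j) x\<bar>) \<le> L2norm (\<lambda>x. u i x * a j x) * L2norm (partial i (w j))"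
          by (rule L2_mult(2)[OF Lua(1) L2_partial_w(1)])
        also have "\<dots> \<le> L2norm (\<Psi> 1) * (?\<omega> * L2norm g)"
          by (intro mult_mono Lua L2_partial_w L2norm_nonneg)
        also have "\<dots> \<le> L2norm (\<Psi> 1) * (?\<omega> * N)" using om N by (intro mult_left_mono L2norm_nonneg) auto
        finally show ?thesis by simp
      qed
      let ?c2 = "(2 + 4 * ?d) * (Cs * (?p + N))"
      have pw: "\<bar>u i x * partial i (b j) x * w j x\<bar> \<le> ?c2 * (G x * h2 x)" for i j x
      proof -
        have "\<bar>u i x * partial i (b j) x * w j x\<bar> \<le> (2 + 4 * ?d) * (G x * h2 x) * (Cs * (?p + N))"
          unfolding abs_mult[of _ "w j x"] using usq_nonneg[of x] gsq_nonneg[of x] \<Psi>1[of x] by (intro mult_mono ub wb) (auto simp: h2_def)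
        then show ?thesis by (simp only: mult_ac)
      qed
      have IGh: "integrable lborel (\<lambda>x. ?c2 * (G x * h2 x))" by (intro integrable_mult_right L2_mult(1) L2_G Lh)
      have I2: "integrable lborel (\<lambda>x. u i x * partial i (b j) x * w j x)" for i j
      proof (rule Bochner_Integration.integrable_bound[OF IGh])
        show "(\<lambda>x. u i x * partial i (b j) x * w j x) \<in> borel_measurable lborel"
          by (simp, intro borel_measurable_continuous_onI continuous_on_mult cont_u C1_partial_continuous[OF ab(2)] C1_continuous[OF C1_w])
        show "AE x in lborel. norm (u i x * partial i (b j) x * w j x) \<le> norm (?c2 * (G x * h2 x))"
          unfolding real_norm_def by (intro AE_I2 order_trans[OF pw abs_ge_self])
      qed
      have A2: "(LBINT x. \<bar>u i x * partial i (b j) x * w j x\<bar>) \<le> (2 + 4 * ?d) * (L2norm G * L2norm h2) * Cs * (?p + N)" for i j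
      proof -
        have c2: "?c2 \<ge> 0" using Cs(1) p0 N by simp
        have "(LBINT x. \<bar>u i x * partial i (b j) x * w j x\<bar>) \<le> (LBINT x. ?c2 * (G x * h2 x))"
          by (intro integral_mono integrable_abs I2 IGh pw)
        also have "\<dots> = ?c2 * (LBINT x. G x * h2 x)" by simp
        also have "\<dots> \<le> ?c2 * (L2norm G * L2norm h2)"
          by (intro mult_left_mono c2 order_trans[OF order_trans[OF abs_ge_self integral_abs_bound] L2_mult(2)[OF L2_G Lh]])
        finally show ?thesis by (simp add: mult_ac)
      qed
      have "(LBINT x. P x * conv (newton_div e) g x) \<le> M * (\<Sum>i\<in>UNIV. \<Sum>j\<in>UNIV. LBINT x. \<bar>u i x * a j x * partial i (w j) x\<bar>)
         + M * (\<Sum>i\<in>UNIV. \<Sum>j\<in>UNIV. LBINT x. \<bar>u i x * partial i (b j) x * w j x\<bar>)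
         + (\<mu> + \<bar>\<mu> + lam\<bar>) * ?d\<^sup>2 * L2norm G * (?\<omega> * L2norm g)"
        by (rule pressure_test[OF nf[OF e] ab aU I1 I2])
      also have "\<dots> \<le> M * (\<Sum>i\<in>(UNIV::'n set). \<Sum>j\<in>(UNIV::'n set). L2norm (\<Psi> 1) * ?\<omega> * N)
         + M * (\<Sum>i\<in>(UNIV::'n set). \<Sum>j\<in>(UNIV::'n set). (2 + 4 * ?d) * (L2norm G * L2norm h2) * Cs * (?p + N))
         + (\<mu> + \<bar>\<mu> + lam\<bar>) * ?d\<^sup>2 * L2norm G * (?\<omega> * N)"
        using M_nonneg mu_pos om N L2norm_nonneg[of G]
        by (intro add_mono mult_left_mono sum_mono A1 A2) auto
      also have "\<dots> = k1 * N + k2 * (?p + N) + k3 * N"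
        by (simp add: k1_def k2_def k3_def power2_eq_square mult_ac)
      finally show ?thesis by (simp add: algebra_simps)
    qed
    then have "?\<omega> * N\<^sup>2 \<le> k2 * ?p + (k1 + k2 + k3) * N" by (rule lim)
    then have "N\<^sup>2 \<le> k2 * ?p / ?\<omega> + (k1 + k2 + k3) / ?\<omega> * N" using om by (simp add: field_simps)
    then have "N \<le> C" unfolding C_def using k om p0 N by (intro le_of_square_le_affine) auto
    then show "\<exists>c\<ge>0. L2norm (\<lambda>x. indicator (cball 0 R) x * \<bar>P x - c\<bar>) \<le> C" using c N by (intro exI[of _ c]) auto
  qed
qed

end

section \<open>Growth of the pressure oscillation in low dimension\<close>

lemma sqrt_powr_double: "sqrt (x powr (2 * a)) = x powr a"
proof -
  have "x powr (2 * a) = (x powr a)\<^sup>2" by (simp only: power2_eq_square powr_add[symmetric] mult_2)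
  then show ?thesis by simp
qed

context flow
begin

lemma usq_le_scaled:
  assumes R: "R > 0" and \<delta>: "\<delta> > 0"
  shows "usq x \<le> R powr (- 2 * real CARD('n) / q) * (\<delta> + \<delta> powr (1 - q / 2) * (R powr real CARD('n) * usq x powr (q / 2)))"
  using le_const_plus_powr[OF usq_nonneg[of x] R \<delta>, of 2 q "real CARD('n)"] q usq_nonneg[of x] by simp

text \<open>Interpolation at scale \<open>R\<close> with \<open>\<delta> = 1\<close>. The radius
  \<open>4 * R\<close> is twice the support radius \<open>2 * R\<close> of the \<open>g\<close>
  built from the pressure, and beyond it the test field has its decay.\<close>

lemma usq_L2_cball:
  assumes q4: "q > 4" and R: "R > 0"
  shows "L2norm (\<lambda>x. indicator (cball 0 (4 * R)) x * usq x)
    \<le> sqrt (unit_ball_vol (real CARD('n)) * 4 ^ CARD('n) + Iq) * R powr (real CARD('n) / 2 - 2 * real CARD('n) / q)"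
proof -
  let ?d = "real CARD('n)"
  let ?V = "unit_ball_vol ?d"
  let ?t = "R powr (- 4 * ?d / q)"
  have le: "(indicator (cball 0 (4 * R)) x * usq x)\<^sup>2 \<le> ?t * (indicator (cball 0 (4 * R)) x + R powr ?d * usq x powr (q / 2))" for x
  proof -
    have "usq x powr (4 / 2) = (usq x)\<^sup>2" using usq_nonneg[of x] by (cases "usq x = 0") auto
    then have "(usq x)\<^sup>2 \<le> ?t * (1 + R powr ?d * usq x powr (q / 2))"
      using le_const_plus_powr[OF usq_nonneg[of x] R zero_less_one, of 4 q ?d] q4 by simp
    then show ?thesis by (simp add: indicator_def)
  qed
  have I: "integrable lborel (\<lambda>x. ?t * (indicator (cball 0 (4 * R)) x + R powr ?d * usq x powr (q / 2)))"
    using Lq_integrable integrable_cball[of "\<lambda>_::real^'n. 1" "4 * R"] by simp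
  have "(LBINT x. (indicator (cball 0 (4 * R)) x * usq x)\<^sup>2) \<le> (LBINT x. ?t * (indicator (cball 0 (4 * R)) x + R powr ?d * usq x powr (q / 2)))"
    using L2_cball[OF cont_usq, of "4 * R"] by (intro integral_mono I le) (simp add: L2_def)
  also have "\<dots> = ?t * (?V * (4 * R) ^ CARD('n) + R powr ?d * Iq)"
    using Lq_integrable integrable_cball[of "\<lambda>_::real^'n. 1" "4 * R"] integral_indicator_cball[of "4 * R", where 'n = 'n] R by simp
  also have "\<dots> = (?t * R powr ?d) * (?V * 4 ^ CARD('n) + Iq)"
    using R by (simp add: power_mult_distrib powr_realpow algebra_simps)
  also have "?t * R powr ?d = R powr (2 * (?d / 2 - 2 * ?d / q))"
    unfolding powr_add[symmetric] by (rule arg_cong[where f = "(powr) R"]) (simp add: field_simps)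
  finally have "L2norm (\<lambda>x. indicator (cball 0 (4 * R)) x * usq x) \<le> sqrt (R powr (2 * (?d / 2 - 2 * ?d / q)) * (?V * 4 ^ CARD('n) + Iq))"
    unfolding L2norm_def by (rule real_sqrt_le_mono)
  also have "sqrt (R powr (2 * (?d / 2 - 2 * ?d / q))) = R powr (?d / 2 - 2 * ?d / q)"
    by (rule sqrt_powr_double)
  then have "sqrt (R powr (2 * (?d / 2 - 2 * ?d / q)) * (?V * 4 ^ CARD('n) + Iq)) = sqrt (?V * 4 ^ CARD('n) + Iq) * R powr (?d / 2 - 2 * ?d / q)"
    by (simp only: real_sqrt_mult mult.commute)
  finally show ?thesis .
qed

text \<open>For \<open>q > 4\<close> the square of the speed is controlled in L2 only locally, so
  the integral is split at \<open>4 * R\<close>: inside, L2 meets L2; outside, the pointwise decay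
  of the gradient of the field takes over. The outer part is proportional to the L1 norm of
  \<open>g\<close>, at most a multiple of \<open>R powr (d / 2) * N\<close>. Both parts then scale
  as \<open>R powr \<alpha> * N\<close>, and one factor \<open>N\<close> cancels.\<close>

lemma pressure_L2_growth:
  assumes q4: "q > 4"
  defines "\<alpha> \<equiv> real CARD('n) / 2 - 2 * real CARD('n) / q"
  obtains C where "C \<ge> 0" "\<And>R. R \<ge> 1 \<Longrightarrow> \<exists>c\<ge>0. L2norm (\<lambda>x. indicator (cball 0 R) x * \<bar>P x - c\<bar>) \<le> C * R powr \<alpha>"
proof -
  let ?\<omega> = "newton_mass TYPE('n)"
  let ?d = "real CARD('n)"
  let ?V = "unit_ball_vol ?d"
  have om: "?\<omega> > 0" by (rule newton_mass_pos)
  have V: "?V \<ge> 0" by (simp add: unit_ball_vol_def)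
  have \<alpha>: "\<alpha> \<ge> 0" using q4 card_ge_1 by (simp add: \<alpha>_def field_simps)
  obtain Ct where Ct: "Ct \<ge> 0" and It: "\<And>R. R > 0 \<Longrightarrow>
      integrable lborel (\<lambda>x::real^'n. indicator {x. R \<le> norm x} x * norm x powr (- (?d + 1)))"
    and tail: "\<And>R. R > 0 \<Longrightarrow> (LBINT x. indicator {x. R \<le> norm x} x * norm (x::real^'n) powr (- (?d + 1))) \<le> Ct * R powr (- 1)"
    by (rule radial_tail[of 1, where 'n = 'n]) (simp, blast)
  define k1 where "k1 = sqrt (?V * 4 ^ CARD('n) + Iq) * ?\<omega>"
  define D where "D = ?d * (5 * ?d + ?d\<^sup>2) * 2 * 2 powr (?d + 1)"
  define k2 where "k2 = D * (Ct + Iq) * sqrt (?V * 2 ^ CARD('n))"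
  define k3 where "k3 = (\<mu> + \<bar>\<mu> + lam\<bar>) * ?d\<^sup>2 * L2norm G * ?\<omega>"
  have D: "D \<ge> 0" by (simp add: D_def)
  have k: "k1 \<ge> 0" "k2 \<ge> 0" "k3 \<ge> 0"
    unfolding k1_def k2_def k3_def using V D Ct om mu_pos L2norm_nonneg[of G] by auto
  define b where "b = M * (?d\<^sup>2 * (k1 + k2)) + k3"
  have b: "b \<ge> 0" unfolding b_def using k M_nonneg by simp
  have C: "b / ?\<omega> \<ge> 0" using b om by simp
  show thesis
  proof (rule that[OF C])
    fix R :: real assume R1: "R \<ge> 1"
    then have R: "R > 0" by simp
    have R\<alpha>: "R powr \<alpha> \<ge> 1" using R1 \<alpha> by (simp add: ge_one_powr_ge_zero)
    obtain c g N where c: "c \<ge> 0" and nf: "\<And>e. e > 0 \<Longrightarrow> newton_field e (2 * R) g"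
      and N: "N \<ge> 0" "L2norm g \<le> N" "L2norm (\<lambda>x. indicator (cball 0 R) x * \<bar>P x - c\<bar>) \<le> N"
      and lim: "\<And>B. (\<And>e. e > 0 \<Longrightarrow> (LBINT x. P x * conv (newton_div e) g x) \<le> B) \<Longrightarrow> ?\<omega> * N\<^sup>2 \<le> B"
      by (rule pressure_mean[OF R]) blast
    have "(LBINT x. P x * conv (newton_div e) g x) \<le> b * R powr \<alpha> * N" if e: "e > 0" for e
    proof -
      interpret newton_field e "2 * R" g by (rule nf[OF e])
      define L where "L = (LBINT y. \<bar>g y\<bar>)"
      have L0: "L \<ge> 0" by (simp add: L_def)
      have L: "L \<le> N * (sqrt (?V * 2 ^ CARD('n)) * R powr (?d / 2))"
      proof -
        have Lg: "L2 g" using integrable_csupp[OF continuous_on_power[OF g(1), of 2]] csupp_g g(1)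
          by (auto simp: L2_def borel_measurable_continuous_onI power2_eq_square csupp_def)
        have Li: "L2 (\<lambda>x. indicator (cball (0::real^'n) (2 * R)) x * 1)" by (rule L2_cball) simp
        have "L = (LBINT y. \<bar>g y * (indicator (cball 0 (2 * R)) y * 1)\<bar>)"
          unfolding L_def using g(2) by (intro Bochner_Integration.integral_cong) (auto simp: indicator_def)
        also have "\<dots> \<le> L2norm g * L2norm (\<lambda>x. indicator (cball (0::real^'n) (2 * R)) x * 1)"
          by (rule L2_mult(2)[OF Lg Li])
        also have "L2norm (\<lambda>x. indicator (cball (0::real^'n) (2 * R)) x * 1) = sqrt (?V * (2 * R) ^ CARD('n))"
        proof -
          have "(\<lambda>x::real^'n. (indicator (cball 0 (2 * R)) x * 1 :: real)\<^sup>2) = indicator (cball 0 (2 * R))" by (auto simp: indicator_def)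
          then show ?thesis unfolding L2norm_def using integral_indicator_cball[of "2 * R", where 'n = 'n] R by simp
        qed
        also have "\<dots> = sqrt (?V * 2 ^ CARD('n)) * R powr (?d / 2)"
        proof -
          have "sqrt (R ^ CARD('n)) = R powr (?d / 2)"
            using R by (simp add: powr_half_sqrt[symmetric] powr_powr powr_realpow[symmetric])
          then show ?thesis by (simp only: power_mult_distrib real_sqrt_mult mult.assoc)
        qed
        also have "L2norm g * (sqrt (?V * 2 ^ CARD('n)) * R powr (?d / 2)) \<le> N * (sqrt (?V * 2 ^ CARD('n)) * R powr (?d / 2))"
          using N V by (intro mult_right_mono) auto
        finally show ?thesis .
      qed
      let ?in = "\<lambda>x. indicator (cball 0 (4 * R)) x * usq x"
      let ?t = "R powr (- 2 * ?d / q)"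
      \<comment> \<open>Majorant outside the ball: \<open>usq\<close> is interpolated at scale
        \<open>R\<close>; its constant part meets the integrable tail, its \<open>q\<close>-part the
        pointwise decay, which gives \<open>R powr (- 1)\<close>.\<close>
      define Y where "Y x = D * R * L * ?t * (indicator {x. R \<le> norm x} x * norm x powr (- (?d + 1)) + R powr (- 1) * usq x powr (q / 2))" for x :: "real^'n"
      have IY: "integrable lborel Y" unfolding Y_def
        by (intro integrable_mult_right Bochner_Integration.integrable_add It R Lq_integrable)
      have Y0: "Y x \<ge> 0" for x unfolding Y_def using D R L0 by (intro mult_nonneg_nonneg add_nonneg_nonneg) auto
      have pw: "\<bar>u i x * u j x * partial i (w j) x\<bar> \<le> \<bar>?in x * partial i (w j) x\<bar> + Y x" for i j x
      proof -
        have "\<bar>u i x * u j x\<bar> \<le> U x * U x" unfolding abs_mult using usq_nonneg by (intro mult_mono abs_u_le) auto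
        also have "\<dots> = usq x" using usq_nonneg[of x] by simp
        finally have uu: "\<bar>u i x * u j x * partial i (w j) x\<bar> \<le> usq x * \<bar>partial i (w j) x\<bar>"
          unfolding abs_mult[of _ "partial i (w j) x"] by (rule mult_right_mono) simp
        show ?thesis
        proof (cases "norm x \<le> 4 * R")
          case True
          have "\<bar>?in x * partial i (w j) x\<bar> = usq x * \<bar>partial i (w j) x\<bar>" using True usq_nonneg[of x] by (simp add: abs_mult)
          then show ?thesis using uu Y0[of x] by linarith
        next
          case False
          let ?n = "norm x powr (- (?d + 1))"
          have x: "norm x > 4 * R" "norm x > 0" using False R by auto
          have "(norm x / 2) powr (- (?d + 1)) = 2 powr (?d + 1) * ?n"
            using x by (simp only: powr_minus powr_divide inverse_divide) (simp add: divide_inverse)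
          moreover have "\<bar>partial i (w j) x\<bar> \<le> ?d * (5 * ?d + ?d\<^sup>2) * (2 * R) * (norm x / 2) powr (- (?d + 1)) * L"
            unfolding L_def by (rule partial_w_decay) (use False in simp)
          ultimately have dw: "\<bar>partial i (w j) x\<bar> \<le> D * R * L * ?n" by (simp add: D_def mult_ac)
          have Rn: "R powr ?d * ?n \<le> R powr (- 1)"
          proof -
            have "?n \<le> R powr (- (?d + 1))" using x R by (intro powr_mono2') auto
            then have "R powr ?d * ?n \<le> R powr ?d * R powr (- (?d + 1))" by (intro mult_left_mono) auto
            also have "\<dots> = R powr (- 1)" unfolding powr_add[symmetric] by simp
            finally show ?thesis .
          qed
          have "usq x * \<bar>partial i (w j) x\<bar> \<le> (?t * (1 + R powr ?d * usq x powr (q / 2))) * (D * R * L * ?n)"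
            using usq_le_scaled[OF R zero_less_one, of x] dw D R L0 by (intro mult_mono) auto
          also have "\<dots> = D * R * L * ?t * (?n + (R powr ?d * ?n) * usq x powr (q / 2))" by (simp add: algebra_simps)
          also have "\<dots> \<le> D * R * L * ?t * (?n + R powr (- 1) * usq x powr (q / 2))"
            using D R L0 Rn by (intro mult_left_mono add_mono mult_right_mono) auto
          also have "\<dots> = Y x" using x R by (simp add: Y_def)
          finally show ?thesis using uu by linarith
        qed
      qed
      note Lin = L2_cball[OF cont_usq, of "4 * R"]
      have Iin: "integrable lborel (\<lambda>x. \<bar>?in x * partial i (w j) x\<bar>)" for i j
        by (intro integrable_abs L2_mult(1) Lin L2_partial_w)
      have IinY: "integrable lborel (\<lambda>x. \<bar>?in x * partial i (w j) x\<bar> + Y x)" for i j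
        by (intro Bochner_Integration.integrable_add Iin IY)
      have I1: "integrable lborel (\<lambda>x. u i x * u j x * partial i (w j) x)" for i j
      proof (rule Bochner_Integration.integrable_bound[OF IinY[of i j]])
        show "(\<lambda>x. u i x * u j x * partial i (w j) x) \<in> borel_measurable lborel"
          by (simp, intro borel_measurable_continuous_onI continuous_on_mult cont_u C1_continuous[OF C1_partial_w])
        show "AE x in lborel. norm (u i x * u j x * partial i (w j) x) \<le> norm (\<bar>?in x * partial i (w j) x\<bar> + Y x)"
          unfolding real_norm_def by (intro AE_I2 order_trans[OF pw abs_ge_self])
      qed
      have A1: "(LBINT x. \<bar>u i x * u j x * partial i (w j) x\<bar>) \<le> (k1 + k2) * (R powr \<alpha> * N)" for i j
      proof -
        have "(LBINT x. \<bar>u i x * u j x * partial i (w j) x\<bar>) \<le> (LBINT x. \<bar>?in x * partial i (w j) x\<bar> + Y x)"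
          by (intro integral_mono integrable_abs I1 IinY pw)
        also have "\<dots> = (LBINT x. \<bar>?in x * partial i (w j) x\<bar>) + (LBINT x. Y x)"
          by (intro Bochner_Integration.integral_add Iin IY)
        also have "(LBINT x. \<bar>?in x * partial i (w j) x\<bar>) \<le> k1 * (R powr \<alpha> * N)"
        proof -
          have "(LBINT x. \<bar>?in x * partial i (w j) x\<bar>) \<le> L2norm ?in * L2norm (partial i (w j))"
            by (rule L2_mult(2)[OF Lin L2_partial_w(1)])
          also have "\<dots> \<le> (sqrt (?V * 4 ^ CARD('n) + Iq) * R powr \<alpha>) * (?\<omega> * L2norm g)"
            unfolding \<alpha>_def using V by (intro mult_mono usq_L2_cball q4 R L2_partial_w L2norm_nonneg) auto
          also have "\<dots> \<le> (sqrt (?V * 4 ^ CARD('n) + Iq) * R powr \<alpha>) * (?\<omega> * N)"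
            using V om N by (intro mult_left_mono) auto
          finally show ?thesis by (simp add: k1_def mult_ac)
        qed
        also have "(LBINT x. Y x) \<le> k2 * (R powr \<alpha> * N)"
        proof -
          have "(LBINT x. Y x) = D * R * L * ?t * ((LBINT x. indicator {x. R \<le> norm x} x * norm (x::real^'n) powr (- (?d + 1))) + R powr (- 1) * Iq)"
            unfolding Y_def using It[OF R] Lq_integrable by simp
          also have "\<dots> \<le> D * R * L * ?t * (Ct * R powr (- 1) + R powr (- 1) * Iq)"
            using D R L0 by (intro mult_left_mono add_mono tail) auto
          also have "\<dots> = D * (Ct + Iq) * ?t * L" using R by (simp add: powr_minus field_simps)
          also have "\<dots> \<le> D * (Ct + Iq) * ?t * (N * (sqrt (?V * 2 ^ CARD('n)) * R powr (?d / 2)))"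
            using D Ct by (intro mult_left_mono L) auto
          also have "\<dots> = k2 * N * (R powr (?d / 2) * ?t)" by (simp add: k2_def mult_ac)
          also have "R powr (?d / 2) * ?t = R powr \<alpha>"
            unfolding powr_add[symmetric] \<alpha>_def by (rule arg_cong[where f = "(powr) R"]) simp
          finally show ?thesis by (simp add: mult_ac)
        qed
        finally show ?thesis by (simp add: distrib_right)
      qed
      \<comment> \<open>The trivial splitting, with \<open>a\<close> the velocity and
        \<open>b\<close> equal to 0.\<close>
      have "(LBINT x. P x * conv (newton_div e) g x) \<le> M * (\<Sum>i\<in>UNIV. \<Sum>j\<in>UNIV. LBINT x. \<bar>u i x * u j x * partial i (w j) x\<bar>)
         + M * (\<Sum>i\<in>(UNIV::'n set). \<Sum>j\<in>UNIV. LBINT x. \<bar>u i x * partial i (\<lambda>x. 0) x * w j x\<bar>)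
         + (\<mu> + \<bar>\<mu> + lam\<bar>) * ?d\<^sup>2 * L2norm G * (?\<omega> * L2norm g)"
        by (rule pressure_test[OF nf[OF e] u C1_const _ abs_u_le I1]) simp_all
      also have "\<dots> \<le> M * (\<Sum>i\<in>(UNIV::'n set). \<Sum>j\<in>(UNIV::'n set). (k1 + k2) * (R powr \<alpha> * N)) + M * 0
         + (\<mu> + \<bar>\<mu> + lam\<bar>) * ?d\<^sup>2 * L2norm G * (?\<omega> * N)"
        using M_nonneg mu_pos om N L2norm_nonneg[of G]
        by (intro add_mono mult_left_mono sum_mono A1) auto
      also have "\<dots> = M * (?d\<^sup>2 * (k1 + k2)) * (R powr \<alpha> * N) + k3 * (1 * N)"
        by (simp add: k3_def power2_eq_square mult_ac)
      also have "\<dots> \<le> M * (?d\<^sup>2 * (k1 + k2)) * (R powr \<alpha> * N) + k3 * (R powr \<alpha> * N)"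
        using k N R\<alpha> by (intro add_left_mono mult_left_mono mult_right_mono) auto
      finally show ?thesis by (simp add: b_def algebra_simps)
    qed
    then have "?\<omega> * N\<^sup>2 \<le> b * R powr \<alpha> * N" by (rule lim)
    then have "N\<^sup>2 \<le> 0 + b * R powr \<alpha> / ?\<omega> * N" using om by (simp add: field_simps)
    then have "N \<le> b * R powr \<alpha> / ?\<omega> + sqrt 0" using b om N by (intro le_of_square_le_affine) auto
    then show "\<exists>c\<ge>0. L2norm (\<lambda>x. indicator (cball 0 R) x * \<bar>P x - c\<bar>) \<le> b / ?\<omega> * R powr \<alpha>"
      using c N by (intro exI[of _ c]) auto
  qed
qed

section \<open>Vanishing of the velocity gradient\<close>

lemma annulus_tendsto_0:
  fixes f :: "real^'n \<Rightarrow> real"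
  assumes f: "integrable lborel f"
  shows "(\<lambda>n. LBINT x. indicator (annulus (real (Suc n))) x * f x) \<longlonglongrightarrow> 0"
proof -
  have "(\<lambda>n. LBINT x. indicator (annulus (real (Suc n))) x * f x) \<longlonglongrightarrow> (\<integral>x. 0 \<partial>(lborel :: (real^'n) measure))"
  proof (rule integral_dominated_convergence[where w = "\<lambda>x. \<bar>f x\<bar>"])
    show "AE x in lborel. (\<lambda>n. indicator (annulus (real (Suc n))) x * f x) \<longlonglongrightarrow> 0"
    proof (intro AE_I2 tendsto_eventually)
      fix x :: "real^'n"
      obtain N :: nat where "norm x \<le> real N" using real_arch_simple by blast
      then show "\<forall>\<^sub>F n in sequentially. indicator (annulus (real (Suc n))) x * f x = 0"
        unfolding eventually_sequentially by (intro exI[of _ N]) (auto simp: annulus_def indicator_def)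
    qed
    show "(\<lambda>x. indicator (annulus (real (Suc n))) x * f x) \<in> borel_measurable lborel" for n
      using f annulus_borel by (intro borel_measurable_times borel_measurable_indicator) auto
  qed (use f in \<open>auto simp: indicator_def\<close>)
  then show ?thesis by simp
qed

text \<open>The hypothesis \<open>dim\<close> makes the powers of \<open>R\<close> cancel when the
  interpolation is used on an annulus. What remains is \<open>\<delta>\<close> times a constant plus
  a multiple of the tail of a convergent integral: \<open>\<delta>\<close> is chosen small first,
  then \<open>n\<close> large.\<close>

lemma U_annulus_tendsto:
  assumes dim: "2 * \<alpha> - 2 + real CARD('n) - 2 * real CARD('n) / q = 0"
  shows "(\<lambda>n. real (Suc n) powr (\<alpha> - 1) * L2norm (\<lambda>x. indicator (annulus (real (Suc n))) x * U x)) \<longlonglongrightarrow> 0"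
proof -
  let ?d = "real CARD('n)"
  let ?V = "unit_ball_vol ?d"
  let ?R = "\<lambda>n. real (Suc n)"
  have V: "?V \<ge> 0" by (simp add: unit_ball_vol_def)
  define a where "a n = ?R n powr (2 * \<alpha> - 2) * (LBINT x. indicator (annulus (?R n)) x * usq x)" for n
  define J where "J n = (LBINT x. indicator (annulus (?R n)) x * usq x powr (q / 2))" for n
  have J: "J \<longlonglongrightarrow> 0" unfolding J_def by (rule annulus_tendsto_0[OF Lq_integrable])
  have a0: "a n \<ge> 0" for n unfolding a_def using usq_nonneg by (intro mult_nonneg_nonneg Bochner_Integration.integral_nonneg) auto
  have ale: "a n \<le> \<delta> * (?V * 2 ^ CARD('n)) + \<delta> powr (1 - q / 2) * J n" if \<delta>: "\<delta> > 0" for \<delta> n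
  proof -
    let ?r = "?R n"
    let ?A = "\<lambda>x::real^'n. indicator (annulus ?r) x :: real"
    let ?t = "?r powr (- 2 * ?d / q)"
    let ?c = "\<delta> powr (1 - q / 2)"
    have r: "?r > 0" by simp
    have IA: "integrable lborel (\<lambda>x. ?A x * (\<delta> + ?c * (?r powr ?d * usq x powr (q / 2))))"
      by (intro integrable_annulus continuous_intros continuous_on_powr' cont_usq) (use q usq_nonneg in auto)
    have IA1: "integrable lborel (\<lambda>x::real^'n. ?A x * 1)" by (intro integrable_annulus) simp
    have IA2: "integrable lborel (\<lambda>x. ?A x * usq x powr (q / 2))"
      by (intro integrable_annulus continuous_on_powr' cont_usq) (use q usq_nonneg in auto)
    have "(LBINT x. ?A x * usq x) \<le> (LBINT x. ?t * (?A x * (\<delta> + ?c * (?r powr ?d * usq x powr (q / 2)))))"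
    proof (rule integral_mono)
      show "integrable lborel (\<lambda>x. ?A x * usq x)" by (intro integrable_annulus cont_usq)
      show "integrable lborel (\<lambda>x. ?t * (?A x * (\<delta> + ?c * (?r powr ?d * usq x powr (q / 2)))))"
        by (rule integrable_mult_right[OF IA])
      show "?A x * usq x \<le> ?t * (?A x * (\<delta> + ?c * (?r powr ?d * usq x powr (q / 2))))" for x
        using usq_le_scaled[OF r \<delta>, of x] by (simp add: indicator_def)
    qed
    also have "\<dots> = ?t * (LBINT x. ?A x * (\<delta> + ?c * (?r powr ?d * usq x powr (q / 2))))"
      by (rule integral_mult_right_zero)
    also have "(\<lambda>x. ?A x * (\<delta> + ?c * (?r powr ?d * usq x powr (q / 2)))) = (\<lambda>x. \<delta> * (?A x * 1) + ?c * (?r powr ?d) * (?A x * usq x powr (q / 2)))"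
      by (rule ext) (simp add: indicator_def)
    also have "?t * (LBINT x. \<delta> * (?A x * 1) + ?c * (?r powr ?d) * (?A x * usq x powr (q / 2))) = ?t * (\<delta> * (LBINT x. ?A x * 1) + ?c * (?r powr ?d) * J n)"
      using IA1 IA2 unfolding J_def by (subst Bochner_Integration.integral_add) auto
    also have "\<dots> \<le> ?t * (\<delta> * (1 * (?V * (2 * ?r) ^ CARD('n))) + ?c * (?r powr ?d) * J n)"
      using \<delta> by (intro mult_left_mono add_right_mono integral_annulus_le) auto
    also have "(2 * ?r) ^ CARD('n) = 2 ^ CARD('n) * ?r powr ?d"
      unfolding power_mult_distrib powr_realpow[OF r] ..
    finally have "a n \<le> ?r powr (2 * \<alpha> - 2) * (?t * (\<delta> * (1 * (?V * (2 ^ CARD('n) * ?r powr ?d))) + ?c * (?r powr ?d) * J n))"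
      unfolding a_def by (intro mult_left_mono) auto
    also have "\<dots> = (?r powr (2 * \<alpha> - 2) * ?t * ?r powr ?d) * (\<delta> * (?V * 2 ^ CARD('n)) + ?c * J n)" by (simp add: algebra_simps)
    also have "?r powr (2 * \<alpha> - 2) * ?t * ?r powr ?d = ?r powr 0"
      unfolding powr_add[symmetric] by (rule arg_cong[where f = "(powr) ?r"]) (use dim in simp)
    finally show ?thesis by simp
  qed
  have "a \<longlonglongrightarrow> 0"
  proof (rule LIMSEQ_I)
    fix \<eta> :: real assume \<eta>: "\<eta> > 0"
    define \<delta> where "\<delta> = \<eta> / (2 * (?V * 2 ^ CARD('n) + 1))"
    have p: "?V * 2 ^ CARD('n) + 1 > 0" using V by (simp add: add_nonneg_pos)
    have \<delta>: "\<delta> > 0" using \<eta> p by (simp add: \<delta>_def)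
    have 1: "\<delta> * (?V * 2 ^ CARD('n)) \<le> \<eta> / 2"
    proof -
      have "\<delta> * (?V * 2 ^ CARD('n)) \<le> \<delta> * (?V * 2 ^ CARD('n) + 1)" using \<delta> by (intro mult_left_mono) auto
      also have "\<dots> = \<eta> / 2" using p by (simp add: \<delta>_def field_simps)
      finally show ?thesis .
    qed
    have "(\<lambda>n. \<delta> powr (1 - q / 2) * J n) \<longlonglongrightarrow> \<delta> powr (1 - q / 2) * 0" by (intro tendsto_intros J)
    then have "\<forall>\<^sub>F n in sequentially. \<delta> powr (1 - q / 2) * J n < \<eta> / 2" using \<eta> by (intro order_tendstoD(2)) auto
    then obtain n0 where n0: "\<And>n. n \<ge> n0 \<Longrightarrow> \<delta> powr (1 - q / 2) * J n < \<eta> / 2" unfolding eventually_sequentially by blast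
    show "\<exists>no. \<forall>n\<ge>no. norm (a n - 0) < \<eta>"
    proof (intro exI[of _ n0] allI impI)
      fix n assume "n \<ge> n0"
      then show "norm (a n - 0) < \<eta>" using ale[OF \<delta>, of n] 1 n0[of n] a0[of n] by simp
    qed
  qed
  then have "(\<lambda>n. sqrt (a n)) \<longlonglongrightarrow> sqrt 0" by (rule tendsto_real_sqrt)
  moreover have "sqrt (a n) = ?R n powr (\<alpha> - 1) * L2norm (\<lambda>x. indicator (annulus (?R n)) x * U x)" for n
  proof -
    have "(indicator (annulus (?R n)) x * U x)\<^sup>2 = indicator (annulus (?R n)) x * usq x" for x
      using usq_nonneg[of x] by (simp add: indicator_def)
    moreover have "sqrt (?R n powr (2 * \<alpha> - 2)) = ?R n powr (\<alpha> - 1)"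
      by (simp add: powr_half_sqrt[symmetric] powr_powr algebra_simps)
    ultimately show ?thesis unfolding a_def L2norm_def by (simp add: real_sqrt_mult)
  qed
  ultimately show ?thesis by simp
qed

lemma integral_divu_sq_le:
  assumes \<alpha>: "\<alpha> \<ge> 0" and dim: "2 * \<alpha> - 2 + real CARD('n) - 2 * real CARD('n) / q = 0"
  shows "(LBINT x. (divu x)\<^sup>2) \<le> (LBINT x. gsq x)"
proof (rule integral_divu_sq_le_aux, rule Lim_null_comparison[OF _ U_annulus_tendsto[OF dim]])
  have "1 / real (Suc n) * l \<le> real (Suc n) powr (\<alpha> - 1) * l" if "l \<ge> 0" for n l
  proof (intro mult_right_mono that)
    have "real (Suc n) powr (- 1) \<le> real (Suc n) powr (\<alpha> - 1)" using \<alpha> by (intro powr_mono) auto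
    then show "1 / real (Suc n) \<le> real (Suc n) powr (\<alpha> - 1)" by (simp add: powr_minus_divide)
  qed
  then show "\<forall>\<^sub>F n in sequentially. norm (1 / real (Suc n) * L2norm (\<lambda>x. indicator (annulus (real (Suc n))) x * U x))
     \<le> real (Suc n) powr (\<alpha> - 1) * L2norm (\<lambda>x. indicator (annulus (real (Suc n))) x * U x)"
    by (intro always_eventually allI) (simp add: L2norm_nonneg)
qed

text \<open>The relation holds for \<open>q = 6\<close> in dimension 2 and \<open>q = 9/2\<close> in
  dimension 3. For the growth exponent \<open>\<alpha>\<close> of the local L2 norms it is
  equivalent to the scale invariance that \<open>U_annulus_tendsto\<close> asks for, so the
  untruncated energy, \<open>\<epsilon> = 0\<close>, has vanishing flux.\<close>

lemma gsq_eq_0_low: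
  assumes q4: "q > 4" and dim: "q * (real CARD('n) - 1) = 3 * real CARD('n)"
  shows "gsq x = 0"
proof -
  define \<alpha> where "\<alpha> = real CARD('n) / 2 - 2 * real CARD('n) / q"
  have \<alpha>: "\<alpha> \<ge> 0" using q4 card_ge_1 by (simp add: \<alpha>_def field_simps)
  have dim': "2 * \<alpha> - 2 + real CARD('n) - 2 * real CARD('n) / q = 0"
  proof -
    have y: "real CARD('n) / q = (real CARD('n) - 1) / 3" using dim q4 by (simp add: field_simps)
    show ?thesis unfolding \<alpha>_def times_divide_eq_right[symmetric] y by (simp add: field_simps)
  qed
  obtain C where C: "C \<ge> 0" "\<And>R. R \<ge> 1 \<Longrightarrow> \<exists>c\<ge>0. L2norm (\<lambda>x. indicator (cball 0 R) x * \<bar>P x - c\<bar>) \<le> C * R powr \<alpha>"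
    unfolding \<alpha>_def by (rule pressure_L2_growth[OF q4]) blast
  have "\<forall>n. \<exists>c\<ge>0. L2norm (\<lambda>x. indicator (cball 0 (2 * real (Suc n))) x * \<bar>P x - c\<bar>) \<le> C * (2 * real (Suc n)) powr \<alpha>"
    by (intro allI C(2)) simp
  from choice[OF this] obtain c where c: "\<And>n. c n \<ge> 0"
    "\<And>n. L2norm (\<lambda>x. indicator (cball 0 (2 * real (Suc n))) x * \<bar>P x - c n\<bar>) \<le> C * (2 * real (Suc n)) powr \<alpha>"
    by blast
  define Cu where "Cu = sqrt (unit_ball_vol (real CARD('n)) * 4 ^ CARD('n) + Iq)"
  have S: "L2norm (\<lambda>x. indicator (cball 0 (2 * real (Suc n))) x * \<Psi> 0 x) \<le> Cu * real (Suc n) powr \<alpha>" for n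
  proof -
    have "L2norm (\<lambda>x. indicator (cball 0 (2 * real (Suc n))) x * \<Psi> 0 x) \<le> L2norm (\<lambda>x. indicator (cball 0 (4 * real (Suc n))) x * usq x)"
    proof (rule L2_mono(2)[OF L2_cball[OF cont_usq]])
      show "(\<lambda>x. indicator (cball 0 (2 * real (Suc n))) x * \<Psi> 0 x) \<in> borel_measurable borel"
        using L2_cball[OF cont_\<Psi>[of 0], of "2 * real (Suc n)"] unfolding L2_def by simp
      show "\<bar>indicator (cball 0 (2 * real (Suc n))) x * \<Psi> 0 x\<bar> \<le> \<bar>indicator (cball 0 (4 * real (Suc n))) x * usq x\<bar>" for x
        by (auto simp: \<Psi>_def indicator_def)
    qed
    then show ?thesis using usq_L2_cball[OF q4, of "real (Suc n)"] by (simp add: Cu_def \<alpha>_def)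
  qed
  have T: "L2norm (\<lambda>x. indicator (cball 0 (2 * real (Suc n))) x * \<bar>P x - c n\<bar>) \<le> (C * 2 powr \<alpha>) * real (Suc n) powr \<alpha>" for n
  proof -
    have "(2 * real (Suc n)) powr \<alpha> = 2 powr \<alpha> * real (Suc n) powr \<alpha>" by (rule powr_mult; simp)
    then show ?thesis using c(2)[of n] by (simp only: mult.assoc)
  qed
  have "(LBINT x. (\<mu> * gsq x + (\<mu> + lam) * (divu x)\<^sup>2) * \<psi> 0 x) \<le> 0"
  proof -
    have "L2norm (\<lambda>x. 0 * \<Psi> 0 x * G x) = 0" by (simp add: L2norm_def)
    moreover have "C * 2 powr \<alpha> \<ge> 0" using C(1) by simp
    ultimately show ?thesis
      using energy_limit[OF order_refl \<alpha> _ c(1) T S U_annulus_tendsto[OF dim'] disjI1[OF refl]] by simp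
  qed
  then have "(LBINT x. \<mu> * gsq x + (\<mu> + lam) * (divu x)\<^sup>2) \<le> 0" by (simp add: \<psi>_def)
  then show ?thesis by (rule gsq_eq_0[OF _ integral_divu_sq_le[OF \<alpha> dim']])
qed

text \<open>Here \<open>\<alpha> = 0\<close> and \<open>q\<close> is the Sobolev exponent. The
  radius goes to infinity first, for fixed \<open>\<epsilon>\<close>, and leaves the truncation
  error with a factor \<open>?K\<close> independent of \<open>\<epsilon>\<close>; then
  \<open>\<epsilon>\<close> goes to 0 by dominated convergence, with majorants from the velocity
  gradient.\<close>

lemma gsq_eq_0_high:
  assumes d3: "CARD('n) \<ge> 3" and q4: "q \<le> 4" and dim: "q * (real CARD('n) - 2) = 2 * real CARD('n)"
  shows "gsq x = 0"
proof -
  have dim': "2 * 0 - 2 + real CARD('n) - 2 * real CARD('n) / q = 0"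
    using dim q by (simp add: field_simps)
  obtain C where C: "C \<ge> 0" "\<And>R. R > 0 \<Longrightarrow> \<exists>c\<ge>0. L2norm (\<lambda>x. indicator (cball 0 R) x * \<bar>P x - c\<bar>) \<le> C"
    by (rule pressure_L2_bounded[OF d3 q4]) blast
  have "\<forall>n. \<exists>c\<ge>0. L2norm (\<lambda>x. indicator (cball 0 (2 * real (Suc n))) x * \<bar>P x - c\<bar>) \<le> C"
    by (intro allI C(2)) simp
  from choice[OF this] obtain c where c: "\<And>n. c n \<ge> 0"
    "\<And>n. L2norm (\<lambda>x. indicator (cball 0 (2 * real (Suc n))) x * \<bar>P x - c n\<bar>) \<le> C"
    by blast
  let ?K = "((M + \<gamma> / (\<gamma> - 1) + \<mu> + \<bar>\<mu> + lam\<bar>) * (real CARD('n))\<^sup>2) * (4 * real CARD('n) * (C + L2norm G))"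
  let ?F = "\<lambda>x. \<mu> * gsq x + (\<mu> + lam) * (divu x)\<^sup>2"
  define e where "e n = inverse (real (Suc n))" for n
  have e: "e n > 0" for n by (simp add: e_def)
  have e0: "e \<longlonglongrightarrow> 0" unfolding e_def by (rule LIMSEQ_inverse_real_of_nat)
  have E: "(LBINT x. ?F x * \<psi> \<epsilon> x) \<le> ?K * L2norm (\<lambda>x. \<epsilon> * \<Psi> \<epsilon> x * G x)" if \<epsilon>: "\<epsilon> > 0" for \<epsilon>
  proof -
    \<comment> \<open>\<open>C'\<close> depends on \<open>\<epsilon>\<close>, but it multiplies only
      the boundary term and disappears in the limit of large radii.\<close>
    define C' where "C' = L2norm (\<Psi> \<epsilon>)"
    have S: "L2norm (\<lambda>x. indicator (cball 0 (2 * real (Suc n))) x * \<Psi> \<epsilon> x) \<le> C' * real (Suc n) powr 0" for n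
    proof -
      have "L2norm (\<lambda>x. indicator (cball 0 (2 * real (Suc n))) x * \<Psi> \<epsilon> x) \<le> C'"
        unfolding C'_def
      proof (rule L2_mono(2)[OF \<Psi>_L2(1)[OF \<epsilon> q4]])
        show "(\<lambda>x. indicator (cball 0 (2 * real (Suc n))) x * \<Psi> \<epsilon> x) \<in> borel_measurable borel"
          using L2_cball[OF cont_\<Psi>[of \<epsilon>], of "2 * real (Suc n)"] \<epsilon> unfolding L2_def by simp
      qed (auto simp: indicator_def)
      then show ?thesis by simp
    qed
    have T: "L2norm (\<lambda>x. indicator (cball 0 (2 * real (Suc n))) x * \<bar>P x - c n\<bar>) \<le> C * real (Suc n) powr 0" for n
      using c(2)[of n] by simp
    show ?thesis
      using energy_limit[OF less_imp_le[OF \<epsilon>] order_refl C(1) c(1) T S U_annulus_tendsto[OF dim'] disjI2[OF refl]]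
      by (simp only: mult.assoc)
  qed
  have den: "(\<lambda>n. 1 + e n * usq x) \<longlonglongrightarrow> 1" for x
    using tendsto_add[OF tendsto_const[of 1] tendsto_mult_right[OF e0, of "usq x"]] by simp
  have l1: "(\<lambda>n. LBINT x. ?F x * \<psi> (e n) x) \<longlonglongrightarrow> (LBINT x. ?F x)"
  proof (rule integral_dominated_convergence[where w = "\<lambda>x. \<bar>?F x\<bar>"])
    show "integrable lborel (\<lambda>x. \<bar>?F x\<bar>)" using gsq_integrable divu_sq_integrable by auto
    show "?F \<in> borel_measurable lborel" by (simp, intro borel_measurable_continuous_onI continuous_intros cont_gsq cont_divu)
    show "(\<lambda>x. ?F x * \<psi> (e n) x) \<in> borel_measurable lborel" for n
      using less_imp_le[OF e] by (simp, intro borel_measurable_continuous_onI continuous_intros cont_gsq cont_divu C1_continuous[OF C1_\<psi>])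
    show "AE x in lborel. (\<lambda>n. ?F x * \<psi> (e n) x) \<longlonglongrightarrow> ?F x"
    proof (intro AE_I2)
      fix x
      have "(\<lambda>n. ?F x * (1 / (1 + e n * usq x)\<^sup>2)) \<longlonglongrightarrow> ?F x * (1 / 1\<^sup>2)"
        by (intro tendsto_intros den) simp
      then show "(\<lambda>n. ?F x * \<psi> (e n) x) \<longlonglongrightarrow> ?F x" by (simp add: \<psi>_def)
    qed
    show "AE x in lborel. norm (?F x * \<psi> (e n) x) \<le> \<bar>?F x\<bar>" for n
      unfolding real_norm_def abs_mult abs_of_nonneg[OF \<psi>_range(1)[OF less_imp_le[OF e]]]
      by (intro AE_I2 mult_left_le \<psi>_range[OF less_imp_le[OF e]]) auto
  qed
  have l2: "(\<lambda>n. L2norm (\<lambda>x. e n * \<Psi> (e n) x * G x)) \<longlonglongrightarrow> 0"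
  proof -
    have "(\<lambda>n. LBINT x. (e n * \<Psi> (e n) x * G x)\<^sup>2) \<longlonglongrightarrow> (\<integral>x. 0 \<partial>(lborel :: (real^'n) measure))"
    proof (rule integral_dominated_convergence[where w = gsq])
      show "(\<lambda>x. (e n * \<Psi> (e n) x * G x)\<^sup>2) \<in> borel_measurable lborel" for n
        using L2_\<Psi>_G[OF less_imp_le[OF e], of n] unfolding L2_def by auto
      show "AE x in lborel. (\<lambda>n. (e n * \<Psi> (e n) x * G x)\<^sup>2) \<longlonglongrightarrow> 0"
      proof (intro AE_I2)
        fix x
        have "(\<lambda>n. (e n * (usq x / (1 + e n * usq x)) * G x)\<^sup>2) \<longlonglongrightarrow> (0 * (usq x / 1) * G x)\<^sup>2"
          by (intro tendsto_intros den e0) simp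
        then show "(\<lambda>n. (e n * \<Psi> (e n) x * G x)\<^sup>2) \<longlonglongrightarrow> 0" by (simp add: \<Psi>_def)
      qed
      show "AE x in lborel. norm ((e n * \<Psi> (e n) x * G x)\<^sup>2) \<le> gsq x" for n
      proof (intro AE_I2)
        fix x
        have "\<bar>e n * \<Psi> (e n) x * G x\<bar>\<^sup>2 \<le> \<bar>G x\<bar>\<^sup>2" by (intro power_mono eps_Psi_G_le less_imp_le[OF e]) simp
        then show "norm ((e n * \<Psi> (e n) x * G x)\<^sup>2) \<le> gsq x" using gsq_nonneg[of x] by simp
      qed
    qed (use gsq_integrable in auto)
    then show ?thesis unfolding L2norm_def using tendsto_real_sqrt by fastforce
  qed
  have "(LBINT x. ?F x) \<le> ?K * 0"
    by (rule LIMSEQ_le[OF l1 tendsto_mult_left[OF l2]]) (use E[OF e] in auto)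
  then have "(LBINT x. ?F x) \<le> 0" by simp
  then show ?thesis by (rule gsq_eq_0[OF _ integral_divu_sq_le[OF order_refl dim']])
qed

end

theorem theorem1p1:
  fixes \<rho> :: "real^'n::finite \<Rightarrow> real"
    and v :: "real^'n \<Rightarrow> real^'n"
    and \<mu> lam A \<gamma> :: real
  assumes dim: "CARD('n) \<ge> 2"
    and mu_pos: "\<mu> > 0" and lam: "lam + 2 * \<mu> > 0" and A_pos: "A > 0" and gamma: "\<gamma> > 1"
    and rho_nonneg: "\<forall>x. \<rho> x \<ge> 0"
    and rho_smooth: "smooth \<rho>" and v_smooth: "smooth_vf v"
    and continuity: "\<forall>x. divergence (\<lambda>y. \<rho> y *\<^sub>R v y) x = 0"
    and momentum: "\<forall>x j. (\<Sum>i\<in>UNIV. partial i (\<lambda>y. \<rho> y * (v y $ i) * (v y $ j)) x)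
        = - partial j (\<lambda>y. A * \<rho> y powr \<gamma>) x
          + \<mu> * (\<Sum>i\<in>UNIV. partial i (partial i (\<lambda>y. v y $ j)) x)
          + (\<mu> + lam) * partial j (divergence v) x"
    and hyp4: "CARD('n) \<ge> 4 \<Longrightarrow> bounded (range \<rho>) \<and> Hdot1 v"
    and hyp3: "CARD('n) = 3 \<Longrightarrow> bounded (range \<rho>) \<and> grad_L2 v \<and> in_Lp (9/2) v"
    and hyp2: "CARD('n) = 2 \<Longrightarrow> bounded (range \<rho>) \<and> grad_L2 v \<and> in_Lp 6 v"
  shows "(\<forall>x. v x = 0) \<and> (\<exists>c. \<forall>x. \<rho> x = c)"
proof -
  let ?d = "real CARD('n)"
  let ?u = "\<lambda>j x. v x $ j"
  \<comment> \<open>The exponent in the last case is at most 4 exactly for dimension at least 4, as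
    \<open>gsq_eq_0_high\<close> demands; in the two other cases it exceeds 4.\<close>
  define q where "q = (if CARD('n) = 2 then 6 else if CARD('n) = 3 then 9 / 2 else 2 * ?d / (?d - 2))"
  consider (two) "CARD('n) = 2" | (three) "CARD('n) = 3" | (high) "CARD('n) \<ge> 4" using dim by linarith
  then have data: "bounded (range \<rho>) \<and> grad_L2 v \<and> in_Lp q v"
  proof cases
    case high
    then have "q = 2 * ?d / (?d - 2)" by (simp add: q_def)
    then show ?thesis using hyp4[OF high] by (simp add: Hdot1_def Let_def)
  qed (use hyp2 hyp3 in \<open>auto simp: q_def\<close>)
  then obtain M where "\<And>x. \<bar>\<rho> x\<bar> \<le> M" by (auto simp: bounded_iff)
  then have M: "\<rho> x \<le> M" for x by (rule order_trans[OF abs_ge_self])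
  have q2: "q > 2" using dim by (simp add: q_def divide_simps)
  have sm: "smooth (?u j)" for j using v_smooth by (simp add: smooth_vf_def)
  have nsq: "(\<Sum>i\<in>UNIV. (v x $ i)\<^sup>2) = (norm (v x))\<^sup>2" for x
    unfolding power2_norm_eq_inner inner_vec_def by (simp add: power2_eq_square)
  have npow: "((norm y)\<^sup>2) powr (q / 2) = norm y powr q" for y :: "real^'n"
  proof (cases "y = 0")
    case False
    then have "(norm y)\<^sup>2 = norm y powr 2" by simp
    then show ?thesis by (simp only: powr_powr) simp
  qed simp
  interpret flow \<rho> ?u \<mu> lam A \<gamma> M q
  proof unfold_locales
    show "C1 \<rho>" by (rule smooth_C1[OF rho_smooth])
    show "C1 (?u i)" for i by (rule smooth_C1[OF sm])
    show "C1 (partial i (?u j))" for i j by (intro smooth_C1 smooth_partial sm)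
    show "(\<Sum>i\<in>UNIV. partial i (\<lambda>y. \<rho> y * v y $ i) x) = 0" for x
      using continuity by (simp add: divergence_def)
    show "(\<Sum>i\<in>UNIV. partial i (\<lambda>y. \<rho> y * v y $ i * v y $ j) x) = - partial j (\<lambda>y. A * \<rho> y powr \<gamma>) x
       + \<mu> * (\<Sum>i\<in>UNIV. partial i (partial i (\<lambda>x. v x $ j)) x) + (\<mu> + lam) * partial j (\<lambda>y. \<Sum>i\<in>UNIV. partial i (\<lambda>x. v x $ i) y) x" for x j
      using momentum unfolding divergence_def[abs_def] by blast
    show "integrable lborel (\<lambda>x. \<Sum>i\<in>UNIV. \<Sum>j\<in>UNIV. (partial i (\<lambda>x. v x $ j) x)\<^sup>2)"
      using data unfolding grad_L2_def grad_sq_def[abs_def] by blast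
    show "integrable lborel (\<lambda>x. (\<Sum>i\<in>UNIV. (v x $ i)\<^sup>2) powr (q / 2))"
      unfolding nsq npow using data by (simp add: in_Lp_def)
  qed (use mu_pos lam A_pos gamma rho_nonneg M q2 in auto)
  have g0: "gsq x = 0" for x
  proof (cases "CARD('n) \<ge> 4")
    case True
    then have q: "q = 2 * ?d / (?d - 2)" by (simp add: q_def)
    have "?d \<ge> 4" using True by simp
    then show ?thesis using True by (intro gsq_eq_0_high) (auto simp: q field_simps)
  next
    case False
    then have "CARD('n) = 2 \<or> CARD('n) = 3" using dim by linarith
    then show ?thesis by (intro gsq_eq_0_low) (auto simp: q_def)
  qed
  have du0: "partial i (?u j) x = 0" for i j x using abs_du_le[of i j x] g0[of x] by simp
  have zero_const: "\<exists>c. \<forall>x. f x = c" if f: "smooth f" and p: "\<And>i x. partial i f x = 0" for f :: "real^'n \<Rightarrow> real"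
  proof -
    have "(f has_derivative (\<lambda>h. 0)) (at x within UNIV)" for x
      using differentiable_directional(1)[OF smooth_differentiable[OF f], of x] by (simp add: p)
    then show ?thesis using has_derivative_zero_constant[of UNIV f] by auto
  qed
  have "\<exists>c. \<forall>x. v x $ j = c" for j by (rule zero_const[OF sm du0])
  then obtain c where c: "\<And>x j. v x $ j = c j" by metis
  then have "usq x = usq 0" for x unfolding usq_def by simp
  note us = this
  \<comment> \<open>Space has infinite measure, so an integrable constant is 0.\<close>
  have "integrable lborel (\<lambda>x::real^'n. usq 0 powr (q / 2))" using Lq_integrable by (subst (asm) us)
  then have "usq 0 powr (q / 2) = 0"
    by (auto simp: integrable_iff_bounded ennreal_mult_top split: if_splits)
  then have "usq x = 0" for x using us[of x] by simp
  then have v0: "v x = 0" for x using nsq[of x] by (simp add: usq_def)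
  have "partial i (\<lambda>x. 0 :: real) = (\<lambda>x :: real^'n. 0)" for i by (rule ext) simp
  then have "partial j P x = 0" for j x
    using momentum[rule_format, where x = x and j = j] unfolding divergence_def[abs_def] v0 P_def[abs_def]
    by simp
  then have "\<rho> x powr (\<gamma> - 1) * partial j \<rho> x = 0" for j x using partial_P[of j x] A_pos gamma by simp
  then have or: "\<rho> x = 0 \<or> partial j \<rho> x = 0" for j x by simp
  have "partial j \<rho> x = 0" for j x
  \<comment> \<open>In vacuum the pressure gradient carries no information, since
    \<open>\<rho> x powr (\<gamma> - 1)\<close> is 0 there; but such a point is a minimum of the
    nonnegative density.\<close>
  proof (cases "\<rho> x = 0")
    case True
    have "partial j \<rho> x = 0"
      by (rule DERIV_local_min[OF C1_deriv[OF rho], of 1]) (use True rho_nonneg in auto)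
    then show ?thesis .
  qed (use or in blast)
  then have "\<exists>c. \<forall>x. \<rho> x = c" by (intro zero_const rho_smooth)
  with v0 show ?thesis by blast
qed

end
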